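(* Let $f\in H^2(\mathbb{B})$. Then the following are equivalent: (i) $f$ is inner; (ii) $\widetilde f\ast f^c=f^c\ast\widetilde f=1$ $\Sigma$-almost everywhere on $\partial\mathbb{B}$; (iii) there exists $I\in\mathbb{S}$ such that $(\widetilde f\ast f^c)_I=(f^c\ast\widetilde f)_I=1$ almost everywhere with respect to the induced Lebesgue measure on $\partial\mathbb{B}_I$.
   Context: $\mathbb{H}$ is the skew field of quaternions, $\mathbb{B}=\{q\in\mathbb{H}:|q|<1\}$, and $\mathbb{S}=\{q\in\mathbb{H}:q^2=-1\}$. For $I\in\mathbb{S}$, $L_I=\mathbb{R}+\mathbb{R}I\cong\mathbb{C}$, $\mathbb{B}_I=\mathbb{B}\cap L_I$, $\partial\mathbb{B}_I=\partial\mathbb{B}\cap L_I$ (the unit circle of $L_I$), and a subscript $I$ on a function denotes its restriction to the slice $L_I$. A function $f:\mathbb{B}\to\mathbb{H}$ is slice regular if, for every $I\in\mathbb{S}$, the restriction $f_I$ to $\mathbb{B}_I$ has continuous partial derivatives and $\frac12(\partial_x+I\partial_y)f_I(x+yI)=0$ on $\mathbb{B}_I$; equivalently $f(q)=\sum_{n\ge0}q^na_n$ on $\mathbb{B}$ with $a_n\in\mathbb{H}$. $\mathbb{N}$ includes $0$. $H^2(\mathbb{B})$ is the space of slice regular functions $f(q)=\sum_{n\ge0}q^na_n$ on $\mathbb{B}$ with $(a_n)\in\ell^2(\mathbb{N},\mathbb{H})$. $H^\infty(\mathbb{B})\subseteq H^2(\mathbb{B})$ is the space of bounded slice regular functions on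 $\mathbb{B}$. The boundary $\partial\mathbb{B}=\{e^{tI}=\cos t+\sin t\,I: I\in\mathbb{S},t\in\mathbb{R}\}$ carries the measure $d\Sigma(e^{tI})=d\sigma(I)\,dt$, where $dt$ is Lebesgue measure on $[0,2\pi)$ and $d\sigma$ is the standard area element of the $2$-sphere $\mathbb{S}$, normalized so that $\Sigma(\partial\mathbb{B})=1$. Every $f\in H^2(\mathbb{B})$ has boundary values $\Sigma$-a.e. on $\partial\mathbb{B}$ (and a.e. on each circle $\partial\mathbb{B}_I$), given by radial limits and still denoted by $f$. A function $\varphi\in H^\infty(\mathbb{B})$ is inner if $|\varphi(q)|\le1$ on $\mathbb{B}$ and $|\varphi(q)|=1$ for $\Sigma$-a.e. $q\in\partial\mathbb{B}$. For $f(q)=\sum_{n\ge0}q^na_n$, the conjugate is $f^c(q)=\sum_{n\ge0}q^n\overline{a_n}$, and $\widetilde f(q)=f(\overline q)$, so that on $\partial\mathbb{B}$ one has $\widetilde f(q)=\sum_{n\le0}q^na_{-n}$. Slice $L^2$ functions on $\partial\mathbb{B}$ are the functions $q\mapsto\sum_{n\in\mathbb{Z}}q^na_n$ with $(a_n)_{n\in\mathbb{Z}}\in\ell^2(\mathbb{Z},\mathbb{H})$; for two such functions $f=\sum_{n\in\mathbb{Z}}q^na_n$ and $g=\sum_{n\in\mathbb{Z}}q^nb_n$, the $\ast$-product is $$f\ast g(q)=\sum_{n\in\mathbb{Z}}q^n\sum_{k\in\mathbb{Z}}a_kb_{n-k},$$ understood as the function on $\partial\mathbb{B}$ whose restriction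 to each circle $\partial\mathbb{B}_I$ is the integrable function with these (right) Fourier coefficients. *)

theory Defs
  imports "HOL-Analysis.Analysis"
begin

section \<open>Quaternions\<close>

datatype quat = Quat (qRe: real) (qIm1: real) (qIm2: real) (qIm3: real)

lemma quat_eq_iff:
  "p = q \<longleftrightarrow> qRe p = qRe q \<and> qIm1 p = qIm1 q \<and> qIm2 p = qIm2 q \<and> qIm3 p = qIm3 q"
  by (cases p; cases q) simp

instantiation quat :: ab_group_add
begin

definition "0 = Quat 0 0 0 0"
definition "p + q = Quat (qRe p + qRe q) (qIm1 p + qIm1 q) (qIm2 p + qIm2 q) (qIm3 p + qIm3 q)"
definition "- p = Quat (- qRe p) (- qIm1 p) (- qIm2 p) (- qIm3 p)"
definition "p - q = Quat (qRe p - qRe q) (qIm1 p - qIm1 q) (qIm2 p - qIm2 q) (qIm3 p - qIm3 q)"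

instance
  by standard
    (simp_all add: quat_eq_iff zero_quat_def plus_quat_def uminus_quat_def minus_quat_def)

end

lemma quat_additive_simps [simp]:
  "qRe 0 = 0" "qIm1 0 = 0" "qIm2 0 = 0" "qIm3 0 = 0"
  "qRe (p + q) = qRe p + qRe q" "qIm1 (p + q) = qIm1 p + qIm1 q"
  "qIm2 (p + q) = qIm2 p + qIm2 q" "qIm3 (p + q) = qIm3 p + qIm3 q"
  "qRe (- p) = - qRe p" "qIm1 (- p) = - qIm1 p"
  "qIm2 (- p) = - qIm2 p" "qIm3 (- p) = - qIm3 p"
  "qRe (p - q) = qRe p - qRe q" "qIm1 (p - q) = qIm1 p - qIm1 q"
  "qIm2 (p - q) = qIm2 p - qIm2 q" "qIm3 (p - q) = qIm3 p - qIm3 q"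
  by (simp_all add: zero_quat_def plus_quat_def uminus_quat_def minus_quat_def)

instantiation quat :: real_algebra_1
begin

definition "1 = Quat 1 0 0 0"
definition "p * q = Quat
  (qRe p * qRe q - qIm1 p * qIm1 q - qIm2 p * qIm2 q - qIm3 p * qIm3 q)
  (qRe p * qIm1 q + qIm1 p * qRe q + qIm2 p * qIm3 q - qIm3 p * qIm2 q)
  (qRe p * qIm2 q - qIm1 p * qIm3 q + qIm2 p * qRe q + qIm3 p * qIm1 q)
  (qRe p * qIm3 q + qIm1 p * qIm2 q - qIm2 p * qIm1 q + qIm3 p * qRe q)"
definition "scaleR r p = Quat (r * qRe p) (r * qIm1 p) (r * qIm2 p) (r * qIm3 p)" for r :: real

instance
  by standard
    (simp_all add: quat_eq_iff one_quat_def times_quat_def scaleR_quat_def algebra_simps)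

end

lemma quat_mult_simps [simp]:
  "qRe 1 = 1" "qIm1 1 = 0" "qIm2 1 = 0" "qIm3 1 = 0"
  "qRe (p * q) = qRe p * qRe q - qIm1 p * qIm1 q - qIm2 p * qIm2 q - qIm3 p * qIm3 q"
  "qIm1 (p * q) = qRe p * qIm1 q + qIm1 p * qRe q + qIm2 p * qIm3 q - qIm3 p * qIm2 q"
  "qIm2 (p * q) = qRe p * qIm2 q - qIm1 p * qIm3 q + qIm2 p * qRe q + qIm3 p * qIm1 q"
  "qIm3 (p * q) = qRe p * qIm3 q + qIm1 p * qIm2 q - qIm2 p * qIm1 q + qIm3 p * qRe q"
  "qRe (r *\<^sub>R p) = r * qRe p" "qIm1 (r *\<^sub>R p) = r * qIm1 p"
  "qIm2 (r *\<^sub>R p) = r * qIm2 p" "qIm3 (r *\<^sub>R p) = r * qIm3 p"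
  by (simp_all add: one_quat_def times_quat_def scaleR_quat_def)

lemma quat_of_real_simps [simp]:
  "qRe (of_real r) = r" "qIm1 (of_real r) = 0" "qIm2 (of_real r) = 0" "qIm3 (of_real r) = 0"
  by (simp_all add: of_real_def)

definition qcnj :: "quat \<Rightarrow> quat" where
  "qcnj q = Quat (qRe q) (- qIm1 q) (- qIm2 q) (- qIm3 q)"

instantiation quat :: real_inner
begin

definition "inner p q = qRe p * qRe q + qIm1 p * qIm1 q + qIm2 p * qIm2 q + qIm3 p * qIm3 q"
definition "norm (p :: quat) = sqrt (inner p p)"
definition "sgn (p :: quat) = inverse (norm p) *\<^sub>R p"
definition "dist p q = norm (p - q)" for p q :: quat
definition "(uniformity :: (quat \<times> quat) filter) = (INF e\<in>{0<..}. principal {(x, y). dist x y < e})"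
definition "open (U :: quat set) \<longleftrightarrow>
  (\<forall>x\<in>U. \<forall>\<^sub>F (x', y) in uniformity. x' = x \<longrightarrow> y \<in> U)"

instance
proof
  fix p q r :: quat and c :: real
  show "inner p q = inner q p" "inner (p + q) r = inner p r + inner q r"
    "inner (c *\<^sub>R p) q = c * inner p q"
    by (simp_all add: inner_quat_def algebra_simps)
  show "0 \<le> inner p p"
    by (simp add: inner_quat_def)
  show "inner p p = 0 \<longleftrightarrow> p = 0"
  proof -
    have "inner p p = (qRe p)\<^sup>2 + (qIm1 p)\<^sup>2 + (qIm2 p)\<^sup>2 + (qIm3 p)\<^sup>2"
      by (simp add: inner_quat_def power2_eq_square)
    then show ?thesis
      by (auto simp: quat_eq_iff add_nonneg_eq_0_iff)
  qed
qed (rule norm_quat_def sgn_quat_def dist_quat_def uniformity_quat_def open_quat_def)+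

end

instantiation quat :: real_normed_div_algebra
begin

definition "inverse q = inverse ((norm q)\<^sup>2) *\<^sub>R qcnj q"
definition "p div q = p * inverse q" for p q :: quat

instance
proof
  have n2: "(norm q)\<^sup>2 = qRe q * qRe q + qIm1 q * qIm1 q + qIm2 q * qIm2 q + qIm3 q * qIm3 q"
    for q :: quat
    by (simp add: power2_norm_eq_inner inner_quat_def)
  have cnj: "qcnj q * q = of_real ((norm q)\<^sup>2)" "q * qcnj q = of_real ((norm q)\<^sup>2)" for q
    unfolding n2 by (simp_all add: quat_eq_iff qcnj_def algebra_simps)
  fix p q :: quat
  show "inverse q * q = 1" "q * inverse q = 1" if "q \<noteq> 0"
  proof -
    have "inverse ((norm q)\<^sup>2) * (norm q)\<^sup>2 = 1"
      using that by (intro left_inverse) simp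
    then have "inverse ((norm q)\<^sup>2) *\<^sub>R of_real ((norm q)\<^sup>2) = (1 :: quat)"
      by (metis of_real_1 of_real_mult scaleR_conv_of_real)
    then show "inverse q * q = 1" "q * inverse q = 1"
      by (simp_all only: inverse_quat_def mult_scaleR_left mult_scaleR_right cnj)
  qed
  show "p div q = p * inverse q"
    by (rule divide_quat_def)
  show "inverse (0 :: quat) = 0"
    by (simp add: inverse_quat_def)
  have "(norm (p * q))\<^sup>2 = (norm p * norm q)\<^sup>2"
    unfolding power_mult_distrib n2 by (simp add: algebra_simps)
  then show "norm (p * q) = norm p * norm q"
    by (simp add: power2_eq_iff_nonneg)
qed

end

instantiation quat :: euclidean_space
begin

definition "Basis = {Quat 1 0 0 0, Quat 0 1 0 0, Quat 0 0 1 0, Quat 0 0 0 1}"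

instance
proof
  show "(Basis :: quat set) \<noteq> {}" "finite (Basis :: quat set)"
    unfolding Basis_quat_def by blast+
  show "inner u v = (if u = v then 1 else 0)" if "u \<in> Basis" "v \<in> Basis" for u v :: quat
    using that unfolding Basis_quat_def insert_iff empty_iff inner_quat_def
    by (elim disjE FalseE; hypsubst; simp)
  have "(\<forall>u\<in>Basis. inner x u = 0) \<longleftrightarrow> qRe x = 0 \<and> qIm1 x = 0 \<and> qIm2 x = 0 \<and> qIm3 x = 0"
    for x :: quat
    unfolding Basis_quat_def inner_quat_def by simp
  then show "(\<forall>u\<in>Basis. inner x u = 0) \<longleftrightarrow> x = 0" for x :: quat
    by (simp only: quat_eq_iff[of x 0] quat_additive_simps)
qed

end

section \<open>Slices and slice regular functions\<close>

definition imag_units :: "quat set" where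
  "imag_units = {q. q\<^sup>2 = - 1}"

definition slice :: "quat \<Rightarrow> quat set" where
  "slice I = {of_real x + y *\<^sub>R I | x y. True}"

text \<open>Functions on the unit ball are total functions whose values off the ball are irrelevant.\<close>

definition slice_regular :: "(quat \<Rightarrow> quat) \<Rightarrow> bool" where
  "slice_regular f \<longleftrightarrow> (\<forall>I\<in>imag_units.
     let D = {(x, y). of_real x + y *\<^sub>R I \<in> ball 0 1} in
     \<exists>fx fy. continuous_on D fx \<and> continuous_on D fy \<and>
       (\<forall>(x, y)\<in>D.
          ((\<lambda>s. f (of_real s + y *\<^sub>R I)) has_vector_derivative fx (x, y)) (at x) \<and>
          ((\<lambda>t. f (of_real x + t *\<^sub>R I)) has_vector_derivative fy (x, y)) (at y) \<and>
          (1/2) *\<^sub>R (fx (x, y) + I * fy (x, y)) = 0))"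

definition has_power_series :: "(quat \<Rightarrow> quat) \<Rightarrow> (nat \<Rightarrow> quat) \<Rightarrow> bool" where
  "has_power_series f a \<longleftrightarrow> (\<forall>q\<in>ball 0 1. (\<lambda>n. q ^ n * a n) sums f q)"

definition power_series_coeffs :: "(quat \<Rightarrow> quat) \<Rightarrow> nat \<Rightarrow> quat" where
  "power_series_coeffs f = (THE a. has_power_series f a)"

definition hardy2 :: "(quat \<Rightarrow> quat) set" where
  "hardy2 = {f. slice_regular f \<and>
     (\<exists>a. has_power_series f a \<and> summable (\<lambda>n. (norm (a n))\<^sup>2))}"

definition hardy_inf :: "(quat \<Rightarrow> quat) set" where
  "hardy_inf = {f. slice_regular f \<and> bounded (f ` ball 0 1)}"

definition regular_conj :: "(quat \<Rightarrow> quat) \<Rightarrow> quat \<Rightarrow> quat" where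
  "regular_conj f q = (\<Sum>n. q ^ n * qcnj (power_series_coeffs f n))"

definition tilde :: "(quat \<Rightarrow> quat) \<Rightarrow> quat \<Rightarrow> quat" where
  "tilde f q = f (qcnj q)"

section \<open>The boundary of the unit ball\<close>

definition boundary_value :: "(quat \<Rightarrow> quat) \<Rightarrow> quat \<Rightarrow> quat" where
  "boundary_value f q = Lim (at_left 1) (\<lambda>r. f (r *\<^sub>R q))"

definition quat_cis :: "quat \<Rightarrow> real \<Rightarrow> quat" where
  "quat_cis I t = of_real (cos t) + sin t *\<^sub>R I"

text \<open>Arc length on the unit circle of the slice of \<open>I\<close>.\<close>

definition circle_measure :: "quat \<Rightarrow> quat measure" where
  "circle_measure I =
     distr (restrict_space lborel {0..<2 * pi}) (restrict_space borel (sphere 0 1 \<inter> slice I))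
       (quat_cis I)"

text \<open>In spherical coordinates the area element of the 2-sphere is
  \<open>sin \<theta> d\<theta> d\<phi>\<close>; the total area is \<open>4 \<pi>\<close>.\<close>

definition imag_unit_of_angles :: "real \<times> real \<Rightarrow> quat" where
  "imag_unit_of_angles = (\<lambda>(\<theta>, \<phi>). Quat 0 (sin \<theta> * cos \<phi>) (sin \<theta> * sin \<phi>) (cos \<theta>))"

definition imag_units_area :: "quat measure" where
  "imag_units_area =
     distr (density (restrict_space lborel ({0..pi} \<times> {0..<2 * pi})) (\<lambda>(\<theta>, \<phi>). ennreal (sin \<theta>)))
       (restrict_space borel imag_units) imag_unit_of_angles"

definition boundary_measure :: "quat measure" where
  "boundary_measure = scale_measure (ennreal (1 / (2 * pi * (4 * pi))))
     (distr (restrict_space lborel {0..<2 * pi} \<Otimes>\<^sub>M imag_units_area)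
       (restrict_space borel (sphere 0 1)) (\<lambda>(t, I). quat_cis I t))"

text \<open>The parametrizations are measurable, so the image measures above are the intended ones, and
  the normalization is right.\<close>

lemma imag_units_iff:
  "q \<in> imag_units \<longleftrightarrow> qRe q = 0 \<and> (qIm1 q)\<^sup>2 + (qIm2 q)\<^sup>2 + (qIm3 q)\<^sup>2 = 1"
proof -
  have "q\<^sup>2 = -1 \<longleftrightarrow> (qRe q)\<^sup>2 - (qIm1 q)\<^sup>2 - (qIm2 q)\<^sup>2 - (qIm3 q)\<^sup>2 = -1
     \<and> qRe q * qIm1 q = 0 \<and> qRe q * qIm2 q = 0 \<and> qRe q * qIm3 q = 0"
    by (auto simp: quat_eq_iff power2_eq_square)
  also have "\<dots> \<longleftrightarrow> qRe q = 0 \<and> (qIm1 q)\<^sup>2 + (qIm2 q)\<^sup>2 + (qIm3 q)\<^sup>2 = 1"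
  proof (cases "qRe q = 0")
    case False
    have "(qRe q)\<^sup>2 \<noteq> -1" using zero_le_power2[of "qRe q"] by linarith
    then show ?thesis using False by auto
  qed auto
  finally show ?thesis by (simp add: imag_units_def)
qed

lemma norm_quat_sq: "(norm q)\<^sup>2 = (qRe q)\<^sup>2 + (qIm1 q)\<^sup>2 + (qIm2 q)\<^sup>2 + (qIm3 q)\<^sup>2"
  unfolding power2_norm_eq_inner by (simp add: inner_quat_def power2_eq_square)

lemma norm_quat_cis: assumes "I \<in> imag_units" shows "norm (quat_cis I t) = 1"
proof -
  have "(norm (quat_cis I t))\<^sup>2 = (cos t)\<^sup>2 + (sin t)\<^sup>2 * ((qIm1 I)\<^sup>2 + (qIm2 I)\<^sup>2 + (qIm3 I)\<^sup>2)"
    using conjunct1[OF assms[unfolded imag_units_iff]] unfolding norm_quat_sq quat_cis_def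
    by (simp add: power_mult_distrib ring_distribs del: sin_cos_squared_add sin_cos_squared_add2)
  also have "\<dots> = 1" using assms unfolding imag_units_iff by simp
  finally show ?thesis by (simp add: power2_eq_1_iff) (smt (verit) norm_ge_zero)
qed

lemma continuous_quat_cis: "continuous_on UNIV (\<lambda>(t, I). quat_cis I t)"
  unfolding quat_cis_def case_prod_beta
  by (intro continuous_intros)

lemma quat_cis_measurable:
  assumes "I \<in> imag_units"
  shows "quat_cis I \<in> measurable (restrict_space lborel {0..<2 * pi}) (restrict_space borel (sphere 0 1 \<inter> slice I))"
proof (intro measurable_restrict_space3)
  have "continuous_on UNIV (quat_cis I)" unfolding quat_cis_def by (intro continuous_intros)
  then show "quat_cis I \<in> lborel \<rightarrow>\<^sub>M borel" by (simp add: borel_measurable_continuous_onI)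
  show "quat_cis I \<in> {0..<2 * pi} \<rightarrow> sphere 0 1 \<inter> slice I"
    using assms norm_quat_cis[OF assms] by (auto simp: slice_def quat_cis_def; blast)
qed

lemma imag_unit_of_angles_in: "imag_unit_of_angles x \<in> imag_units"
proof -
  obtain a b where [simp]: "x = (a, b)" by fastforce
  have "(sin a * cos b)\<^sup>2 + (sin a * sin b)\<^sup>2 = (sin a)\<^sup>2 * ((cos b)\<^sup>2 + (sin b)\<^sup>2)"
    by (simp add: power_mult_distrib algebra_simps del: sin_cos_squared_add sin_cos_squared_add2)
  then show ?thesis by (simp add: imag_units_iff imag_unit_of_angles_def)
qed

lemma imag_unit_of_angles_measurable:
  "imag_unit_of_angles \<in> measurable (restrict_space lborel S) (restrict_space borel imag_units)"
proof (intro measurable_restrict_space3)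
  have "imag_unit_of_angles = (\<lambda>x. (sin (fst x) * cos (snd x)) *\<^sub>R Quat 0 1 0 0 +
     (sin (fst x) * sin (snd x)) *\<^sub>R Quat 0 0 1 0 + cos (fst x) *\<^sub>R Quat 0 0 0 1)"
    by (auto simp: imag_unit_of_angles_def fun_eq_iff quat_eq_iff)
  moreover have "continuous_on UNIV \<dots>" by (intro continuous_intros)
  ultimately have "continuous_on UNIV imag_unit_of_angles" by metis
  then show "imag_unit_of_angles \<in> lborel \<rightarrow>\<^sub>M borel" by (simp add: borel_measurable_continuous_onI)
qed (simp add: imag_unit_of_angles_in)

lemma emeasure_imag_units_area:
  "emeasure imag_units_area (space imag_units_area) = ennreal (4 * pi)"
proof -
  let ?S = "{0..pi} \<times> {0..<2 * pi} :: (real \<times> real) set"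
  have S: "?S \<in> sets lborel" unfolding sets_lborel borel_prod[symmetric] by (intro pair_measureI) auto
  have m: "(\<lambda>(\<theta>, \<phi>). ennreal (sin \<theta>)) \<in> borel_measurable (restrict_space lborel ?S)"
  proof (rule measurable_restrict_space1)
    have "(\<lambda>x::real \<times> real. sin (fst x)) \<in> borel_measurable borel"
      by (intro borel_measurable_continuous_onI continuous_intros)
    then show "(\<lambda>(\<theta>, \<phi> :: real). ennreal (sin \<theta>)) \<in> borel_measurable lborel"
      by (simp add: case_prod_beta)
  qed
  have "emeasure imag_units_area (space imag_units_area)
    = emeasure (density (restrict_space lborel ?S) (\<lambda>(\<theta>, \<phi>). ennreal (sin \<theta>))) ?S"
  proof -
    have "imag_unit_of_angles -` imag_units \<inter> ?S = ?S" using imag_unit_of_angles_in by auto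
    then show ?thesis
      unfolding imag_units_area_def using imag_unit_of_angles_measurable[of ?S]
      by (subst emeasure_distr) (auto simp: space_restrict_space measurable_density_eq1 sets_restrict_space intro: image_eqI[of _ _ UNIV])
  qed
  also have "\<dots> = (\<integral>\<^sup>+x. (case x of (\<theta>, \<phi>) \<Rightarrow> ennreal (sin \<theta>)) * indicator ?S x \<partial>restrict_space lborel ?S)"
    using m S by (subst emeasure_density) (auto simp: sets_restrict_space_iff)
  also have "\<dots> = (\<integral>\<^sup>+x. (ennreal (sin (fst x)) * indicator {0..pi} (fst x)) * indicator {0..<2*pi} (snd x) \<partial>(lborel \<Otimes>\<^sub>M lborel))"
    unfolding lborel_prod using S
    by (subst nn_integral_restrict_space) (auto intro!: nn_integral_cong simp: indicator_def split: prod.splits)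
  also have "\<dots> = (\<integral>\<^sup>+x. (\<integral>\<^sup>+y. (ennreal (sin x) * indicator {0..pi} x) * indicator {0..<2*pi} y \<partial>lborel) \<partial>lborel)"
    by (subst lborel.nn_integral_fst[symmetric]) (auto simp: case_prod_beta)
  also have "\<dots> = (\<integral>\<^sup>+x. (ennreal (sin x) * indicator {0..pi} x) \<partial>lborel) * ennreal (2*pi)"
    by (simp add: nn_integral_cmult nn_integral_multc)
  also have "(\<integral>\<^sup>+x. (ennreal (sin x) * indicator {0..pi} x) \<partial>lborel) = ennreal ((- cos pi) - (- cos 0))"
    by (rule nn_integral_FTC_Icc) (auto intro!: derivative_eq_intros sin_ge_zero)
  also have "ennreal (- cos pi - - cos 0) * ennreal (2 * pi) = ennreal (4 * pi)"
    by (subst ennreal_mult[symmetric]) auto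
  finally show ?thesis .
qed

lemma quat_cis_pair_measurable:
  "(\<lambda>(t, I). quat_cis I t) \<in> measurable (restrict_space lborel {0..<2 * pi} \<Otimes>\<^sub>M imag_units_area) (restrict_space borel (sphere 0 1))"
proof (rule measurable_restrict_space2)
  have [measurable_cong]: "sets imag_units_area = sets (restrict_space borel imag_units)"
    by (simp add: imag_units_area_def)
  have [measurable]: "(\<lambda>x. x) \<in> imag_units_area \<rightarrow>\<^sub>M borel"
    by (subst measurable_cong_sets[OF \<open>sets imag_units_area = _\<close> refl]) (simp add: measurable_restrict_space1)
  have [measurable]: "(\<lambda>x. x) \<in> restrict_space lborel {0..<2*pi} \<rightarrow>\<^sub>M borel"
    by (simp add: measurable_restrict_space1)
  have "(\<lambda>(t, I). quat_cis I t) \<in> borel \<Otimes>\<^sub>M borel \<rightarrow>\<^sub>M borel"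
    unfolding borel_prod using continuous_quat_cis by (rule borel_measurable_continuous_onI)
  then have [measurable]: "(\<lambda>(t, I). quat_cis I t) \<in> borel_measurable (borel \<Otimes>\<^sub>M borel)" .
  have "(\<lambda>x. (\<lambda>(t, I). quat_cis I t) (fst x, snd x)) \<in> restrict_space lborel {0..<2 * pi} \<Otimes>\<^sub>M imag_units_area \<rightarrow>\<^sub>M borel"
    by (rule measurable_compose[of "\<lambda>x. (fst x, snd x)" _ "borel \<Otimes>\<^sub>M borel"])
      (intro measurable_Pair measurable_compose[OF measurable_fst \<open>(\<lambda>x. x) \<in> restrict_space lborel _ \<rightarrow>\<^sub>M borel\<close>]
        measurable_compose[OF measurable_snd \<open>(\<lambda>x. x) \<in> imag_units_area \<rightarrow>\<^sub>M borel\<close>], fact)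
  then show "(\<lambda>(t, I). quat_cis I t) \<in> restrict_space lborel {0..<2 * pi} \<Otimes>\<^sub>M imag_units_area \<rightarrow>\<^sub>M borel" by simp
  show "(\<lambda>(t, I). quat_cis I t) \<in> space (restrict_space lborel {0..<2 * pi} \<Otimes>\<^sub>M imag_units_area) \<rightarrow> sphere 0 1"
    by (auto simp: space_pair_measure imag_units_area_def space_restrict_space norm_quat_cis)
qed

lemma emeasure_boundary_measure: "emeasure boundary_measure (space boundary_measure) = 1"
proof -
  interpret finite_measure imag_units_area
    using emeasure_imag_units_area by (intro finite_measureI) auto
  let ?M = "restrict_space lborel {0..<2 * pi} \<Otimes>\<^sub>M imag_units_area"
  have "emeasure ?M (space ?M) = ennreal (2 * pi) * ennreal (4 * pi)"
    unfolding space_pair_measure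
    by (subst emeasure_pair_measure_Times[OF sets.top sets.top])
      (simp add: emeasure_imag_units_area emeasure_restrict_space space_restrict_space)
  moreover have "(\<lambda>(t, I). quat_cis I t) -` sphere 0 1 \<inter> space ?M = space ?M"
    using measurable_space[OF quat_cis_pair_measurable] by (auto simp: space_restrict_space)
  ultimately have "emeasure (distr ?M (restrict_space borel (sphere 0 1)) (\<lambda>(t, I). quat_cis I t))
      (sphere 0 1) = ennreal (2 * pi) * ennreal (4 * pi)"
    using quat_cis_pair_measurable by (subst emeasure_distr) (auto simp: sets_restrict_space)
  then have "emeasure boundary_measure (space boundary_measure) =
      ennreal (1 / (2 * pi * (4 * pi))) * (ennreal (2 * pi) * ennreal (4 * pi))"
    by (simp only: boundary_measure_def emeasure_scale_measure space_scale_measure space_distr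
      space_restrict_space space_borel Int_UNIV_right)
  also have "\<dots> = ennreal (1 / (2 * pi * (4 * pi)) * (2 * pi * (4 * pi)))"
    by (subst ennreal_mult[symmetric], simp, simp)+ (rule refl)
  also have "\<dots> = 1"
    by simp
  finally show ?thesis .
qed

definition inner_function :: "(quat \<Rightarrow> quat) \<Rightarrow> bool" where
  "inner_function \<phi> \<longleftrightarrow> \<phi> \<in> hardy_inf \<and> (\<forall>q\<in>ball 0 1. norm (\<phi> q) \<le> 1) \<and>
     (AE q in boundary_measure. norm (boundary_value \<phi> q) = 1)"

section \<open>The slice product of functions on the boundary\<close>

text \<open>\<open>F\<close> is the boundary function \<open>\<Sum> q\<^sup>n a\<^sub>n\<close>, the sum ranging over all integers: on every
  circle \<open>F\<close> is integrable with right Fourier coefficients \<open>a\<close>.\<close>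

definition has_fourier_coeffs :: "(quat \<Rightarrow> quat) \<Rightarrow> (int \<Rightarrow> quat) \<Rightarrow> bool" where
  "has_fourier_coeffs F a \<longleftrightarrow> (\<forall>I\<in>imag_units. integrable (circle_measure I) F \<and>
     (\<forall>n. (1 / (2 * pi)) *\<^sub>R (\<integral>q. q powi (- n) * F q \<partial>circle_measure I) = a n))"

definition fourier_coeffs :: "(quat \<Rightarrow> quat) \<Rightarrow> int \<Rightarrow> quat" where
  "fourier_coeffs F = (THE a. has_fourier_coeffs F a)"

text \<open>The coefficients determine a function on each circle only up to a null set of that circle.
  Distinct circles being uncountably many, the representatives on them have to be chosen in a
  jointly measurable way; any two such choices agree almost everywhere on every circle and, by
  Fubini, almost everywhere for \<^const>\<open>boundary_measure\<close>.\<close>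

definition slice_prod :: "(quat \<Rightarrow> quat) \<Rightarrow> (quat \<Rightarrow> quat) \<Rightarrow> quat \<Rightarrow> quat"
    (infixl \<open>\<star>\<close> 70) where
  "F \<star> G = (SOME H. H \<in> borel_measurable (restrict_space borel (sphere 0 1)) \<and>
     has_fourier_coeffs H
       (\<lambda>n. \<Sum>\<^sub>\<infinity>k. fourier_coeffs F k * fourier_coeffs G (n - k)))"

end

theory Submission
  imports Defs
begin

text \<open>Let \<open>f(q) = \<Sum> q\<^sup>n a\<^sub>n\<close> with square-summable coefficients, and put \<open>A(t) = \<Sum> cos (n t) a\<^sub>n\<close> and
  \<open>B(t) = \<Sum> sin (n t) a\<^sub>n\<close>, which converge in the mean square.  The pair \<open>U = (A, B)\<close>, written \<open>A + \<iota> B\<close>, is the stem of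
  the boundary function: for almost every \<open>t\<close> one has \<open>f(exp (t I)) = A(t) + I B(t)\<close> for all imaginary units \<open>I\<close>.  The point is
  that the stem does not depend on \<open>I\<close>, and that slice products become products of stems in the complexified quaternions.

  From \<open>|A + I B|\<^sup>2 = |A|\<^sup>2 + |B|\<^sup>2 + 2 \<langle>I, A B\<^sup>c\<rangle>\<close>, with \<open>c\<close> denoting conjugation, \<open>|f| = 1\<close> holds almost everywhere on
  the boundary if and only if, for almost every \<open>t\<close>, \<open>|A|\<^sup>2 + |B|\<^sup>2 = 1\<close> and \<open>A B\<^sup>c\<close> is real.  On the other hand the stem of
  the product of \<open>f(q\<^sup>c)\<close> with the regular conjugate of \<open>f\<close> is
  \<open>(A - \<iota> B) (A\<^sup>c + \<iota> B\<^sup>c) = |A|\<^sup>2 + |B|\<^sup>2 + \<iota> (A B\<^sup>c - B A\<^sup>c)\<close>, so the same condition says that this product is \<open>1\<close>; the product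
  in the other order is then \<open>1\<close> as well.  If the product is \<open>1\<close> almost everywhere on a single circle, then comparing the
  values at \<open>t\<close> and \<open>2 \<pi> - t\<close> gives the condition on the stem, hence the statement on all circles.  This condition also
  gives \<open>|f| \<le> 1\<close> in the ball, where \<open>f\<close> is the Poisson integral of its boundary values on a circle.

  The analytic part rests on three results.  Fatou's theorem \<open>poisson_integral_tendsto_AE\<close> gives the radial limits, and
  also the uniqueness of the Fourier coefficients of an integrable function (\<open>trig_moments_zero_imp_AE_zero\<close>).  Completeness
  of the square-integrable functions (\<open>L2_complete\<close>) gives the stem.  The convolution theorem
  \<open>stem_mult_has_stem_coeffs\<close>, together with the existence of a Borel function on the sphere with prescribed stem
  (\<open>boundary_stem_exists\<close>), identifies the slice product (\<open>slice_prod_stem\<close>).\<close>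

section \<open>The Poisson kernel\<close>

text \<open>The Poisson kernel \<open>P\<^sub>r(s) = 1 + 2 (\<Sum>n\<ge>1. r\<^sup>n cos (n s))\<close> of the unit disc, in closed form.  It is
  not divided by \<open>2 \<pi>\<close>: its integral over a period is \<open>2 \<pi>\<close>.\<close>

definition poisson :: "real \<Rightarrow> real \<Rightarrow> real" where
  "poisson r s = (1 - r\<^sup>2) / (1 - 2 * r * cos s + r\<^sup>2)"

lemma poisson_denominator_pos:
  fixes r s :: real
  assumes "\<bar>r\<bar> < 1"
  shows "0 < 1 - 2 * r * cos s + r\<^sup>2"
proof -
  have "1 - 2 * r * cos s + r\<^sup>2 = (1 - r * cos s)\<^sup>2 + (r * sin s)\<^sup>2"
  proof -
    have "(r * sin s)\<^sup>2 = r\<^sup>2 * (1 - (cos s)\<^sup>2)"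
      by (simp only: power_mult_distrib sin_squared_eq)
    then show ?thesis by (simp add: power2_eq_square algebra_simps)
  qed
  moreover have "\<bar>r * cos s\<bar> < 1"
    using assms abs_cos_le_one[of s] mult_left_mono[of "\<bar>cos s\<bar>" 1 "\<bar>r\<bar>"] by (simp add: abs_mult)
  then have "0 < (1 - r * cos s)\<^sup>2" by simp
  ultimately show ?thesis by (simp add: add_pos_nonneg)
qed

lemma poisson_nonneg: "\<bar>r\<bar> < 1 \<Longrightarrow> 0 \<le> poisson r s"
  using poisson_denominator_pos[of r s] unfolding poisson_def
  by (intro divide_nonneg_pos) (simp_all add: abs_square_le_1)

lemma poisson_minus [simp]: "poisson r (- s) = poisson r s"
  by (simp add: poisson_def)

lemma poisson_series:
  assumes "\<bar>r\<bar> < 1"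
  shows "(\<lambda>n. r ^ n * cos (real n * s)) sums ((1 + poisson r s) / 2)"
proof -
  define z where "z = of_real r * cis s"
  have "norm z < 1" using assms by (simp add: z_def norm_mult)
  then have "(\<lambda>n. Re (z ^ n)) sums Re (1 / (1 - z))"
    by (intro sums_Re geometric_sums)
  moreover have "Re (z ^ n) = r ^ n * cos (real n * s)" for n
    by (simp add: z_def power_mult_distrib Complex.DeMoivre flip: of_real_power)
  moreover have "Re (1 / (1 - z)) = (1 + poisson r s) / 2"
  proof -
    have "(r * sin s)\<^sup>2 = r\<^sup>2 * (1 - (cos s)\<^sup>2)"
      by (simp only: power_mult_distrib sin_squared_eq)
    then have e: "(1 - r * cos s)\<^sup>2 + (r * sin s)\<^sup>2 = 1 - 2 * r * cos s + r\<^sup>2"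
      by (simp add: power2_eq_square algebra_simps)
    have "Re (1 / (1 - z)) = (1 - r * cos s) / (1 - 2 * r * cos s + r\<^sup>2)"
      unfolding e[symmetric] by (simp add: Re_divide z_def)
    then show ?thesis using poisson_denominator_pos[OF assms, of s]
      by (simp add: poisson_def field_simps)
  qed
  ultimately show ?thesis by simp
qed

lemma poisson_le:
  assumes r: "0 \<le> r" "r < 1"
  shows "poisson r s \<le> (1 + r) / (1 - r)"
proof -
  have "(1 - r)\<^sup>2 \<le> 1 - 2 * r * cos s + r\<^sup>2"
    using mult_left_mono[OF cos_le_one r(1), of s] by (simp add: power2_eq_square algebra_simps)
  then have "poisson r s \<le> (1 - r\<^sup>2) / (1 - r)\<^sup>2"
    unfolding poisson_def using r by (intro divide_left_mono mult_pos_pos poisson_denominator_pos)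
      (auto simp: power2_eq_square mult_le_one intro!: mult_pos_pos poisson_denominator_pos[unfolded power2_eq_square])
  also have "\<dots> = (1 + r) / (1 - r)"
    using r by (simp add: power2_eq_square divide_simps) (simp add: algebra_simps)
  finally show ?thesis .
qed

lemma poisson_measurable [measurable]: "poisson r \<in> borel_measurable borel"
  unfolding poisson_def by measurable

text \<open>The parameter interval of the unit circles; the measures \<^const>\<open>circle_measure\<close> are
  images of it.\<close>

abbreviation circ :: "real measure" where
  "circ \<equiv> restrict_space lborel {0..<2 * pi}"

lemma finite_measure_circ: "finite_measure circ"
  by (intro finite_measureI) (simp add: emeasure_restrict_space space_restrict_space)

lemma measurable_circ: "f \<in> borel_measurable borel \<Longrightarrow> f \<in> borel_measurable circ"
  by (rule measurable_restrict_space1) simp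

lemma integrable_circ_iff:
  fixes f :: "real \<Rightarrow> 'a::{banach, second_countable_topology}"
  shows "integrable circ f \<longleftrightarrow> integrable lborel (\<lambda>t. indicator {0..<2*pi} t *\<^sub>R f t)"
  by (subst integrable_restrict_space) auto

lemma integral_circ:
  fixes f :: "real \<Rightarrow> 'a::{banach, second_countable_topology}"
  shows "(\<integral>t. f t \<partial>circ) = (\<integral>t. indicator {0..<2*pi} t *\<^sub>R f t \<partial>lborel)"
  by (subst integral_restrict_space) auto

lemma integrable_circ_scaleR_bounded:
  fixes h :: "real \<Rightarrow> 'a::{banach, second_countable_topology}"
  assumes "integrable circ h" "\<phi> \<in> borel_measurable borel" "\<And>s. \<bar>\<phi> s\<bar> \<le> C"
  shows "integrable circ (\<lambda>s. \<phi> s *\<^sub>R h s)"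
proof (rule Bochner_Integration.integrable_bound[OF integrable_scaleR_right[OF assms(1), of C]])
  show "(\<lambda>s. \<phi> s *\<^sub>R h s) \<in> borel_measurable circ"
    by (intro borel_measurable_scaleR measurable_circ assms borel_measurable_integrable[OF assms(1)])
  show "AE s in circ. norm (\<phi> s *\<^sub>R h s) \<le> norm (C *\<^sub>R h s)"
    using assms(3) by (intro AE_I2) (auto intro!: mult_right_mono order_trans[OF assms(3)])
qed

lemma poisson_abs_le:
  assumes r: "0 \<le> r" "r < 1"
  shows "\<bar>poisson r s\<bar> \<le> (1 + r) / (1 - r)"
  using poisson_le[OF r, of s] poisson_nonneg[of r s] r by simp

lemma integrable_poisson:
  fixes h :: "real \<Rightarrow> 'a::{banach, second_countable_topology}"
  assumes "0 \<le> r" "r < 1" "integrable circ h"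
  shows "integrable circ (\<lambda>s. poisson r (t - s) *\<^sub>R h s)"
  using assms by (intro integrable_circ_scaleR_bounded[where C="(1 + r) / (1 - r)"] poisson_abs_le) auto

text \<open>The half sum on the right comes from writing the kernel as
  \<open>P\<^sub>r(s) = 2 (\<Sum>n. r\<^sup>n cos (n s)) - 1\<close>, so that only cosine moments with \<open>n \<ge> 0\<close> occur.\<close>

lemma poisson_integral_series:
  fixes h :: "real \<Rightarrow> 'a::{banach, second_countable_topology}"
  assumes r: "0 \<le> r" "r < 1" and h: "integrable circ h"
  shows "(\<lambda>n. r ^ n *\<^sub>R (\<integral>s. cos (real n * (t - s)) *\<^sub>R h s \<partial>circ)) sums
     ((1/2) *\<^sub>R ((\<integral>s. h s \<partial>circ) + (\<integral>s. poisson r (t - s) *\<^sub>R h s \<partial>circ)))"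
proof -
  let ?f = "\<lambda>n s. (r ^ n * cos (real n * (t - s))) *\<^sub>R h s"
  have i: "integrable circ (?f n)" for n
    using r power_le_one[of r n]
    by (intro integrable_circ_scaleR_bounded[OF h, where C=1])
      (auto simp: abs_mult intro!: mult_le_one)
  have le: "norm (?f n s) \<le> r ^ n * norm (h s)" for n s
    using r by (auto simp: abs_mult intro!: mult_right_mono mult_left_le)
  have s: "summable (\<lambda>n. r ^ n)" using r by simp
  have "(\<lambda>n. \<integral>s. ?f n s \<partial>circ) sums (\<integral>s. (\<Sum>n. ?f n s) \<partial>circ)"
  proof (rule sums_integral[OF i])
    show "AE s in circ. summable (\<lambda>n. norm (?f n s))"
      by (intro AE_I2 summable_comparison_test'[OF summable_mult2[OF s]]) (use le in auto)
    have "(\<integral>s. norm (?f n s) \<partial>circ) \<le> r ^ n * (\<integral>s. norm (h s) \<partial>circ)" for n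
      using integral_mono[OF integrable_norm[OF i[of n]] _ le] h by simp
    then show "summable (\<lambda>n. \<integral>s. norm (?f n s) \<partial>circ)"
      by (intro summable_comparison_test'[OF summable_mult2[OF s, of "\<integral>s. norm (h s) \<partial>circ"]]) auto
  qed
  moreover have "(\<Sum>n. ?f n s) = ((1 + poisson r (t - s)) / 2) *\<^sub>R h s" for s
    using sums_scaleR_left[OF poisson_series[of r "t - s"], of "h s"] r by (simp add: sums_iff)
  moreover have "(\<integral>s. ((1 + poisson r (t - s)) / 2) *\<^sub>R h s \<partial>circ) =
      (1/2) *\<^sub>R ((\<integral>s. h s \<partial>circ) + (\<integral>s. poisson r (t - s) *\<^sub>R h s \<partial>circ))"
  proof -
    have "((1 + poisson r (t - s)) / 2) *\<^sub>R h s = (1/2) *\<^sub>R (h s + poisson r (t - s) *\<^sub>R h s)" for s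
      by (simp add: algebra_simps add_divide_distrib)
    then show ?thesis using h integrable_poisson[OF r h, of t] by simp
  qed
  moreover have "(\<integral>s. ?f n s \<partial>circ) = r ^ n *\<^sub>R (\<integral>s. cos (real n * (t - s)) *\<^sub>R h s \<partial>circ)" for n
    by (simp flip: scaleR_scaleR)
  ultimately show ?thesis by simp
qed

lemma integral_circ_cos:
  assumes "k \<in> \<int>"
  shows "(\<integral>s. cos (k * s + c) \<partial>circ) = (if k = 0 then 2 * pi * cos c else 0)"
proof (cases "k = 0")
  case True
  then show ?thesis by (simp add: measure_restrict_space space_restrict_space)
next
  case False
  obtain m where m: "k = of_int m" using assms by (auto elim: Ints_cases)
  have "(\<integral>s. cos (k * s + c) \<partial>circ) = (\<integral>s. indicator {0..2*pi} s *\<^sub>R cos (k * s + c) \<partial>lborel)"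
    unfolding integral_circ by (intro integral_cong_AE) (auto intro!: AE_I[of _ _ "{2*pi}"] simp: indicator_def)
  also have "\<dots> = sin (k * (2 * pi) + c) / k - sin (k * 0 + c) / k"
    using False
    by (intro integral_FTC_Icc) (auto intro!: derivative_eq_intros continuous_intros simp flip: has_real_derivative_iff_has_vector_derivative)
  also have "sin (k * (2 * pi) + c) = sin c"
    using sin_add[of "of_int m * (2 * pi)" c] by (simp add: m mult.commute[of _ "2*pi"])
  finally show ?thesis using False by simp
qed

lemma integral_poisson:
  assumes r: "0 \<le> r" "r < 1"
  shows "(\<integral>s. poisson r (t - s) \<partial>circ) = 2 * pi"
proof -
  interpret finite_measure circ by (rule finite_measure_circ)
  have "(\<integral>s. cos (real n * (t - s)) \<partial>circ) = (if n = 0 then 2 * pi else 0)" for n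
    using integral_circ_cos[of "- real n" "real n * t"] by (auto simp: algebra_simps)
  then have "(\<lambda>n. r ^ n * (if n = 0 then 2 * pi else 0)) sums ((2 * pi + (\<integral>s. poisson r (t - s) \<partial>circ)) / 2)"
    using poisson_integral_series[OF r, of "\<lambda>_. 1::real" t]
    by (simp add: measure_restrict_space space_restrict_space)
  moreover have "(\<lambda>n. r ^ n * (if n = 0 then 2 * pi else 0)) sums (2 * pi)"
    using sums_single[of 0 "\<lambda>n. r ^ n * (2 * pi)"] by (simp add: if_distrib cong: if_cong)
  ultimately show ?thesis using sums_unique2 by fastforce
qed

section \<open>Lebesgue points on the line\<close>

lemma lborel_integral_translate:
  fixes f :: "real \<Rightarrow> 'a::{banach, second_countable_topology}"
  shows "(\<integral>u. f (x + u) \<partial>lborel) = (\<integral>s. f s \<partial>lborel)"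
  using lborel_integral_real_affine[of 1 f x] by simp

lemma lborel_integral_reflect:
  fixes f :: "real \<Rightarrow> 'a::{banach, second_countable_topology}"
  shows "(\<integral>u. f (x - u) \<partial>lborel) = (\<integral>s. f s \<partial>lborel)"
  using lborel_integral_real_affine[of "-1" f x] by simp

lemma AE_right_lebesgue_derivative:
  fixes h :: "real \<Rightarrow> 'a::euclidean_space"
  assumes h: "integrable lborel h"
  shows "AE x in lborel. \<forall>e>0. \<exists>\<delta>>0. \<forall>d. 0 < d \<and> d < \<delta> \<longrightarrow>
    norm ((\<integral>u. indicator {0..d} u *\<^sub>R h (x + u) \<partial>lborel) - d *\<^sub>R h x) \<le> e * d"
proof -
  have si: "set_integrable lborel {a..b} h" for a b
    using h unfolding set_integrable_def by (intro integrable_mult_indicator) auto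
  have i: "h integrable_on cbox a b" for a b
    using set_borel_integral_eq_integral(1)[OF si] by (simp add: cbox_interval)
  obtain N where N: "negligible N" and *: "\<And>x e. \<lbrakk>x \<notin> N; 0 < e\<rbrakk> \<Longrightarrow>
       \<exists>d>0. \<forall>k. 0 < k \<and> k < d \<longrightarrow> norm (integral (cbox x (x + k *\<^sub>R One)) h /\<^sub>R k ^ DIM(real) - h x) < e"
    using integrable_ccontinuous_explicit[OF i] by metis
  have "AE x in lborel. x \<notin> N"
  proof -
    have "N \<in> null_sets (completion lborel)" using N by (simp add: negligible_iff_null_sets)
    then have "AE x in completion lborel. x \<notin> N" by (rule AE_not_in)
    then show ?thesis by (simp add: AE_completion_iff)
  qed
  then show ?thesis
  proof (rule AE_mp, intro AE_I2 impI allI)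
    fix x e :: real assume "x \<notin> N" "0 < e"
    then obtain \<delta> where \<delta>: "\<delta> > 0" "\<And>d. 0 < d \<Longrightarrow> d < \<delta> \<Longrightarrow>
        norm (integral (cbox x (x + d)) h /\<^sub>R d - h x) < e"
      using *[of x e] by auto
    have "norm ((\<integral>u. indicator {0..d} u *\<^sub>R h (x + u) \<partial>lborel) - d *\<^sub>R h x) \<le> e * d"
      if d: "0 < d" "d < \<delta>" for d
    proof -
      have "(\<integral>u. indicator {0..d} u *\<^sub>R h (x + u) \<partial>lborel) =
          (\<integral>u. (\<lambda>s. indicator {x..x+d} s *\<^sub>R h s) (x + u) \<partial>lborel)"
        by (intro Bochner_Integration.integral_cong) (auto simp: indicator_def)
      also have "\<dots> = integral {x..x+d} h"
        unfolding lborel_integral_translate[of "\<lambda>s. indicator {x..x+d} s *\<^sub>R h s"]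
        using set_borel_integral_eq_integral(2)[OF si] by (simp add: set_lebesgue_integral_def)
      finally have "(\<integral>u. indicator {0..d} u *\<^sub>R h (x + u) \<partial>lborel) - d *\<^sub>R h x =
          d *\<^sub>R (integral (cbox x (x + d)) h /\<^sub>R d - h x)"
        using d by (simp add: cbox_interval algebra_simps)
      then show ?thesis using \<delta>(2)[OF d] d by (simp add: mult.commute)
    qed
    then show "\<exists>\<delta>>0. \<forall>d. 0 < d \<and> d < \<delta> \<longrightarrow>
        norm ((\<integral>u. indicator {0..d} u *\<^sub>R h (x + u) \<partial>lborel) - d *\<^sub>R h x) \<le> e * d"
      using \<delta>(1) by blast
  qed
qed

lemma AE_lborel_uminus:
  assumes "AE x::real in lborel. P x" shows "AE x in lborel. P (- x)"
proof -
  have "AE x in distr lborel borel uminus. P x"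
    unfolding lborel_distr_uminus using assms .
  then show ?thesis by (intro AE_distrD[where f=uminus and M=lborel and M'=borel and P=P]) simp_all
qed

text \<open>Almost every point \<open>x\<close> is a Lebesgue point in a weak symmetric sense: the integral of
  \<open>h(x + u) + h(x - u) - 2 h(x)\<close> over \<open>[0, d]\<close> is \<open>o(d)\<close>, with no claim on the integral of its norm.  Fatou's theorem
  needs no more, because the Poisson kernel is even and decreasing.\<close>

lemma AE_symmetric_lebesgue_derivative:
  fixes h :: "real \<Rightarrow> 'a::euclidean_space"
  assumes h: "integrable lborel h"
  shows "AE x in lborel. \<forall>e>0. \<exists>\<delta>>0. \<forall>d. 0 < d \<and> d < \<delta> \<longrightarrow>
    norm (\<integral>u. indicator {0..d} u *\<^sub>R (h (x + u) + h (x - u) - 2 *\<^sub>R h x) \<partial>lborel) \<le> e * d"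
proof -
  have hm: "integrable lborel (\<lambda>u. h (- u))"
    using lborel_integrable_real_affine[OF h, of "-1" 0] by simp
  have "AE x in lborel. \<forall>e>0. \<exists>\<delta>>0. \<forall>d. 0 < d \<and> d < \<delta> \<longrightarrow>
    norm ((\<integral>u. indicator {0..d} u *\<^sub>R h (x - u) \<partial>lborel) - d *\<^sub>R h x) \<le> e * d"
    using AE_lborel_uminus[OF AE_right_lebesgue_derivative[OF hm]] by simp
  with AE_right_lebesgue_derivative[OF h] show ?thesis
  proof eventually_elim
    case (elim x)
    have i1: "integrable lborel (\<lambda>u. indicator {0..d} u *\<^sub>R h (x + u))" for d
      using lborel_integrable_real_affine[OF h, of 1 x] by (intro integrable_mult_indicator) auto
    have i2: "integrable lborel (\<lambda>u. indicator {0..d} u *\<^sub>R h (x - u))" for d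
      using lborel_integrable_real_affine[OF h, of "-1" x] by (intro integrable_mult_indicator) auto
    show ?case
    proof (intro allI impI)
      fix e :: real assume "e > 0"
      then have e: "e / 2 > 0" by simp
      obtain \<delta>1 where 1: "\<delta>1 > 0" "\<And>d. 0 < d \<Longrightarrow> d < \<delta>1 \<Longrightarrow>
          norm ((\<integral>u. indicator {0..d} u *\<^sub>R h (x + u) \<partial>lborel) - d *\<^sub>R h x) \<le> e/2 * d"
        using elim(1)[rule_format, OF e] by auto
      obtain \<delta>2 where 2: "\<delta>2 > 0" "\<And>d. 0 < d \<Longrightarrow> d < \<delta>2 \<Longrightarrow>
          norm ((\<integral>u. indicator {0..d} u *\<^sub>R h (x - u) \<partial>lborel) - d *\<^sub>R h x) \<le> e/2 * d"
        using elim(2)[rule_format, OF e] by auto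
      have "norm (\<integral>u. indicator {0..d} u *\<^sub>R (h (x + u) + h (x - u) - 2 *\<^sub>R h x) \<partial>lborel) \<le> e * d"
        if d: "0 < d" "d < min \<delta>1 \<delta>2" for d
      proof -
        have i3: "integrable lborel (\<lambda>u::real. (2 * indicator {0..d} u) *\<^sub>R h x)"
          by (intro integrable_scaleR_left integrable_mult_right integrable_real_indicator)
            (auto simp: emeasure_lborel_Icc_eq)
        have "(\<integral>u. indicator {0..d} u *\<^sub>R (h (x + u) + h (x - u) - 2 *\<^sub>R h x) \<partial>lborel) =
          (\<integral>u. indicator {0..d} u *\<^sub>R h (x + u) + indicator {0..d} u *\<^sub>R h (x - u) -
             (2 * indicator {0..d} u) *\<^sub>R h x \<partial>lborel)"
          by (intro Bochner_Integration.integral_cong) (auto simp: algebra_simps)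
        also have "\<dots> = (\<integral>u. indicator {0..d} u *\<^sub>R h (x + u) \<partial>lborel) +
            (\<integral>u. indicator {0..d} u *\<^sub>R h (x - u) \<partial>lborel) - (2 * d) *\<^sub>R h x"
          using i1[of d] i2[of d] i3 d by (simp add: integral_scaleR_left)
        also have "\<dots> = ((\<integral>u. indicator {0..d} u *\<^sub>R h (x + u) \<partial>lborel) - d *\<^sub>R h x) +
            ((\<integral>u. indicator {0..d} u *\<^sub>R h (x - u) \<partial>lborel) - d *\<^sub>R h x)"
          by (simp add: scaleR_2 algebra_simps flip: scaleR_scaleR)
        also have "norm \<dots> \<le> e/2 * d + e/2 * d"
          using 1(2)[of d] 2(2)[of d] d by (intro norm_triangle_mono) auto
        finally show ?thesis by (simp add: mult.commute)
      qed
      then show "\<exists>\<delta>>0. \<forall>d. 0 < d \<and> d < \<delta> \<longrightarrow>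
          norm (\<integral>u. indicator {0..d} u *\<^sub>R (h (x + u) + h (x - u) - 2 *\<^sub>R h x) \<partial>lborel) \<le> e * d"
        using 1(1) 2(1) by (intro exI[of _ "min \<delta>1 \<delta>2"]) auto
    qed
  qed
qed

text \<open>Integration by parts of a smooth \<open>k\<close> against a merely integrable \<open>\<phi>\<close>.  The primitive of \<open>\<phi>\<close>
  need not be differentiable everywhere, so the identity is obtained by Fubini, from
  \<open>k(u) = k(\<delta>) - \<integral>\<^sub>u\<^sup>\<delta> k'(w) dw\<close>.\<close>

lemma integral_by_parts_primitive:
  fixes \<phi> :: "real \<Rightarrow> 'a::euclidean_space" and k k' :: "real \<Rightarrow> real"
  assumes \<phi>: "integrable lborel \<phi>" and \<delta>: "0 \<le> \<delta>"
    and k: "\<And>x. (k has_real_derivative k' x) (at x)" and k': "continuous_on UNIV k'"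
  shows "(\<integral>u. indicator {0..\<delta>} u *\<^sub>R k u *\<^sub>R \<phi> u \<partial>lborel) =
     k \<delta> *\<^sub>R (\<integral>u. indicator {0..\<delta>} u *\<^sub>R \<phi> u \<partial>lborel) -
     (\<integral>w. indicator {0..\<delta>} w *\<^sub>R k' w *\<^sub>R (\<integral>u. indicator {0..w} u *\<^sub>R \<phi> u \<partial>lborel) \<partial>lborel)"
    and "integrable lborel (\<lambda>w. indicator {0..\<delta>} w *\<^sub>R k' w *\<^sub>R (\<integral>u. indicator {0..w} u *\<^sub>R \<phi> u \<partial>lborel))"
proof -
  have k'm: "k' \<in> borel_measurable borel"
    by (rule borel_measurable_continuous_onI[OF k'])
  have \<phi>m: "\<phi> \<in> borel_measurable borel"
    using borel_measurable_integrable[OF \<phi>] by (simp only: measurable_lborel1 measurable_lborel2)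
  have "bounded (k' ` {0..\<delta>})"
    by (intro compact_imp_bounded compact_continuous_image continuous_on_subset[OF k']) auto
  then obtain C where "\<forall>y\<in>k' ` {0..\<delta>}. norm y \<le> C" unfolding bounded_iff ..
  then have C: "\<bar>k' w\<bar> \<le> C" if "w \<in> {0..\<delta>}" for w
    using that by auto
  have "0 \<le> \<bar>k' 0\<bar>" by simp
  also have "\<dots> \<le> C" using \<delta> by (intro C) simp
  finally have C0: "C \<ge> 0" .
  define F where "F u w = (indicator {0..\<delta>} w * indicator {0..w} u * k' w) *\<^sub>R \<phi> u" for u w
  define S where "S = {p :: real \<times> real. 0 \<le> fst p \<and> fst p \<le> snd p \<and> snd p \<le> \<delta>}"
  have "closed S" unfolding S_def by (intro closed_Collect_conj closed_Collect_le continuous_intros)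
  then have "S \<in> sets (borel \<Otimes>\<^sub>M borel)" unfolding borel_prod by simp
  then have "(\<lambda>p. indicator S p *\<^sub>R k' (snd p) *\<^sub>R \<phi> (fst p)) \<in> borel_measurable (borel \<Otimes>\<^sub>M borel)"
    by (intro borel_measurable_scaleR borel_measurable_indicator
        measurable_compose[OF measurable_snd k'm] measurable_compose[OF measurable_fst \<phi>m])
  moreover have "(\<lambda>(u, w). F u w) = (\<lambda>p. indicator S p *\<^sub>R k' (snd p) *\<^sub>R \<phi> (fst p))"
    by (auto simp: F_def S_def indicator_def fun_eq_iff)
  ultimately have Fm: "(\<lambda>(u, w). F u w) \<in> borel_measurable (lborel \<Otimes>\<^sub>M lborel)"
    by (simp only: lborel_prod borel_prod measurable_lborel2)
  have Fle: "norm (F u w) \<le> indicator {0..\<delta>} w * (C * norm (\<phi> u))" for u w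
    using C[of w] C0 by (simp add: F_def indicator_def mult_right_mono)
  have iI: "integrable lborel (\<lambda>w::real. indicator {0..\<delta>} w * c :: real)" for c
    by (intro integrable_mult_left integrable_real_indicator) (auto simp: emeasure_lborel_Icc_eq)
  have iFw: "integrable lborel (F u)" for u
  proof (rule Bochner_Integration.integrable_bound[OF iI[of "C * norm (\<phi> u)"]])
    have "u \<in> space lborel" by simp
    from measurable_Pair2[OF Fm this] show "F u \<in> borel_measurable lborel"
      by (simp only: prod.case)
    show "AE w in lborel. norm (F u w) \<le> norm (indicator {0..\<delta>} w * (C * norm (\<phi> u)))"
      unfolding real_norm_def by (intro AE_I2 order_trans[OF Fle abs_ge_self])
  qed
  have iF: "integrable (lborel \<Otimes>\<^sub>M lborel) (\<lambda>(u, w). F u w)"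
  proof (rule lborel_pair.Fubini_integrable[OF Fm])
    show "AE u in lborel. integrable lborel (\<lambda>w. (\<lambda>(u, w). F u w) (u, w))" using iFw by simp
    have "(\<integral>w. norm (F u w) \<partial>lborel) \<le> \<delta> * (C * norm (\<phi> u))" for u
      using integral_mono[OF integrable_norm[OF iFw] iI Fle] \<delta> by simp
    moreover have "0 \<le> (\<integral>w. norm (F u w) \<partial>lborel)" for u
      by (rule Bochner_Integration.integral_nonneg) simp
    ultimately have "norm (\<integral>w. norm (F u w) \<partial>lborel) \<le> norm (\<delta> * (C * norm (\<phi> u)))" for u
      unfolding real_norm_def by (metis abs_ge_self abs_of_nonneg order_trans)
    moreover have "(\<lambda>u. \<integral>w. norm (F u w) \<partial>lborel) \<in> borel_measurable lborel"
      using lborel.borel_measurable_lebesgue_integral[of "\<lambda>u w. norm (F u w)" lborel]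
        measurable_compose[OF Fm borel_measurable_norm] by (simp only: case_prod_beta')
    ultimately show "integrable lborel (\<lambda>u. \<integral>w. norm ((\<lambda>(u, w). F u w) (u, w)) \<partial>lborel)"
      unfolding prod.case
      by (intro Bochner_Integration.integrable_bound[OF integrable_mult_right[OF integrable_mult_right[OF integrable_norm[OF \<phi>]], of \<delta> C]] AE_I2)
  qed
  have inner_w: "(\<integral>w. F u w \<partial>lborel) = indicator {0..\<delta>} u *\<^sub>R (k \<delta> - k u) *\<^sub>R \<phi> u" for u
  proof (cases "u \<in> {0..\<delta>}")
    case True
    have "(\<integral>w. F u w \<partial>lborel) = (\<integral>w. (indicator {u..\<delta>} w *\<^sub>R k' w) *\<^sub>R \<phi> u \<partial>lborel)"
      using True by (intro Bochner_Integration.integral_cong) (auto simp: F_def indicator_def)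
    also have "\<dots> = (\<integral>w. indicator {u..\<delta>} w *\<^sub>R k' w \<partial>lborel) *\<^sub>R \<phi> u"
      by (rule integral_scaleR_left)
        (intro borel_integrable_compact continuous_on_subset[OF k'], auto)
    also have "(\<integral>w. indicator {u..\<delta>} w *\<^sub>R k' w \<partial>lborel) = k \<delta> - k u"
      using True k
      by (intro integral_FTC_Icc continuous_on_subset[OF k'])
        (auto intro: has_field_derivative_at_within simp flip: has_real_derivative_iff_has_vector_derivative)
    finally show ?thesis using True by simp
  next
    case False
    then have "F u w = 0" for w by (auto simp: F_def indicator_def)
    then show ?thesis using False by simp
  qed
  have inner_u: "(\<integral>u. F u w \<partial>lborel) = indicator {0..\<delta>} w *\<^sub>R k' w *\<^sub>R (\<integral>u. indicator {0..w} u *\<^sub>R \<phi> u \<partial>lborel)" for w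
  proof -
    have "(\<integral>u. F u w \<partial>lborel) = (\<integral>u. (indicator {0..\<delta>} w * k' w) *\<^sub>R (indicator {0..w} u *\<^sub>R \<phi> u) \<partial>lborel)"
      by (intro Bochner_Integration.integral_cong) (auto simp: F_def indicator_def)
    then show ?thesis unfolding Bochner_Integration.integral_scaleR_right by simp
  qed
  have "(\<integral>w. (\<integral>u. F u w \<partial>lborel) \<partial>lborel) = (\<integral>u. (\<integral>w. F u w \<partial>lborel) \<partial>lborel)"
    by (rule lborel_pair.Fubini_integral[OF iF])
  then have eq: "(\<integral>w. indicator {0..\<delta>} w *\<^sub>R k' w *\<^sub>R (\<integral>u. indicator {0..w} u *\<^sub>R \<phi> u \<partial>lborel) \<partial>lborel) =
      (\<integral>u. indicator {0..\<delta>} u *\<^sub>R (k \<delta> - k u) *\<^sub>R \<phi> u \<partial>lborel)"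
    by (simp only: inner_w inner_u)
  have i1: "integrable lborel (\<lambda>u. k \<delta> *\<^sub>R indicator {0..\<delta>} u *\<^sub>R \<phi> u)"
    using \<phi> by (intro integrable_scaleR_right integrable_mult_indicator) auto
  have i2: "integrable lborel (\<lambda>u. indicator {0..\<delta>} u *\<^sub>R (k \<delta> - k u) *\<^sub>R \<phi> u)"
    using lborel_pair.integrable_fst'[OF iF] by (simp add: inner_w)
  have "(\<integral>u. indicator {0..\<delta>} u *\<^sub>R k u *\<^sub>R \<phi> u \<partial>lborel) =
     (\<integral>u. k \<delta> *\<^sub>R indicator {0..\<delta>} u *\<^sub>R \<phi> u - indicator {0..\<delta>} u *\<^sub>R (k \<delta> - k u) *\<^sub>R \<phi> u \<partial>lborel)"
    by (intro Bochner_Integration.integral_cong) (auto simp: indicator_def algebra_simps)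
  also have "\<dots> = k \<delta> *\<^sub>R (\<integral>u. indicator {0..\<delta>} u *\<^sub>R \<phi> u \<partial>lborel) -
      (\<integral>u. indicator {0..\<delta>} u *\<^sub>R (k \<delta> - k u) *\<^sub>R \<phi> u \<partial>lborel)"
    unfolding Bochner_Integration.integral_diff[OF i1 i2] Bochner_Integration.integral_scaleR_right ..
  finally show "(\<integral>u. indicator {0..\<delta>} u *\<^sub>R k u *\<^sub>R \<phi> u \<partial>lborel) =
     k \<delta> *\<^sub>R (\<integral>u. indicator {0..\<delta>} u *\<^sub>R \<phi> u \<partial>lborel) -
     (\<integral>w. indicator {0..\<delta>} w *\<^sub>R k' w *\<^sub>R (\<integral>u. indicator {0..w} u *\<^sub>R \<phi> u \<partial>lborel) \<partial>lborel)"
    by (simp only: eq)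
  show "integrable lborel (\<lambda>w. indicator {0..\<delta>} w *\<^sub>R k' w *\<^sub>R (\<integral>u. indicator {0..w} u *\<^sub>R \<phi> u \<partial>lborel))"
    using lborel_pair.integrable_snd[OF iF] by (simp add: inner_u)
qed


text \<open>A decreasing kernel sees a function whose primitive is \<open>e\<close>-small as if the function were bounded by \<open>e\<close>:
  the boundary terms of the two integrations by parts, one against \<open>\<phi>\<close> and one against the constant \<open>e\<close>, cancel.\<close>

lemma norm_integral_decreasing_kernel_le:
  fixes \<phi> :: "real \<Rightarrow> 'a::euclidean_space" and k k' :: "real \<Rightarrow> real"
  assumes \<phi>: "integrable lborel \<phi>" and \<delta>: "0 \<le> \<delta>" and e: "0 \<le> e"
    and k: "\<And>x. (k has_real_derivative k' x) (at x)" and k': "continuous_on UNIV k'"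
    and k_nonneg: "0 \<le> k \<delta>" and k_decr: "\<And>w. 0 \<le> w \<Longrightarrow> w \<le> \<delta> \<Longrightarrow> k' w \<le> 0"
    and le: "\<And>w. 0 \<le> w \<Longrightarrow> w \<le> \<delta> \<Longrightarrow> norm (\<integral>u. indicator {0..w} u *\<^sub>R \<phi> u \<partial>lborel) \<le> e * w"
  shows "norm (\<integral>u. indicator {0..\<delta>} u *\<^sub>R k u *\<^sub>R \<phi> u \<partial>lborel) \<le>
    e * (\<integral>u. indicator {0..\<delta>} u * k u \<partial>lborel)"
proof -
  define \<Phi> where "\<Phi> w = (\<integral>u. indicator {0..w} u *\<^sub>R \<phi> u \<partial>lborel)" for w
  have ik: "continuous_on UNIV k" using k by (intro continuous_at_imp_continuous_on) (auto intro: DERIV_isCont)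
  have i1: "integrable lborel (\<lambda>w. indicator {0..\<delta>} w *\<^sub>R (e * w * (- k' w)))"
    by (intro borel_integrable_compact continuous_intros continuous_on_subset[OF k']) auto
  have "norm (\<integral>w. indicator {0..\<delta>} w *\<^sub>R k' w *\<^sub>R \<Phi> w \<partial>lborel) \<le>
      (\<integral>w. norm (indicator {0..\<delta>} w *\<^sub>R k' w *\<^sub>R \<Phi> w) \<partial>lborel)"
    by (rule integral_norm_bound)
  also have "\<dots> \<le> (\<integral>w. indicator {0..\<delta>} w *\<^sub>R (e * w * (- k' w)) \<partial>lborel)"
  proof (rule integral_mono[OF _ i1])
    show "integrable lborel (\<lambda>w. norm (indicator {0..\<delta>} w *\<^sub>R k' w *\<^sub>R \<Phi> w))"
      unfolding \<Phi>_def by (rule integrable_norm[OF integral_by_parts_primitive(2)[OF \<phi> \<delta> k k']])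
    show "norm (indicator {0..\<delta>} w *\<^sub>R k' w *\<^sub>R \<Phi> w) \<le> indicator {0..\<delta>} w *\<^sub>R (e * w * (- k' w))" for w
    proof (cases "w \<in> {0..\<delta>}")
      case True
      then have "\<bar>k' w\<bar> * norm (\<Phi> w) \<le> \<bar>k' w\<bar> * (e * w)"
        using le[of w] by (intro mult_left_mono) (auto simp: \<Phi>_def)
      then show ?thesis using True k_decr[of w] by (simp add: mult.commute)
    qed simp
  qed
  finally have 1: "norm (\<integral>w. indicator {0..\<delta>} w *\<^sub>R k' w *\<^sub>R \<Phi> w \<partial>lborel) \<le>
    (\<integral>w. indicator {0..\<delta>} w *\<^sub>R (e * w * (- k' w)) \<partial>lborel)" .
  have d: "((\<lambda>w. w * k w) has_real_derivative (k w + w * k' w)) (at w)" for w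
    by (rule derivative_eq_intros k refl)+ simp
  have "(\<integral>w. indicator {0..\<delta>} w *\<^sub>R (k w + w * k' w) \<partial>lborel) = \<delta> * k \<delta> - 0 * k 0"
    using \<delta> d by (intro integral_FTC_Icc continuous_intros continuous_on_subset[OF k'] continuous_on_subset[OF ik])
        (auto intro: has_field_derivative_at_within simp flip: has_real_derivative_iff_has_vector_derivative)
  moreover have "(\<integral>w. indicator {0..\<delta>} w *\<^sub>R (e * w * (- k' w)) \<partial>lborel) =
      (\<integral>w. e * (indicator {0..\<delta>} w * k w) - e * (indicator {0..\<delta>} w *\<^sub>R (k w + w * k' w)) \<partial>lborel)"
    by (intro Bochner_Integration.integral_cong) (auto simp: algebra_simps)
  moreover have "\<dots> = e * (\<integral>w. indicator {0..\<delta>} w * k w \<partial>lborel) - e * (\<integral>w. indicator {0..\<delta>} w *\<^sub>R (k w + w * k' w) \<partial>lborel)"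
  proof -
    have "integrable lborel (\<lambda>w. indicator {0..\<delta>} w *\<^sub>R k w)"
      "integrable lborel (\<lambda>w. indicator {0..\<delta>} w *\<^sub>R (k w + w * k' w))"
      by (intro borel_integrable_compact continuous_intros continuous_on_subset[OF k'] continuous_on_subset[OF ik]; simp)+
    then show ?thesis by simp
  qed
  ultimately have 2: "norm (\<integral>w. indicator {0..\<delta>} w *\<^sub>R k' w *\<^sub>R \<Phi> w \<partial>lborel) \<le>
      e * (\<integral>w. indicator {0..\<delta>} w * k w \<partial>lborel) - e * (\<delta> * k \<delta>)"
    using 1 by simp
  have "norm (k \<delta> *\<^sub>R \<Phi> \<delta>) \<le> k \<delta> * (e * \<delta>)"
    using le[of \<delta>] \<delta> k_nonneg by (simp add: \<Phi>_def mult_left_mono)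
  then have "norm (k \<delta> *\<^sub>R \<Phi> \<delta> - (\<integral>w. indicator {0..\<delta>} w *\<^sub>R k' w *\<^sub>R \<Phi> w \<partial>lborel)) \<le>
     k \<delta> * (e * \<delta>) + (e * (\<integral>w. indicator {0..\<delta>} w * k w \<partial>lborel) - e * (\<delta> * k \<delta>))"
    by (intro order_trans[OF norm_triangle_ineq4] add_mono 2)
  then show ?thesis
    unfolding integral_by_parts_primitive(1)[OF \<phi> \<delta> k k'] \<Phi>_def by (simp add: mult_ac)
qed

text \<open>The derivative of the Poisson kernel in the angle; it is nonpositive on \<open>[0, \<pi>]\<close>.\<close>

definition poisson_deriv :: "real \<Rightarrow> real \<Rightarrow> real" where
  "poisson_deriv r s = - ((1 - r\<^sup>2) * (2 * r * sin s)) / (1 - 2 * r * cos s + r\<^sup>2)\<^sup>2"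

lemma poisson_has_derivative:
  assumes "\<bar>r\<bar> < 1"
  shows "(poisson r has_real_derivative poisson_deriv r s) (at s)"
  unfolding poisson_def[abs_def] poisson_deriv_def
  using poisson_denominator_pos[OF assms, of s]
  by (auto intro!: derivative_eq_intros simp: power2_eq_square)

lemma continuous_poisson_deriv:
  assumes "\<bar>r\<bar> < 1" shows "continuous_on UNIV (poisson_deriv r)"
proof -
  have "1 - 2 * r * cos s + r\<^sup>2 \<noteq> 0" for s using poisson_denominator_pos[OF assms, of s] by simp
  then show ?thesis unfolding poisson_deriv_def[abs_def] by (intro continuous_intros ballI) auto
qed

lemma poisson_deriv_nonpos:
  assumes r: "0 \<le> r" "r < 1" and s: "0 \<le> s" "s \<le> pi"
  shows "poisson_deriv r s \<le> 0"
proof -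
  have "0 \<le> (1 - r\<^sup>2) * (2 * r * sin s)"
    using r s by (intro mult_nonneg_nonneg) (auto simp: abs_square_le_1 sin_ge_zero)
  then show ?thesis unfolding poisson_deriv_def by (intro divide_nonpos_nonneg) auto
qed

lemma tendsto_poisson_away:
  assumes "c < 1"
  shows "((\<lambda>r. (1 - r\<^sup>2) / (1 - 2 * r * c + r\<^sup>2)) \<longlongrightarrow> 0) (at_left (1::real))"
proof -
  have "((\<lambda>r. (1 - r\<^sup>2) / (1 - 2 * r * c + r\<^sup>2)) \<longlongrightarrow> (1 - 1\<^sup>2) / (1 - 2 * 1 * c + 1\<^sup>2)) (at_left (1::real))"
    using assms by (intro tendsto_intros) auto
  then show ?thesis by simp
qed

lemma poisson_le_of_cos_le:
  assumes r: "0 \<le> r" "r < 1" and "cos s \<le> c" "c \<le> 1"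
  shows "poisson r s \<le> (1 - r\<^sup>2) / (1 - 2 * r * c + r\<^sup>2)"
proof -
  have "0 < (1 - r)\<^sup>2" using r by simp
  also have "\<dots> \<le> 1 - 2 * r * c + r\<^sup>2"
    using mult_left_mono[OF assms(4) r(1)] by (simp add: power2_eq_square algebra_simps)
  finally have "0 < 1 - 2 * r * c + r\<^sup>2" .
  moreover have "1 - 2 * r * c + r\<^sup>2 \<le> 1 - 2 * r * cos s + r\<^sup>2"
    using mult_left_mono[OF assms(3) r(1)] by simp
  moreover have "0 \<le> 1 - r\<^sup>2" using r by (simp add: abs_square_le_1)
  ultimately show ?thesis unfolding poisson_def
    using r by (intro divide_left_mono mult_pos_pos) linarith+
qed

section \<open>Radial limits of Poisson integrals\<close>

lemma cos_le_cos_of_abs: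
  assumes "0 \<le> \<delta>" "\<delta> \<le> \<bar>u\<bar>" "\<bar>u\<bar> \<le> 2 * pi - \<delta>"
  shows "cos u \<le> cos \<delta>"
proof -
  have "cos u = cos \<bar>u\<bar>" by simp
  also have "\<dots> \<le> cos \<delta>"
  proof (cases "\<bar>u\<bar> \<le> pi")
    case True then show ?thesis using assms by (intro cos_monotone_0_pi_le) auto
  next
    case False
    have "cos \<bar>u\<bar> = cos (2 * pi - \<bar>u\<bar>)" by (simp add: cos_diff)
    also have "\<dots> \<le> cos \<delta>" using assms False by (intro cos_monotone_0_pi_le) auto
    finally show ?thesis .
  qed
  finally show ?thesis .
qed

lemma integrable_lborel_affine:
  fixes f :: "real \<Rightarrow> 'a::{banach, second_countable_topology}"
  assumes "integrable lborel f"
  shows "integrable lborel (\<lambda>u. f (x + u))" "integrable lborel (\<lambda>u. f (x - u))"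
  using lborel_integrable_real_affine[OF assms, of 1 x] lborel_integrable_real_affine[OF assms, of "-1" x]
  by simp_all

lemma integrable_poisson_lborel:
  fixes k :: "real \<Rightarrow> 'a::{banach, second_countable_topology}"
  assumes r: "0 \<le> r" "r < 1" and k: "integrable lborel k"
  shows "integrable lborel (\<lambda>u. poisson r u *\<^sub>R k u)"
proof (rule Bochner_Integration.integrable_bound[OF integrable_scaleR_right[OF k, of "(1 + r) / (1 - r)"]])
  show "(\<lambda>u. poisson r u *\<^sub>R k u) \<in> borel_measurable lborel"
    using k poisson_measurable[of r]
    by (intro borel_measurable_scaleR borel_measurable_integrable[OF k]) (simp only: measurable_lborel2)
  show "AE u in lborel. norm (poisson r u *\<^sub>R k u) \<le> norm (((1 + r) / (1 - r)) *\<^sub>R k u)"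
    unfolding norm_scaleR
    using poisson_abs_le[OF r] r by (intro AE_I2 mult_right_mono) (auto intro: order_trans)
qed

text \<open>Fatou's theorem.  At a symmetric Lebesgue point \<open>t\<close> the kernel is split at distance \<open>\<delta>\<close> from \<open>t\<close>: the near part is
  small because the kernel decreases away from \<open>t\<close>, the far part because the kernel tends to \<open>0\<close> uniformly there.\<close>

theorem poisson_integral_tendsto_AE:
  fixes h :: "real \<Rightarrow> 'a::euclidean_space"
  assumes h: "integrable circ h"
  shows "AE t in circ. ((\<lambda>r. \<integral>s. poisson r (t - s) *\<^sub>R h s \<partial>circ) \<longlongrightarrow> (2 * pi) *\<^sub>R h t) (at_left 1)"
proof -
  define g where "g s = indicator {0..<2*pi} s *\<^sub>R h s" for s
  have g: "integrable lborel g" using h unfolding g_def[abs_def] by (simp only: integrable_circ_iff)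
  have conv: "((\<lambda>r. \<integral>s. poisson r (t - s) *\<^sub>R h s \<partial>circ) \<longlongrightarrow> (2 * pi) *\<^sub>R h t) (at_left 1)"
    if t: "0 < t" "t < 2 * pi" and leb: "\<forall>e>0. \<exists>\<delta>>0. \<forall>d. 0 < d \<and> d < \<delta> \<longrightarrow>
      norm (\<integral>u. indicator {0..d} u *\<^sub>R (g (t + u) + g (t - u) - 2 *\<^sub>R g t) \<partial>lborel) \<le> e * d" for t
  proof (rule tendstoI)
    fix \<eta> :: real assume \<eta>: "\<eta> > 0"
    define L where "L = h t"
    \<comment> \<open>The near part is bounded by \<open>2 \<pi> e\<close>.\<close>
    define e where "e = \<eta> / (4 * pi)"
    have e: "e > 0" using \<eta> by (simp add: e_def)
    obtain \<delta>' where \<delta>': "\<delta>' > 0" and le': "\<And>d. 0 < d \<Longrightarrow> d < \<delta>' \<Longrightarrow>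
        norm (\<integral>u. indicator {0..d} u *\<^sub>R (g (t + u) + g (t - u) - 2 *\<^sub>R g t) \<partial>lborel) \<le> e * d"
      using leb[rule_format, OF e] by auto
    \<comment> \<open>With this choice both \<open>t - u\<close> and \<open>t + u\<close> stay in the parameter interval for \<open>u \<le> \<delta>\<close>.\<close>
    define \<delta> where "\<delta> = min \<delta>' (min t (2 * pi - t)) / 2"
    have \<delta>: "0 < \<delta>" "\<delta> < \<delta>'" "\<delta> < t" "\<delta> < 2 * pi - t"
      using \<delta>' t by (auto simp: \<delta>_def min_def)
    then have \<delta>_pi: "\<delta> < pi" by linarith
    \<comment> \<open>The kernel has total mass \<open>2 \<pi>\<close>, so the error is the Poisson integral of \<open>h - L\<close>.\<close>
    define k where "k s = indicator {0..<2*pi} s *\<^sub>R (h s - L)" for s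
    have k: "integrable lborel k"
    proof -
      interpret finite_measure circ by (rule finite_measure_circ)
      show ?thesis unfolding k_def[abs_def] integrable_circ_iff[symmetric]
        using h by (intro Bochner_Integration.integrable_diff integrable_const)
    qed
    define \<phi> where "\<phi> u = k (t + u) + k (t - u)" for u
    have \<phi>: "integrable lborel \<phi>"
      unfolding \<phi>_def[abs_def] by (intro Bochner_Integration.integrable_add integrable_lborel_affine k)
    have le: "norm (\<integral>u. indicator {0..w} u *\<^sub>R \<phi> u \<partial>lborel) \<le> e * w" if w: "0 \<le> w" "w \<le> \<delta>" for w
    proof (cases "w = 0")
      case True
      have "AE u in lborel. indicator {0..w} u *\<^sub>R \<phi> u = 0"
        using AE_lborel_singleton[of 0] by eventually_elim (simp add: True indicator_def)
      then have "(\<integral>u. indicator {0..w} u *\<^sub>R \<phi> u \<partial>lborel) = 0"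
        by (rule integral_eq_zero_AE)
      then show ?thesis by (simp only: True norm_zero mult_zero_right order_refl)
    next
      case False
      have "(\<integral>u. indicator {0..w} u *\<^sub>R \<phi> u \<partial>lborel) =
          (\<integral>u. indicator {0..w} u *\<^sub>R (g (t + u) + g (t - u) - 2 *\<^sub>R g t) \<partial>lborel)"
        using w \<delta> t by (intro Bochner_Integration.integral_cong)
          (auto simp: indicator_def \<phi>_def k_def g_def L_def scaleR_2)
      then show ?thesis using le'[of w] w False \<delta> by simp
    qed
    define N where "N = (\<integral>s. norm (k s) \<partial>lborel)"
    have "((\<lambda>r. (1 - r\<^sup>2) / (1 - 2 * r * cos \<delta> + r\<^sup>2) * N) \<longlongrightarrow> 0) (at_left 1)"
      using tendsto_mult_left_zero[OF tendsto_poisson_away[of "cos \<delta>"], of N] cos_monotone_0_pi[of 0 \<delta>] \<delta> \<delta>_pi by simp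
    then have "\<forall>\<^sub>F r in at_left 1. (1 - r\<^sup>2) / (1 - 2 * r * cos \<delta> + r\<^sup>2) * N < \<eta> / 2"
      using \<eta> by (intro order_tendstoD(2)) auto
    moreover have "\<forall>\<^sub>F r in at_left (1::real). 0 \<le> r \<and> r < 1"
      unfolding eventually_at_left_field by (intro exI[of _ 0]) auto
    ultimately show "\<forall>\<^sub>F r in at_left 1. dist (\<integral>s. poisson r (t - s) *\<^sub>R h s \<partial>circ) ((2 * pi) *\<^sub>R h t) < \<eta>"
    proof eventually_elim
      case (elim r)
      then have r: "0 \<le> r" "r < 1" "\<bar>r\<bar> < 1" by auto
      have ik: "integrable lborel (\<lambda>u. poisson r u *\<^sub>R k (t - u))"
        "integrable lborel (\<lambda>u. poisson r u *\<^sub>R k (t + u))"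
        by (intro integrable_poisson_lborel r integrable_lborel_affine k)+
      have "(\<integral>s. poisson r (t - s) *\<^sub>R h s \<partial>circ) - (2 * pi) *\<^sub>R h t =
          (\<integral>s. poisson r (t - s) *\<^sub>R (h s - L) \<partial>circ)"
      proof -
        interpret finite_measure circ by (rule finite_measure_circ)
        have i: "integrable circ (\<lambda>s. poisson r (t - s))"
          using integrable_poisson[OF r(1,2) integrable_const[of "1::real"], of t] by simp
        show ?thesis
          using integrable_poisson[OF r(1,2) h, of t] i
          by (simp add: scaleR_diff_right L_def integral_poisson[OF r(1,2)])
      qed
      also have "\<dots> = (\<integral>s. poisson r (t - s) *\<^sub>R k s \<partial>lborel)"
        unfolding integral_circ k_def by (simp add: mult.commute)
      also have "\<dots> = (\<integral>u. poisson r u *\<^sub>R k (t - u) \<partial>lborel)"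
        using lborel_integral_reflect[of "\<lambda>s. poisson r (t - s) *\<^sub>R k s" t] by simp
      also have "\<dots> = (\<integral>u. indicator {0..\<delta>} u *\<^sub>R poisson r u *\<^sub>R k (t - u)
          + indicator {-\<delta>..0} u *\<^sub>R poisson r u *\<^sub>R k (t - u)
          + indicator (- {-\<delta>..\<delta>}) u *\<^sub>R poisson r u *\<^sub>R k (t - u) \<partial>lborel)"
      proof (rule integral_cong_AE)
        show "(\<lambda>u. poisson r u *\<^sub>R k (t - u)) \<in> borel_measurable lborel"
          by (rule borel_measurable_integrable[OF ik(1)])
        show "(\<lambda>u. indicator {0..\<delta>} u *\<^sub>R poisson r u *\<^sub>R k (t - u)
          + indicator {-\<delta>..0} u *\<^sub>R poisson r u *\<^sub>R k (t - u)
          + indicator (- {-\<delta>..\<delta>}) u *\<^sub>R poisson r u *\<^sub>R k (t - u)) \<in> borel_measurable lborel"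
          by (intro borel_measurable_add borel_measurable_scaleR[OF borel_measurable_indicator borel_measurable_integrable[OF ik(1)]])
            auto
        show "AE u in lborel. poisson r u *\<^sub>R k (t - u) = indicator {0..\<delta>} u *\<^sub>R poisson r u *\<^sub>R k (t - u)
          + indicator {-\<delta>..0} u *\<^sub>R poisson r u *\<^sub>R k (t - u)
          + indicator (- {-\<delta>..\<delta>}) u *\<^sub>R poisson r u *\<^sub>R k (t - u)"
          using AE_lborel_singleton[of 0]
        proof eventually_elim
          case (elim u)
          then show ?case using \<delta> by (cases "u < - \<delta>"; cases "u < 0"; cases "u \<le> \<delta>") (auto simp: indicator_def)
        qed
      qed
      also have "\<dots> = (\<integral>u. indicator {0..\<delta>} u *\<^sub>R poisson r u *\<^sub>R k (t - u) \<partial>lborel)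
          + (\<integral>u. indicator {-\<delta>..0} u *\<^sub>R poisson r u *\<^sub>R k (t - u) \<partial>lborel)
          + (\<integral>u. indicator (- {-\<delta>..\<delta>}) u *\<^sub>R poisson r u *\<^sub>R k (t - u) \<partial>lborel)"
        by (subst Bochner_Integration.integral_add Bochner_Integration.integral_add,
            (intro Bochner_Integration.integrable_add integrable_mult_indicator ik; simp)+)+ simp
      also have "(\<integral>u. indicator {-\<delta>..0} u *\<^sub>R poisson r u *\<^sub>R k (t - u) \<partial>lborel) =
          (\<integral>u. indicator {0..\<delta>} u *\<^sub>R poisson r u *\<^sub>R k (t + u) \<partial>lborel)"
      proof -
        have "indicator {-\<delta>..0} (0 - u) = (indicator {0..\<delta>} u :: real)" for u
          by (auto simp: indicator_def)
        then show ?thesis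
          using lborel_integral_reflect[of "\<lambda>u. indicator {-\<delta>..0} u *\<^sub>R poisson r u *\<^sub>R k (t - u)" 0] by simp
      qed
      also have "(\<integral>u. indicator {0..\<delta>} u *\<^sub>R poisson r u *\<^sub>R k (t - u) \<partial>lborel) +
           (\<integral>u. indicator {0..\<delta>} u *\<^sub>R poisson r u *\<^sub>R k (t + u) \<partial>lborel) =
          (\<integral>u. indicator {0..\<delta>} u *\<^sub>R poisson r u *\<^sub>R \<phi> u \<partial>lborel)"
        unfolding \<phi>_def scaleR_add_right
        by (subst Bochner_Integration.integral_add, (intro integrable_mult_indicator ik; simp)+) (rule add.commute)
      finally have eq: "(\<integral>s. poisson r (t - s) *\<^sub>R h s \<partial>circ) - (2 * pi) *\<^sub>R h t =
          (\<integral>u. indicator {0..\<delta>} u *\<^sub>R poisson r u *\<^sub>R \<phi> u \<partial>lborel) +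
          (\<integral>u. indicator (- {-\<delta>..\<delta>}) u *\<^sub>R poisson r u *\<^sub>R k (t - u) \<partial>lborel)" .
      have "norm (\<integral>u. indicator {0..\<delta>} u *\<^sub>R poisson r u *\<^sub>R \<phi> u \<partial>lborel) \<le>
          e * (\<integral>u. indicator {0..\<delta>} u * poisson r u \<partial>lborel)"
        using \<delta> \<delta>_pi e le r
        by (intro norm_integral_decreasing_kernel_le[OF \<phi> _ _ poisson_has_derivative[OF r(3)] continuous_poisson_deriv[OF r(3)]]
            poisson_nonneg poisson_deriv_nonpos) auto
      also have "\<dots> \<le> e * (2 * pi)"
      proof (intro mult_left_mono)
        have i: "integrable lborel (\<lambda>u. indicator {0..<2*pi} u *\<^sub>R poisson r (0 - u))"
        proof -
          interpret finite_measure circ by (rule finite_measure_circ)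
          show ?thesis unfolding integrable_circ_iff[symmetric]
            using integrable_poisson[OF r(1,2) integrable_const[of "1::real"], of 0] by simp
        qed
        have "(\<integral>u. indicator {0..\<delta>} u * poisson r u \<partial>lborel) \<le>
           (\<integral>u. indicator {0..<2*pi} u *\<^sub>R poisson r (0 - u) \<partial>lborel)"
        proof (rule integral_mono[OF _ i])
          have "integrable lborel (\<lambda>u. indicator {0..\<delta>} u *\<^sub>R (indicator {0..<2*pi} u *\<^sub>R poisson r (0 - u)))"
            by (intro integrable_mult_indicator i) simp
          moreover have "indicator {0..\<delta>} u *\<^sub>R (indicator {0..<2*pi} u *\<^sub>R poisson r (0 - u)) =
              indicator {0..\<delta>} u * poisson r u" for u
            using \<delta>_pi by (auto simp: indicator_def)
          ultimately show "integrable lborel (\<lambda>u. indicator {0..\<delta>} u * poisson r u)" by (simp only:)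
          show "indicator {0..\<delta>} u * poisson r u \<le> indicator {0..<2*pi} u *\<^sub>R poisson r (0 - u)" for u
            using \<delta>_pi poisson_nonneg[OF r(3)] by (auto simp: indicator_def)
        qed
        also have "\<dots> = 2 * pi"
          using integral_poisson[OF r(1,2), of 0] unfolding integral_circ .
        finally show "(\<integral>u. indicator {0..\<delta>} u * poisson r u \<partial>lborel) \<le> 2 * pi" .
      qed (use e in simp)
      also have "\<dots> = \<eta> / 2" by (simp add: e_def)
      finally have near: "norm (\<integral>u. indicator {0..\<delta>} u *\<^sub>R poisson r u *\<^sub>R \<phi> u \<partial>lborel) \<le> \<eta> / 2" .
      define B where "B = (1 - r\<^sup>2) / (1 - 2 * r * cos \<delta> + r\<^sup>2)"
      have "0 \<le> poisson r \<delta>" by (rule poisson_nonneg[OF r(3)])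
      then have B0: "0 \<le> B" by (simp add: B_def poisson_def)
      have "norm (\<integral>u. indicator (- {-\<delta>..\<delta>}) u *\<^sub>R poisson r u *\<^sub>R k (t - u) \<partial>lborel) \<le>
         (\<integral>u. norm (indicator (- {-\<delta>..\<delta>}) u *\<^sub>R poisson r u *\<^sub>R k (t - u)) \<partial>lborel)"
        by (rule integral_norm_bound)
      also have "\<dots> \<le> (\<integral>u. B * norm (k (t - u)) \<partial>lborel)"
      proof (rule integral_mono)
        show "integrable lborel (\<lambda>u. norm (indicator (- {-\<delta>..\<delta>}) u *\<^sub>R poisson r u *\<^sub>R k (t - u)))"
          by (intro integrable_norm integrable_mult_indicator ik) simp
        show "integrable lborel (\<lambda>u. B * norm (k (t - u)))"
          by (intro integrable_mult_right integrable_norm integrable_lborel_affine k)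
        show "norm (indicator (- {-\<delta>..\<delta>}) u *\<^sub>R poisson r u *\<^sub>R k (t - u)) \<le> B * norm (k (t - u))" for u
        proof (cases "u \<in> - {-\<delta>..\<delta>} \<and> t - u \<in> {0..<2*pi}")
          case True
          then have "cos u \<le> cos \<delta>" using \<delta> by (intro cos_le_cos_of_abs) auto
          then have "poisson r u \<le> B" unfolding B_def by (intro poisson_le_of_cos_le r) auto
          then show ?thesis using True poisson_nonneg[OF r(3), of u] by (auto intro: mult_right_mono)
        next
          case False
          then show ?thesis using B0 by (auto simp: indicator_def k_def)
        qed
      qed
      also have "\<dots> = B * N"
        using lborel_integral_reflect[of "\<lambda>u. norm (k u)" t] by (simp add: N_def)
      finally have far: "norm (\<integral>u. indicator (- {-\<delta>..\<delta>}) u *\<^sub>R poisson r u *\<^sub>R k (t - u) \<partial>lborel) \<le> B * N" .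
      have "norm ((\<integral>s. poisson r (t - s) *\<^sub>R h s \<partial>circ) - (2 * pi) *\<^sub>R h t) \<le> \<eta> / 2 + B * N"
        unfolding eq by (intro norm_triangle_mono near far)
      also have "\<dots> < \<eta>" using elim(1) unfolding B_def by linarith
      finally show ?case by (simp add: dist_norm)
    qed
  qed
  have "AE t in lborel. t \<in> {0..<2*pi} \<longrightarrow>
      ((\<lambda>r. \<integral>s. poisson r (t - s) *\<^sub>R h s \<partial>circ) \<longlongrightarrow> (2 * pi) *\<^sub>R h t) (at_left 1)"
    using AE_symmetric_lebesgue_derivative[OF g] AE_lborel_singleton[of 0]
  proof eventually_elim
    case (elim t)
    then show ?case using conv[of t] by (cases "0 < t") auto
  qed
  then show ?thesis by (subst AE_restrict_space_iff) auto
qed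

section \<open>Square-integrable functions on the circle\<close>

text \<open>Square-integrability over one period.  The function is required to be Borel on the whole line, so that it can be
  composed with reflections and with other real functions.\<close>

definition sq_integrable :: "(real \<Rightarrow> 'b::euclidean_space) \<Rightarrow> bool" where
  "sq_integrable f \<longleftrightarrow> f \<in> borel_measurable borel \<and> integrable circ (\<lambda>t. (norm (f t))\<^sup>2)"

lemma sq_integrableD:
  assumes "sq_integrable f"
  shows "f \<in> borel_measurable borel" "f \<in> borel_measurable circ" "integrable circ (\<lambda>t. (norm (f t))\<^sup>2)"
  using assms by (auto simp: sq_integrable_def intro: measurable_circ)

lemma integrable_sq_mult:
  fixes f g :: "real \<Rightarrow> real"
  assumes "f \<in> borel_measurable circ" "g \<in> borel_measurable circ"
    "integrable circ (\<lambda>t. (f t)\<^sup>2)" "integrable circ (\<lambda>t. (g t)\<^sup>2)"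
  shows "integrable circ (\<lambda>t. f t * g t)"
proof (rule Bochner_Integration.integrable_bound[OF Bochner_Integration.integrable_add[OF assms(3,4)]])
  show "(\<lambda>t. f t * g t) \<in> borel_measurable circ" by (intro borel_measurable_times assms)
  have "\<bar>x * y\<bar> \<le> x\<^sup>2 + y\<^sup>2" for x y :: real
  proof -
    have "2 * (\<bar>x\<bar> * \<bar>y\<bar>) \<le> x\<^sup>2 + y\<^sup>2" using sum_squares_bound[of "\<bar>x\<bar>" "\<bar>y\<bar>"] by (simp add: mult.assoc)
    moreover have "0 \<le> \<bar>x\<bar> * \<bar>y\<bar>" by simp
    ultimately show ?thesis unfolding abs_mult by linarith
  qed
  then show "AE t in circ. norm (f t * g t) \<le> norm ((f t)\<^sup>2 + (g t)\<^sup>2)" by simp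
qed

lemma sq_integrable_bound:
  fixes f :: "real \<Rightarrow> 'b::euclidean_space" and g :: "real \<Rightarrow> 'c::euclidean_space"
  assumes "sq_integrable g" "f \<in> borel_measurable borel" "\<And>t. norm (f t) \<le> C * norm (g t)"
  shows "sq_integrable f"
  unfolding sq_integrable_def
proof
  have "(norm (f t))\<^sup>2 \<le> C\<^sup>2 * (norm (g t))\<^sup>2" for t
    using power_mono[OF assms(3)[of t] norm_ge_zero, of 2] by (simp add: power_mult_distrib)
  then show "integrable circ (\<lambda>t. (norm (f t))\<^sup>2)"
    using measurable_circ[OF assms(2)]
    by (intro Bochner_Integration.integrable_bound[OF integrable_mult_right[OF sq_integrableD(3)[OF assms(1)], of "C\<^sup>2"]] AE_I2
       borel_measurable_power measurable_compose[OF _ borel_measurable_norm]) (auto simp: order_trans)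
qed fact

lemma sq_integrable_const: "sq_integrable (\<lambda>_. c)"
proof -
  interpret finite_measure circ by (rule finite_measure_circ)
  show ?thesis by (simp add: sq_integrable_def)
qed

lemma sq_integrable_add:
  fixes f g :: "real \<Rightarrow> 'b::euclidean_space"
  assumes "sq_integrable f" "sq_integrable g"
  shows "sq_integrable (\<lambda>t. f t + g t)"
  unfolding sq_integrable_def
proof
  show m: "(\<lambda>t. f t + g t) \<in> borel_measurable borel"
    by (intro borel_measurable_add sq_integrableD(1) assms)
  have "(norm (f t + g t))\<^sup>2 \<le> 2 * (norm (f t))\<^sup>2 + 2 * (norm (g t))\<^sup>2" for t
  proof -
    have "(norm (f t + g t))\<^sup>2 \<le> (norm (f t) + norm (g t))\<^sup>2"
      by (intro power_mono norm_triangle_ineq norm_ge_zero)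
    also have "\<dots> \<le> 2 * (norm (f t))\<^sup>2 + 2 * (norm (g t))\<^sup>2"
      using sum_squares_bound[of "norm (f t)" "norm (g t)"] by (simp add: power2_sum)
    finally show ?thesis .
  qed
  then show "integrable circ (\<lambda>t. (norm (f t + g t))\<^sup>2)"
    using measurable_circ[OF m]
    by (intro Bochner_Integration.integrable_bound[OF Bochner_Integration.integrable_add[OF
        integrable_mult_right[OF sq_integrableD(3)[OF assms(1)], of 2] integrable_mult_right[OF sq_integrableD(3)[OF assms(2)], of 2]]] AE_I2
       borel_measurable_power measurable_compose[OF _ borel_measurable_norm]) auto
qed

lemma sq_integrable_minus:
  assumes "sq_integrable f" shows "sq_integrable (\<lambda>t. - f t)"
  by (rule sq_integrable_bound[OF assms borel_measurable_uminus[OF sq_integrableD(1)[OF assms]], of 1]) simp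

lemma sq_integrable_diff:
  "sq_integrable f \<Longrightarrow> sq_integrable g \<Longrightarrow> sq_integrable (\<lambda>t. f t - g t)"
  using sq_integrable_add[OF _ sq_integrable_minus, of f g] by simp

lemma sq_integrable_imp_integrable:
  fixes f :: "real \<Rightarrow> 'b::euclidean_space"
  assumes "sq_integrable f" shows "integrable circ f"
proof -
  interpret finite_measure circ by (rule finite_measure_circ)
  have "integrable circ (\<lambda>t. norm (f t) * 1)"
    using measurable_compose[OF sq_integrableD(2)[OF assms] borel_measurable_norm] sq_integrableD(3)[OF assms]
    by (intro integrable_sq_mult) auto
  then show ?thesis
    using sq_integrableD(2)[OF assms] by (simp add: integrable_norm_iff)
qed

text \<open>The inequality of Cauchy and Schwarz against the constant \<open>1\<close>, with its weight \<open>c\<close> left free.\<close>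

lemma integral_norm_le_sq:
  fixes f :: "real \<Rightarrow> 'b::euclidean_space"
  assumes f: "sq_integrable f" and c: "c > 0"
  shows "(\<integral>t. norm (f t) \<partial>circ) \<le> (2 * pi * c + (\<integral>t. (norm (f t))\<^sup>2 \<partial>circ) / c) / 2"
proof -
  interpret finite_measure circ by (rule finite_measure_circ)
  have "(\<integral>t. norm (f t) \<partial>circ) \<le> (\<integral>t. (c + (norm (f t))\<^sup>2 / c) / 2 \<partial>circ)"
  proof (rule integral_mono)
    show "integrable circ (\<lambda>t. norm (f t))" using sq_integrable_imp_integrable[OF f] by simp
    show "integrable circ (\<lambda>t. (c + (norm (f t))\<^sup>2 / c) / 2)"
      by (intro integrable_divide Bochner_Integration.integrable_add integrable_const sq_integrableD(3) f)
    show "norm (f t) \<le> (c + (norm (f t))\<^sup>2 / c) / 2" for t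
      using c sum_squares_bound[of c "norm (f t)"] by (simp add: field_simps power2_eq_square)
  qed
  also have "\<dots> = (2 * pi * c + (\<integral>t. (norm (f t))\<^sup>2 \<partial>circ) / c) / 2"
    using sq_integrableD(3)[OF f] by (simp add: measure_restrict_space space_restrict_space)
  finally show ?thesis .
qed

lemma AE_summable_of_integrals:
  fixes f :: "nat \<Rightarrow> real \<Rightarrow> real"
  assumes f: "\<And>j. integrable M (f j)" "\<And>j t. 0 \<le> f j t" and s: "summable (\<lambda>j. \<integral>t. f j t \<partial>M)"
  shows "AE t in M. summable (\<lambda>j. f j t)"
proof -
  have m: "(\<lambda>t. ennreal (f j t)) \<in> borel_measurable M" for j
    by (intro measurable_compose[OF borel_measurable_integrable[OF f(1)] measurable_ennreal])
  have "(\<integral>\<^sup>+t. (\<Sum>j. ennreal (f j t)) \<partial>M) = (\<Sum>j. \<integral>\<^sup>+t. ennreal (f j t) \<partial>M)"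
    by (rule nn_integral_suminf[OF m])
  also have "\<dots> = (\<Sum>j. ennreal (\<integral>t. f j t \<partial>M))"
    by (intro suminf_cong nn_integral_eq_integral f(1)) (simp add: f(2))
  also have "\<dots> = ennreal (\<Sum>j. \<integral>t. f j t \<partial>M)"
    by (intro suminf_ennreal2 s Bochner_Integration.integral_nonneg f(2))
  finally have "(\<integral>\<^sup>+t. (\<Sum>j. ennreal (f j t)) \<partial>M) \<noteq> \<infinity>" by simp
  then have "AE t in M. (\<Sum>j. ennreal (f j t)) \<noteq> \<infinity>"
    by (intro nn_integral_noteq_infinite borel_measurable_suminf_order m)
  then show ?thesis
    by eventually_elim (intro summable_suminf_not_top f(2), simp)
qed

text \<open>The Riesz--Fischer theorem.  A rapidly converging subsequence has an integrable sum of consecutive distances, hence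
  converges almost everywhere; Fatou's lemma transfers the Cauchy estimates to the limit.\<close>

theorem L2_complete:
  fixes T :: "nat \<Rightarrow> real \<Rightarrow> 'b::euclidean_space"
  assumes T: "\<And>N. sq_integrable (T N)"
    and Cauchy: "\<And>e. e > 0 \<Longrightarrow> \<exists>n. \<forall>N\<ge>n. \<forall>M\<ge>n. (\<integral>t. (norm (T N t - T M t))\<^sup>2 \<partial>circ) \<le> e"
  shows "\<exists>U. sq_integrable U \<and> (\<lambda>N. \<integral>t. (norm (T N t - U t))\<^sup>2 \<partial>circ) \<longlonglongrightarrow> 0"
proof -
  have "\<exists>n. \<forall>j. \<forall>N\<ge>n j. \<forall>M\<ge>n j. (\<integral>t. (norm (T N t - T M t))\<^sup>2 \<partial>circ) \<le> (1/4) ^ j"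
    by (intro choice allI Cauchy) simp
  then obtain n where n: "\<And>j N M. N \<ge> n j \<Longrightarrow> M \<ge> n j \<Longrightarrow>
      (\<integral>t. (norm (T N t - T M t))\<^sup>2 \<partial>circ) \<le> (1/4) ^ j" by blast
  \<comment> \<open>The running maximum makes the chosen indices monotone.\<close>
  define m where "m j = Max (n ` {..j})" for j
  have m_ge: "n i \<le> m j" if "i \<le> j" for i j using that by (auto simp: m_def)
  define D where "D j t = T (m (Suc j)) t - T (m j) t" for j t
  have D: "sq_integrable (D j)" for j unfolding D_def[abs_def] by (intro sq_integrable_diff T)
  have D_le: "(\<integral>t. norm (D j t) \<partial>circ) \<le> (pi + 1) * (1/2) ^ j" for j
  proof -
    have "(\<integral>t. (norm (D j t))\<^sup>2 \<partial>circ) \<le> (1/4) ^ j"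
      unfolding D_def by (intro n m_ge) auto
    then have "(\<integral>t. (norm (D j t))\<^sup>2 \<partial>circ) / (1/2) ^ j \<le> (1/4) ^ j / (1/2) ^ j"
      by (intro divide_right_mono) auto
    also have "\<dots> = (1/2 :: real) ^ j" by (simp flip: power_divide)
    finally have le: "(\<integral>t. (norm (D j t))\<^sup>2 \<partial>circ) / (1/2) ^ j \<le> (1/2) ^ j" .
    have "(\<integral>t. norm (D j t) \<partial>circ) \<le> (2 * pi * (1/2) ^ j + (\<integral>t. (norm (D j t))\<^sup>2 \<partial>circ) / (1/2) ^ j) / 2"
      by (intro integral_norm_le_sq D) simp
    also have "\<dots> \<le> (2 * pi * (1/2) ^ j + (1/2) ^ j) / 2"
      by (intro divide_right_mono add_left_mono le) simp
    also have "\<dots> \<le> (pi + 1) * (1/2) ^ j" by (simp add: field_simps)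
    finally show ?thesis .
  qed
  have "AE t in circ. summable (\<lambda>j. norm (D j t))"
  proof (rule AE_summable_of_integrals)
    show "integrable circ (\<lambda>t. norm (D j t))" for j
      by (intro integrable_norm sq_integrable_imp_integrable D)
    have s: "summable (\<lambda>j. (pi + 1) * (1/2::real) ^ j)" by (intro summable_mult summable_geometric) simp
    show "summable (\<lambda>j. \<integral>t. norm (D j t) \<partial>circ)"
      by (rule summable_comparison_test'[OF s, of 0]) (use D_le in simp)
  qed simp
  moreover have "convergent (\<lambda>j. T (m j) t)" if "summable (\<lambda>j. norm (D j t))" for t
  proof -
    have "(\<lambda>j. T (m 0) t + (\<Sum>i<j. D i t)) \<longlonglongrightarrow> T (m 0) t + (\<Sum>i. D i t)"
      by (intro tendsto_intros summable_LIMSEQ summable_norm_cancel[OF that])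
    moreover have "T (m 0) t + (\<Sum>i<j. D i t) = T (m j) t" for j
      unfolding D_def by (subst sum_lessThan_telescope) simp
    ultimately show ?thesis by (auto simp: convergent_def)
  qed
  ultimately have conv: "AE t in circ. convergent (\<lambda>j. T (m j) t)" by (rule eventually_mono)
  define U where "U t = lim (\<lambda>j. T (m j) t)" for t
  have Um: "U \<in> borel_measurable borel"
    unfolding U_def[abs_def] by (intro borel_measurable_lim_metric sq_integrableD(1) T)
  have Fatou: "(\<integral>\<^sup>+t. ennreal ((norm (T N t - U t))\<^sup>2) \<partial>circ) \<le> ennreal ((1/4) ^ i)" if N: "N \<ge> n i" for N i
  proof -
    have sq: "sq_integrable (\<lambda>t. T N t - T (m j) t)" for j by (intro sq_integrable_diff T)
    have "(\<integral>\<^sup>+t. ennreal ((norm (T N t - U t))\<^sup>2) \<partial>circ) =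
        (\<integral>\<^sup>+t. liminf (\<lambda>j. ennreal ((norm (T N t - T (m j) t))\<^sup>2)) \<partial>circ)"
    proof (rule nn_integral_cong_AE)
      show "AE t in circ. ennreal ((norm (T N t - U t))\<^sup>2) = liminf (\<lambda>j. ennreal ((norm (T N t - T (m j) t))\<^sup>2))"
        using conv
      proof eventually_elim
        case (elim t)
        then have "(\<lambda>j. T (m j) t) \<longlonglongrightarrow> U t" by (simp add: U_def convergent_LIMSEQ_iff)
        then have "(\<lambda>j. ennreal ((norm (T N t - T (m j) t))\<^sup>2)) \<longlonglongrightarrow> ennreal ((norm (T N t - U t))\<^sup>2)"
          by (intro tendsto_intros)
        then show ?case by (intro lim_imp_Liminf[symmetric]) auto
      qed
    qed
    also have "\<dots> \<le> liminf (\<lambda>j. \<integral>\<^sup>+t. ennreal ((norm (T N t - T (m j) t))\<^sup>2) \<partial>circ)"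
      by (intro nn_integral_liminf measurable_compose[OF borel_measurable_integrable[OF sq_integrableD(3)[OF sq]] measurable_ennreal])
    also have "\<dots> \<le> ennreal ((1/4) ^ i)"
    proof (rule Liminf_le)
      have "(\<integral>\<^sup>+t. ennreal ((norm (T N t - T (m j) t))\<^sup>2) \<partial>circ) \<le> ennreal ((1/4) ^ i)" if "j \<ge> i" for j
      proof -
        have "(\<integral>\<^sup>+t. ennreal ((norm (T N t - T (m j) t))\<^sup>2) \<partial>circ) = ennreal (\<integral>t. (norm (T N t - T (m j) t))\<^sup>2 \<partial>circ)"
          by (intro nn_integral_eq_integral sq_integrableD(3) sq) simp
        also have "\<dots> \<le> ennreal ((1/4) ^ i)"
          by (intro ennreal_leI n N m_ge that)
        finally show ?thesis .
      qed
      then show "\<forall>\<^sub>F j in sequentially. (\<integral>\<^sup>+t. ennreal ((norm (T N t - T (m j) t))\<^sup>2) \<partial>circ) \<le> ennreal ((1/4) ^ i)"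
        by (rule eventually_sequentiallyI)
    qed simp
    finally show ?thesis .
  qed
  have TUm: "(\<lambda>t. T N t - U t) \<in> borel_measurable borel" for N
    by (intro borel_measurable_diff Um sq_integrableD(1) T)
  have TUm2: "(\<lambda>t. (norm (T N t - U t))\<^sup>2) \<in> borel_measurable circ" for N
    by (intro measurable_circ borel_measurable_power measurable_compose[OF TUm borel_measurable_norm])
  have i: "integrable circ (\<lambda>t. (norm (T N t - U t))\<^sup>2)" if "N \<ge> n i" for N i
    using Fatou[OF that] by (intro integrableI_bounded TUm2) (auto simp: le_less_trans)
  have "sq_integrable (\<lambda>t. T (n 0) t - U t)"
    unfolding sq_integrable_def using TUm i[of 0 "n 0"] by simp
  from sq_integrable_diff[OF T[of "n 0"] this] have U: "sq_integrable U" by simp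
  have bound: "(\<integral>t. (norm (T N t - U t))\<^sup>2 \<partial>circ) \<le> (1/4) ^ i" if N: "N \<ge> n i" for N i
  proof -
    have "ennreal (\<integral>t. (norm (T N t - U t))\<^sup>2 \<partial>circ) = (\<integral>\<^sup>+t. ennreal ((norm (T N t - U t))\<^sup>2) \<partial>circ)"
      by (intro nn_integral_eq_integral[symmetric] i[OF N]) simp
    also note Fatou[OF N]
    finally show ?thesis by (subst (asm) ennreal_le_iff) simp_all
  qed
  have "(\<lambda>N. \<integral>t. (norm (T N t - U t))\<^sup>2 \<partial>circ) \<longlonglongrightarrow> 0"
  proof (rule LIMSEQ_I)
    fix r :: real assume "r > 0"
    then obtain i where i: "(1/4) ^ i < r" using real_arch_pow_inv[of r "1/4"] by auto
    have "norm ((\<integral>t. (norm (T N t - U t))\<^sup>2 \<partial>circ) - 0) < r" if "N \<ge> n i" for N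
    proof -
      have "0 \<le> (\<integral>t. (norm (T N t - U t))\<^sup>2 \<partial>circ)" by (intro Bochner_Integration.integral_nonneg) simp
      then show ?thesis using bound[OF that] i by simp
    qed
    then show "\<exists>n0. \<forall>N\<ge>n0. norm ((\<integral>t. (norm (T N t - U t))\<^sup>2 \<partial>circ) - 0) < r" by blast
  qed
  with U show ?thesis by blast
qed

text \<open>If the integrands depend on \<open>T\<^sub>N\<close> in a Lipschitz way with a square-integrable constant \<open>g\<close>, then convergence in
  the mean square of \<open>T\<^sub>N\<close> suffices for convergence of the integrals.\<close>

lemma tendsto_integral_of_L2:
  fixes T :: "nat \<Rightarrow> real \<Rightarrow> 'b::euclidean_space" and F :: "nat \<Rightarrow> real \<Rightarrow> 'c::euclidean_space" and g :: "real \<Rightarrow> real"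
  assumes T: "\<And>N. sq_integrable (T N)" and U: "sq_integrable U" and g: "sq_integrable g"
    and lim: "(\<lambda>N. \<integral>t. (norm (T N t - U t))\<^sup>2 \<partial>circ) \<longlonglongrightarrow> 0"
    and F: "\<And>N. integrable circ (F N)" and G: "integrable circ G"
    and le: "\<And>N t. norm (F N t - G t) \<le> g t * norm (T N t - U t)"
  shows "(\<lambda>N. \<integral>t. F N t \<partial>circ) \<longlonglongrightarrow> (\<integral>t. G t \<partial>circ)"
proof -
  define E where "E N = (\<integral>t. (norm (T N t - U t))\<^sup>2 \<partial>circ)" for N
  \<comment> \<open>The weight of the arithmetic-geometric mean inequality; the second summand keeps it positive when \<open>E N = 0\<close>.\<close>
  define c where "c N = sqrt (E N) + 1 / real (Suc N)" for N
  define K where "K = (\<integral>t. (g t)\<^sup>2 \<partial>circ)"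
  have E0: "0 \<le> E N" for N unfolding E_def by (intro Bochner_Integration.integral_nonneg) simp
  have c: "c N > 0" for N unfolding c_def by (intro add_nonneg_pos) (auto simp: E0)
  have TU: "sq_integrable (\<lambda>t. T N t - U t)" for N by (intro sq_integrable_diff T U)
  have "norm ((\<integral>t. F N t \<partial>circ) - (\<integral>t. G t \<partial>circ)) \<le> (K * c N + sqrt (E N)) / 2" for N
  proof -
    have "norm ((\<integral>t. F N t \<partial>circ) - (\<integral>t. G t \<partial>circ)) = norm (\<integral>t. F N t - G t \<partial>circ)"
      using F G by simp
    also have "\<dots> \<le> (\<integral>t. norm (F N t - G t) \<partial>circ)" by (rule integral_norm_bound)
    also have "\<dots> \<le> (\<integral>t. ((g t)\<^sup>2 * c N + (norm (T N t - U t))\<^sup>2 / c N) / 2 \<partial>circ)"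
    proof (rule integral_mono)
      show "integrable circ (\<lambda>t. norm (F N t - G t))" using F G by simp
      show "integrable circ (\<lambda>t. ((g t)\<^sup>2 * c N + (norm (T N t - U t))\<^sup>2 / c N) / 2)"
        using sq_integrableD(3)[OF g] sq_integrableD(3)[OF TU] by simp
      show "norm (F N t - G t) \<le> ((g t)\<^sup>2 * c N + (norm (T N t - U t))\<^sup>2 / c N) / 2" for t
      proof -
        have "2 * (g t * c N) * norm (T N t - U t) \<le> (g t * c N)\<^sup>2 + (norm (T N t - U t))\<^sup>2"
          by (rule sum_squares_bound)
        then have "g t * norm (T N t - U t) \<le> ((g t)\<^sup>2 * c N + (norm (T N t - U t))\<^sup>2 / c N) / 2"
          using c[of N] by (simp add: field_simps power2_eq_square)
        then show ?thesis using le[of N t] by linarith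
      qed
    qed
    also have "\<dots> = (K * c N + E N / c N) / 2"
      using sq_integrableD(3)[OF g] sq_integrableD(3)[OF TU] by (simp add: K_def E_def)
    also have "E N / c N \<le> sqrt (E N)"
    proof -
      have "E N = sqrt (E N) * sqrt (E N)" using E0 by simp
      also have "\<dots> \<le> sqrt (E N) * c N" using E0 by (intro mult_left_mono) (auto simp: c_def)
      finally show ?thesis using c[of N] by (simp add: pos_divide_le_eq)
    qed
    finally show ?thesis by simp
  qed
  then have "\<forall>\<^sub>F N in sequentially. norm ((\<integral>t. F N t \<partial>circ) - (\<integral>t. G t \<partial>circ)) \<le> (K * c N + sqrt (E N)) / 2"
    by (intro always_eventually allI)
  moreover have "(\<lambda>N. (K * c N + sqrt (E N)) / 2) \<longlonglongrightarrow> 0"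
  proof -
    have "E \<longlonglongrightarrow> 0" using lim by (simp only: E_def[abs_def])
    moreover have "(\<lambda>N. 1 / real (Suc N)) \<longlonglongrightarrow> 0"
      using LIMSEQ_inverse_real_of_nat by (simp only: inverse_eq_divide)
    ultimately have "(\<lambda>N. (K * c N + sqrt (E N)) / 2) \<longlonglongrightarrow> (K * (sqrt 0 + 0) + sqrt 0) / 2"
      unfolding c_def by (intro tendsto_intros) simp_all
    then show ?thesis by (simp only: real_sqrt_zero add_0_left mult_zero_right div_0)
  qed
  ultimately have "(\<lambda>N. (\<integral>t. F N t \<partial>circ) - (\<integral>t. G t \<partial>circ)) \<longlonglongrightarrow> 0"
    by (rule Lim_null_comparison)
  then show ?thesis by (simp add: LIM_zero_iff)
qed

section \<open>Trigonometric series of stem functions\<close>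

text \<open>A pair \<open>(p, q)\<close> stands for the element \<open>p + \<iota> q\<close> of the complexification of a real vector space, and \<open>rot \<theta>\<close>
  is multiplication by \<open>exp (\<iota> \<theta>)\<close>.\<close>

definition rot :: "real \<Rightarrow> 'a::euclidean_space \<times> 'a \<Rightarrow> 'a \<times> 'a" where
  "rot \<theta> u = cos \<theta> *\<^sub>R u + sin \<theta> *\<^sub>R (- snd u, fst u)"

lemma rot_0 [simp]: "rot 0 u = u" by (simp add: rot_def prod_eq_iff)

lemma rot_rot: "rot s (rot t u) = rot (s + t) u"
  by (simp add: rot_def prod_eq_iff cos_add sin_add algebra_simps)

lemma rot_add: "rot \<theta> (u + v) = rot \<theta> u + rot \<theta> v"
  by (simp add: rot_def prod_eq_iff algebra_simps)

lemma rot_scaleR: "rot \<theta> (c *\<^sub>R u) = c *\<^sub>R rot \<theta> u"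
  by (simp add: rot_def prod_eq_iff algebra_simps)

lemma inner_rot: "inner (rot s (a, 0)) (rot t (b, 0)) = cos (s - t) * inner a b"
  by (simp add: rot_def inner_prod_def cos_diff algebra_simps)

lemma norm_rot [simp]: "norm (rot \<theta> u) = norm u"
proof -
  have "inner (rot \<theta> u) (rot \<theta> u) = ((cos \<theta>)\<^sup>2 + (sin \<theta>)\<^sup>2) * inner u u"
    by (simp add: rot_def inner_prod_def inner_add_left inner_add_right power2_eq_square algebra_simps inner_commute
        del: sin_cos_squared_add sin_cos_squared_add2 sin_cos_squared_add3)
  then show ?thesis by (simp add: norm_eq_sqrt_inner)
qed

lemma continuous_rot [continuous_intros]:
  fixes f :: "'b::t2_space \<Rightarrow> real"
  assumes "continuous_on S f" "continuous_on S g"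
  shows "continuous_on S (\<lambda>t. rot (f t) (g t))"
  unfolding rot_def using assms by (auto intro!: continuous_intros)

lemma rot_measurable:
  assumes "f \<in> borel_measurable M" "g \<in> borel_measurable M"
  shows "(\<lambda>t. rot (f t) (g t)) \<in> borel_measurable M"
proof -
  have "continuous_on UNIV (\<lambda>p. rot (fst p) (snd p))" by (intro continuous_intros)
  from borel_measurable_continuous_Pair[OF assms this] show ?thesis by simp
qed

lemma sq_integrable_rot:
  assumes "f \<in> borel_measurable borel" "sq_integrable g"
  shows "sq_integrable (\<lambda>t. rot (f t) (g t))"
proof (rule sq_integrable_bound[OF assms(2), of _ 1])
  show "(\<lambda>t. rot (f t) (g t)) \<in> borel_measurable borel"
    by (rule rot_measurable[OF assms(1) sq_integrableD(1)[OF assms(2)]])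
qed simp

lemma cos_scaleR_rot: "cos a *\<^sub>R rot b u = (1/2) *\<^sub>R (rot (b + a) u + rot (b - a) u)"
proof -
  have half: "(c / 2) *\<^sub>R v + ((c / 2) *\<^sub>R v + w) = c *\<^sub>R v + w" "(c / 2) *\<^sub>R v + (c / 2) *\<^sub>R v = c *\<^sub>R v"
    for c and v w :: 'a
    by (simp_all add: add.assoc[symmetric] flip: scaleR_add_left)
  show ?thesis
    by (simp add: rot_def prod_eq_iff cos_add cos_diff sin_add sin_diff algebra_simps half)
qed

lemma affine_measurable_real: "(\<lambda>t. m * t + c) \<in> borel_measurable (borel :: real measure)"
  by (intro borel_measurable_continuous_onI continuous_intros)

lemma integral_rot:
  assumes "m \<in> \<int>"
  shows "(\<integral>t. rot (m * t + c) u \<partial>circ) = (if m = 0 then (2 * pi) *\<^sub>R rot c u else 0)"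
proof -
  interpret finite_measure circ by (rule finite_measure_circ)
  have sin_eq: "sin (m * t + c) = cos (m * t + (c - pi / 2))" for t
    by (simp add: sin_cos_eq cos_minus[symmetric, of "pi / 2 - _"] algebra_simps)
  have i: "integrable circ (\<lambda>t. cos (m * t + d))" for d
    using integrable_circ_scaleR_bounded[OF integrable_const[of "1::real"], of "\<lambda>t. cos (m * t + d)" 1]
    by (simp add: borel_measurable_continuous_onI continuous_intros)
  have "(\<integral>t. rot (m * t + c) u \<partial>circ) =
      (\<integral>t. cos (m * t + c) *\<^sub>R u \<partial>circ) + (\<integral>t. cos (m * t + (c - pi / 2)) *\<^sub>R (- snd u, fst u) \<partial>circ)"
    unfolding rot_def sin_eq by (intro Bochner_Integration.integral_add integrable_scaleR_left i)
  also have "\<dots> = (\<integral>t. cos (m * t + c) \<partial>circ) *\<^sub>R u + (\<integral>t. cos (m * t + (c - pi / 2)) \<partial>circ) *\<^sub>R (- snd u, fst u)"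
    by (simp only: integral_scaleR_left[OF i])
  also have "\<dots> = (if m = 0 then (2 * pi) *\<^sub>R rot c u else 0)"
    unfolding integral_circ_cos[OF assms] by (simp add: rot_def cos_diff scaleR_add_right zero_prod_def)
  finally show ?thesis .
qed

text \<open>Partial sums of \<open>\<Sum>k. exp (\<iota> e\<^sub>k t) a\<^sub>k\<close>, with coefficients \<open>a\<^sub>k\<close> in the real space and
  integer exponents \<open>e k\<close>.  Only the exponents \<open>k\<close> and \<open>- k\<close> are needed in the end.\<close>

definition trig_sum :: "(nat \<Rightarrow> int) \<Rightarrow> (nat \<Rightarrow> 'a::euclidean_space) \<Rightarrow> nat \<Rightarrow> real \<Rightarrow> 'a \<times> 'a" where
  "trig_sum e a N t = (\<Sum>k<N. rot (of_int (e k) * t) (a k, 0))"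

lemma sq_integrable_sum:
  assumes "\<And>k. k \<in> K \<Longrightarrow> sq_integrable (f k)"
  shows "sq_integrable (\<lambda>t. \<Sum>k\<in>K. f k t)"
  using assms by (induction K rule: infinite_finite_induct) (auto intro: sq_integrable_add sq_integrable_const)

lemma sq_integrable_rot_const: "sq_integrable (\<lambda>t. rot (m * t + c) u)"
  by (intro sq_integrable_rot sq_integrable_const affine_measurable_real)

lemma sq_integrable_trig_sum: "sq_integrable (trig_sum e a N)"
  using sq_integrable_rot_const[of _ 0] unfolding trig_sum_def[abs_def] by (intro sq_integrable_sum) simp

lemma integral_norm_sq_trig:
  assumes "finite K" "inj e"
  shows "(\<integral>t. (norm (\<Sum>k\<in>K. rot (of_int (e k) * t) (a k, 0)))\<^sup>2 \<partial>circ) = 2 * pi * (\<Sum>k\<in>K. (norm (a k))\<^sup>2)"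
proof -
  interpret finite_measure circ by (rule finite_measure_circ)
  have i: "integrable circ (\<lambda>t. cos (m * t))" for m
    using integrable_circ_scaleR_bounded[OF integrable_const[of "1::real"], of "\<lambda>t. cos (m * t)" 1]
    by (simp add: borel_measurable_continuous_onI continuous_intros)
  have "(norm (\<Sum>k\<in>K. rot (of_int (e k) * t) (a k, 0)))\<^sup>2 =
      (\<Sum>k\<in>K. \<Sum>l\<in>K. cos (of_int (e k - e l) * t) * inner (a k) (a l))" for t
    unfolding power2_norm_eq_inner inner_sum_left inner_sum_right inner_rot
    by (subst sum.swap) (simp add: left_diff_distrib)
  then have "(\<integral>t. (norm (\<Sum>k\<in>K. rot (of_int (e k) * t) (a k, 0)))\<^sup>2 \<partial>circ) =
      (\<Sum>k\<in>K. \<Sum>l\<in>K. (\<integral>t. cos (of_int (e k - e l) * t) \<partial>circ) * inner (a k) (a l))"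
    using i by simp
  also have "\<dots> = (\<Sum>k\<in>K. \<Sum>l\<in>K. if k = l then 2 * pi * inner (a k) (a k) else 0)"
  proof (intro sum.cong refl)
    fix k l
    have "(\<integral>t. cos (of_int (e k - e l) * t) \<partial>circ) = (if e k = e l then 2 * pi else 0)"
      using integral_circ_cos[of "of_int (e k - e l)" 0] by simp
    then show "(\<integral>t. cos (of_int (e k - e l) * t) \<partial>circ) * inner (a k) (a l) = (if k = l then 2 * pi * inner (a k) (a k) else 0)"
      using injD[OF assms(2), of k l] by auto
  qed
  also have "\<dots> = 2 * pi * (\<Sum>k\<in>K. (norm (a k))\<^sup>2)"
    using assms(1) by (simp add: sum_distrib_left power2_norm_eq_inner)
  finally show ?thesis .
qed

text \<open>The series with exponents \<open>e\<close> and coefficients \<open>a\<close> converges to \<open>U\<close> in the mean square.\<close>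

definition L2_series :: "(nat \<Rightarrow> int) \<Rightarrow> (nat \<Rightarrow> 'a::euclidean_space) \<Rightarrow> (real \<Rightarrow> 'a \<times> 'a) \<Rightarrow> bool" where
  "L2_series e a U \<longleftrightarrow> sq_integrable U \<and> (\<lambda>N. \<integral>t. (norm (trig_sum e a N t - U t))\<^sup>2 \<partial>circ) \<longlonglongrightarrow> 0"

lemma L2_series_exists:
  assumes e: "inj e" and a: "summable (\<lambda>k. (norm (a k))\<^sup>2)"
  shows "\<exists>U. L2_series e a U"
  unfolding L2_series_def
proof (intro L2_complete sq_integrable_trig_sum)
  fix \<epsilon> :: real assume "\<epsilon> > 0"
  then have "\<epsilon> / (2 * pi) > 0" by simp
  then obtain n where n: "\<And>m k. m \<ge> n \<Longrightarrow> norm (sum (\<lambda>k. (norm (a k))\<^sup>2) {m..<k}) < \<epsilon> / (2 * pi)"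
    using a unfolding summable_Cauchy by meson
  have le: "(\<integral>t. (norm (trig_sum e a N t - trig_sum e a M t))\<^sup>2 \<partial>circ) \<le> \<epsilon>" if "n \<le> M" "M \<le> N" for N M
  proof -
    have "trig_sum e a N t - trig_sum e a M t = (\<Sum>k\<in>{M..<N}. rot (of_int (e k) * t) (a k, 0))" for t
      unfolding trig_sum_def using that(2) by (simp add: sum_diff_nat_ivl lessThan_atLeast0)
    then have "(\<integral>t. (norm (trig_sum e a N t - trig_sum e a M t))\<^sup>2 \<partial>circ) = 2 * pi * (\<Sum>k\<in>{M..<N}. (norm (a k))\<^sup>2)"
      using integral_norm_sq_trig[OF _ e, of "{M..<N}" a] by simp
    also have "\<dots> \<le> 2 * pi * (\<epsilon> / (2 * pi))"
      using n[OF that(1), of N] by (intro mult_left_mono) auto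
    finally show ?thesis by simp
  qed
  have "(\<integral>t. (norm (trig_sum e a N t - trig_sum e a M t))\<^sup>2 \<partial>circ) \<le> \<epsilon>" if "n \<le> M" "n \<le> N" for N M
    using le[of M N] le[of N M] that by (cases "M \<le> N") (simp_all add: norm_minus_commute)
  then show "\<exists>n. \<forall>N\<ge>n. \<forall>M\<ge>n. (\<integral>t. (norm (trig_sum e a N t - trig_sum e a M t))\<^sup>2 \<partial>circ) \<le> \<epsilon>"
    by blast
qed

lemma L2_seriesD: "L2_series e a U \<Longrightarrow> sq_integrable U" by (simp add: L2_series_def)

text \<open>A square-integrable family of linear maps may be integrated term by term against a mean-square convergent series.  The
  three instances are the Fourier coefficients, the Poisson integral, and the product with a second such series.\<close>

lemma L2_series_tendsto_integral:
  fixes F :: "real \<Rightarrow> 'a::euclidean_space \<times> 'a \<Rightarrow> 'c::euclidean_space"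
  assumes U: "L2_series e a U" and g: "sq_integrable g"
    and F: "\<And>k. integrable circ (\<lambda>t. F t (rot (of_int (e k) * t) (a k, 0)))" "integrable circ (\<lambda>t. F t (U t))"
    and lin: "\<And>t. linear (F t)" and le: "\<And>t v. norm (F t v) \<le> g t * norm v"
  shows "(\<lambda>k. \<integral>t. F t (rot (of_int (e k) * t) (a k, 0)) \<partial>circ) sums (\<integral>t. F t (U t) \<partial>circ)"
proof -
  have eq: "F t (trig_sum e a N t) = (\<Sum>k<N. F t (rot (of_int (e k) * t) (a k, 0)))" for t N
    unfolding trig_sum_def using linear_sum[OF lin] by simp
  have "(\<lambda>N. \<integral>t. F t (trig_sum e a N t) \<partial>circ) \<longlonglongrightarrow> (\<integral>t. F t (U t) \<partial>circ)"
  proof (rule tendsto_integral_of_L2[OF sq_integrable_trig_sum L2_seriesD[OF U] g])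
    show "(\<lambda>N. \<integral>t. (norm (trig_sum e a N t - U t))\<^sup>2 \<partial>circ) \<longlonglongrightarrow> 0"
      using U by (simp add: L2_series_def)
    show "integrable circ (\<lambda>t. F t (trig_sum e a N t))" for N
      unfolding eq by (intro Bochner_Integration.integrable_sum F)
    show "norm (F t (trig_sum e a N t) - F t (U t)) \<le> g t * norm (trig_sum e a N t - U t)" for N t
      unfolding linear_diff[OF lin, symmetric] by (rule le)
  qed (rule F)
  then show ?thesis unfolding sums_def eq by (subst (asm) Bochner_Integration.integral_sum) (rule F)
qed

lemma linear_rot: "linear (rot \<theta>)"
  by (intro linearI) (simp_all add: rot_add rot_scaleR)

lemma L2_series_moment:
  assumes U: "L2_series e a U"
  shows "(\<lambda>k. if e k = n then ((2 * pi) *\<^sub>R a k, 0) else 0) sums (\<integral>t. rot (- of_int n * t) (U t) \<partial>circ)"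
proof -
  have m: "(\<lambda>t. c * t) \<in> borel_measurable (borel :: real measure)" for c
    using affine_measurable_real[of c 0] by simp
  have "(\<lambda>k. \<integral>t. rot (- of_int n * t) (rot (of_int (e k) * t) (a k, 0)) \<partial>circ) sums (\<integral>t. rot (- of_int n * t) (U t) \<partial>circ)"
  proof (rule L2_series_tendsto_integral[OF U sq_integrable_const[of "1::real"]])
    show "integrable circ (\<lambda>t. rot (- of_int n * t) (U t))"
      by (intro sq_integrable_imp_integrable sq_integrable_rot L2_seriesD[OF U] m)
    show "integrable circ (\<lambda>t. rot (- of_int n * t) (rot (of_int (e k) * t) (a k, 0)))" for k
      by (intro sq_integrable_imp_integrable sq_integrable_rot m sq_integrable_const)
  qed (simp_all add: linear_rot)
  moreover have "(\<integral>t. rot (- of_int n * t) (rot (of_int (e k) * t) (a k, 0)) \<partial>circ) =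
      (if e k = n then ((2 * pi) *\<^sub>R a k, 0) else 0)" for k
  proof -
    have "rot (- of_int n * t) (rot (of_int (e k) * t) (a k, 0)) = rot (of_int (e k - n) * t + 0) (a k, 0)" for t
      unfolding rot_rot by (simp add: algebra_simps)
    then show ?thesis by (simp only: integral_rot Ints_of_int) (simp add: scaleR_prod_def)
  qed
  ultimately show ?thesis by simp
qed

lemma L2_series_moment_eq:
  fixes a :: "nat \<Rightarrow> 'a::euclidean_space"
  assumes U: "L2_series e a U" and e: "inj e"
  shows "(\<integral>t. rot (- of_int (e k) * t) (U t) \<partial>circ) = ((2 * pi) *\<^sub>R a k, 0)"
proof -
  let ?v = "\<lambda>l. ((2 * pi) *\<^sub>R a l, 0 :: 'a)"
  have eq: "(\<lambda>l. if e l = e k then ?v l else 0) = (\<lambda>l. if l = k then ?v l else 0)"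
    using injD[OF e] by (auto simp: fun_eq_iff)
  have "(\<lambda>l. if e l = e k then ?v l else 0) sums ?v k"
    unfolding eq by (rule sums_single)
  with L2_series_moment[OF U] show ?thesis by (rule sums_unique2)
qed

lemma L2_series_moment_eq_0:
  fixes a :: "nat \<Rightarrow> 'a::euclidean_space"
  assumes U: "L2_series e a U" and n: "n \<notin> range e"
  shows "(\<integral>t. rot (- of_int n * t) (U t) \<partial>circ) = 0"
proof -
  have eq: "(\<lambda>l. if e l = n then ((2 * pi) *\<^sub>R a l, 0 :: 'a) else 0) = (\<lambda>l. 0)"
    using n by (auto simp: fun_eq_iff)
  have "(\<lambda>l. if e l = n then ((2 * pi) *\<^sub>R a l, 0 :: 'a) else 0) sums 0"
    unfolding eq by (rule sums_zero)
  with L2_series_moment[OF U] show ?thesis by (rule sums_unique2)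
qed

lemma poisson_integral_rot:
  assumes r: "0 \<le> r" "r < 1"
  shows "(\<integral>s. poisson r (t - s) *\<^sub>R rot (of_int m * s) u \<partial>circ) = (2 * pi * r ^ nat \<bar>m\<bar>) *\<^sub>R rot (of_int m * t) u"
proof -
  let ?h = "\<lambda>s. rot (of_int m * s) u"
  have h: "integrable circ (\<lambda>s. rot (k * s + c) u)" for k c
    by (intro sq_integrable_imp_integrable sq_integrable_rot_const)
  have h': "integrable circ ?h" using h[of _ 0] by simp
  have coef: "(\<integral>s. cos (real n * (t - s)) *\<^sub>R ?h s \<partial>circ) =
      (if n = nat \<bar>m\<bar> then (if m = 0 then 2 * pi else pi) *\<^sub>R rot (of_int m * t) u else 0)" for n
  proof -
    have "cos (real n * (t - s)) *\<^sub>R ?h s =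
        (1/2) *\<^sub>R (rot (of_int (m - int n) * s + real n * t) u + rot (of_int (m + int n) * s + - real n * t) u)" for s
      unfolding cos_scaleR_rot by (simp add: algebra_simps)
    then have "(\<integral>s. cos (real n * (t - s)) *\<^sub>R ?h s \<partial>circ) =
        (1/2) *\<^sub>R ((if m - int n = 0 then (2 * pi) *\<^sub>R rot (real n * t) u else 0) +
          (if m + int n = 0 then (2 * pi) *\<^sub>R rot (- real n * t) u else 0))"
      by (simp only: integral_scaleR_right Bochner_Integration.integral_add[OF h h] integral_rot Ints_of_int of_int_eq_0_iff)
    also have "\<dots> = (if n = nat \<bar>m\<bar> then (if m = 0 then 2 * pi else pi) *\<^sub>R rot (of_int m * t) u else 0)"
      by (cases "m = 0"; cases "m > 0") (auto simp: scaleR_2[symmetric])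
    finally show ?thesis .
  qed
  have h_int: "(\<integral>s. ?h s \<partial>circ) = (if m = 0 then (2 * pi) *\<^sub>R u else 0)"
    using integral_rot[of "of_int m" 0 u] by simp
  have "(\<lambda>n. r ^ n *\<^sub>R (if n = nat \<bar>m\<bar> then (if m = 0 then 2 * pi else pi) *\<^sub>R rot (of_int m * t) u else 0)) =
     (\<lambda>n. if n = nat \<bar>m\<bar> then r ^ n *\<^sub>R (if m = 0 then 2 * pi else pi) *\<^sub>R rot (of_int m * t) u else 0)"
    by auto
  then have "(\<lambda>n. r ^ n *\<^sub>R (if n = nat \<bar>m\<bar> then (if m = 0 then 2 * pi else pi) *\<^sub>R rot (of_int m * t) u else 0))
      sums (r ^ nat \<bar>m\<bar> *\<^sub>R (if m = 0 then 2 * pi else pi) *\<^sub>R rot (of_int m * t) u)"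
    using sums_single[of "nat \<bar>m\<bar>" "\<lambda>n. r ^ n *\<^sub>R (if m = 0 then 2 * pi else pi) *\<^sub>R rot (of_int m * t) u"]
    by (simp only:)
  from sums_unique2[OF this poisson_integral_series[OF r h', of t, unfolded coef]]
  have "r ^ nat \<bar>m\<bar> *\<^sub>R (if m = 0 then 2 * pi else pi) *\<^sub>R rot (of_int m * t) u =
      (1/2) *\<^sub>R ((\<integral>s. ?h s \<partial>circ) + (\<integral>s. poisson r (t - s) *\<^sub>R ?h s \<partial>circ))" .
  then have "(\<integral>s. poisson r (t - s) *\<^sub>R ?h s \<partial>circ) =
      2 *\<^sub>R (r ^ nat \<bar>m\<bar> *\<^sub>R (if m = 0 then 2 * pi else pi) *\<^sub>R rot (of_int m * t) u) - (\<integral>s. ?h s \<partial>circ)"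
    by (simp only: scaleR_scaleR) simp
  then show ?thesis unfolding h_int by (cases "m = 0") (simp_all add: mult_ac flip: scaleR_diff_left)
qed

text \<open>The Abel means of the series are the Poisson integrals of its sum.\<close>

lemma L2_series_poisson:
  assumes U: "L2_series e a U" and r: "0 \<le> r" "r < 1"
  shows "(\<lambda>k. r ^ nat \<bar>e k\<bar> *\<^sub>R rot (of_int (e k) * t) (a k, 0)) sums
    ((1 / (2 * pi)) *\<^sub>R (\<integral>s. poisson r (t - s) *\<^sub>R U s \<partial>circ))"
proof -
  have "(\<lambda>k. \<integral>s. poisson r (t - s) *\<^sub>R rot (of_int (e k) * s) (a k, 0) \<partial>circ) sums (\<integral>s. poisson r (t - s) *\<^sub>R U s \<partial>circ)"
  proof (rule L2_series_tendsto_integral[OF U sq_integrable_const[of "(1 + r) / (1 - r)"]])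
    show "integrable circ (\<lambda>s. poisson r (t - s) *\<^sub>R U s)"
      by (intro integrable_poisson r sq_integrable_imp_integrable L2_seriesD[OF U])
    show "integrable circ (\<lambda>s. poisson r (t - s) *\<^sub>R rot (of_int (e k) * s) (a k, 0))" for k
      using sq_integrable_rot_const[of "of_int (e k)" 0]
      by (intro integrable_poisson r sq_integrable_imp_integrable) simp
    show "linear (\<lambda>v. poisson r (t - s) *\<^sub>R v :: 'a \<times> 'a)" for s
      by (intro linearI) (simp_all add: scaleR_add_right)
    show "norm (poisson r (t - s) *\<^sub>R v) \<le> (1 + r) / (1 - r) * norm v" for s and v :: "'a \<times> 'a"
      unfolding norm_scaleR by (intro mult_right_mono poisson_abs_le r) simp
  qed
  from sums_scaleR_right[OF this, of "1 / (2 * pi)"] show ?thesis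
    unfolding poisson_integral_rot[OF r] by simp
qed

lemma L2_series_image:
  assumes U: "L2_series e a U" and L: "linear L" "\<And>v. norm (L v) = norm v"
    and eq: "\<And>k t. L (rot (of_int (e k) * t) (a k, 0)) = rot (of_int (e' k) * t) (a' k, 0)"
  shows "L2_series e' a' (\<lambda>t. L (U t))"
proof -
  have "L (trig_sum e a N t) = trig_sum e' a' N t" for N t
    unfolding trig_sum_def linear_sum[OF L(1)] eq ..
  then have "norm (trig_sum e' a' N t - L (U t)) = norm (trig_sum e a N t - U t)" for N t
    by (metis L linear_diff)
  moreover have "sq_integrable (\<lambda>t. L (U t))"
    unfolding sq_integrable_def L(2)
    by (intro conjI sq_integrableD(3) L2_seriesD[OF U] measurable_compose[OF sq_integrableD(1)[OF L2_seriesD[OF U]]]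
        borel_measurable_continuous_onI linear_continuous_on linear_conv_bounded_linear[THEN iffD1] L(1))
  ultimately show ?thesis using U by (simp add: L2_series_def)
qed

text \<open>An integrable function is determined by its Fourier coefficients: they determine its Poisson integral, and hence by
  Fatou's theorem the function itself.\<close>

theorem trig_moments_zero_imp_AE_zero:
  fixes h :: "real \<Rightarrow> 'a::euclidean_space"
  assumes h: "integrable circ h"
    and c: "\<And>n::nat. (\<integral>s. cos (real n * s) *\<^sub>R h s \<partial>circ) = 0"
    and s: "\<And>n::nat. (\<integral>s. sin (real n * s) *\<^sub>R h s \<partial>circ) = 0"
  shows "AE t in circ. h t = 0"
  using poisson_integral_tendsto_AE[OF h]
proof eventually_elim
  case (elim t)
  have i: "integrable circ (\<lambda>s. cos (real n * s) *\<^sub>R h s)" "integrable circ (\<lambda>s. sin (real n * s) *\<^sub>R h s)" for n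
    by (intro integrable_circ_scaleR_bounded[OF h, of _ 1] borel_measurable_continuous_onI continuous_intros; simp)+
  have "(\<integral>s. cos (real n * (t - s)) *\<^sub>R h s \<partial>circ) = 0" for n
  proof -
    have "cos (real n * (t - s)) *\<^sub>R h s = cos (real n * t) *\<^sub>R cos (real n * s) *\<^sub>R h s +
        sin (real n * t) *\<^sub>R sin (real n * s) *\<^sub>R h s" for s
      by (simp add: right_diff_distrib cos_diff algebra_simps)
    then show ?thesis using i[of n] by (simp add: c s del: scaleR_scaleR)
  qed
  then have "(\<integral>s. poisson r (t - s) *\<^sub>R h s \<partial>circ) = 0" if "0 \<le> r" "r < 1" for r
    using sums_unique2[OF sums_zero, of "(1/2) *\<^sub>R ((\<integral>s. h s \<partial>circ) + (\<integral>s. poisson r (t - s) *\<^sub>R h s \<partial>circ))"]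
      poisson_integral_series[OF that h, of t] c[of 0] by simp
  moreover have "\<forall>\<^sub>F r in at_left (1::real). 0 \<le> r \<and> r < 1"
    unfolding eventually_at_left_field by (intro exI[of _ 0]) auto
  ultimately have "\<forall>\<^sub>F r in at_left (1::real). (\<integral>s. poisson r (t - s) *\<^sub>R h s \<partial>circ) = 0"
    by (auto elim: eventually_mono)
  from elim[unfolded tendsto_cong[OF this]] have "(2 * pi) *\<^sub>R h t = 0"
    by (simp add: tendsto_const_iff)
  then show ?case by simp
qed

section \<open>Quaternions and unit circles\<close>

lemma qcnj_simps [simp]:
  "qRe (qcnj q) = qRe q" "qIm1 (qcnj q) = - qIm1 q" "qIm2 (qcnj q) = - qIm2 q" "qIm3 (qcnj q) = - qIm3 q"
  by (simp_all add: qcnj_def)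

lemma qcnj_mult: "qcnj (p * q) = qcnj q * qcnj p"
  by (simp add: quat_eq_iff algebra_simps)

lemma mult_qcnj: "q * qcnj q = of_real ((norm q)\<^sup>2)" "qcnj q * q = of_real ((norm q)\<^sup>2)"
  unfolding norm_quat_sq by (simp_all add: quat_eq_iff power2_eq_square algebra_simps)

lemma norm_qcnj [simp]: "norm (qcnj q) = norm q"
proof -
  have "(norm (qcnj q))\<^sup>2 = (norm q)\<^sup>2" by (simp add: norm_quat_sq)
  then show ?thesis by simp
qed

lemma linear_qcnj: "linear qcnj"
  by (intro linearI) (simp_all add: quat_eq_iff)

lemma bounded_linear_qcnj: "bounded_linear qcnj"
  using linear_qcnj by (simp add: linear_conv_bounded_linear)

lemma bounded_linear_qRe: "bounded_linear qRe"
  unfolding linear_conv_bounded_linear[symmetric] by (intro linearI) simp_all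

lemma imag_units_mult_self: "I \<in> imag_units \<Longrightarrow> I * I = - 1"
  by (simp add: imag_units_def power2_eq_square)

lemma imag_units_uminus: "I \<in> imag_units \<Longrightarrow> - I \<in> imag_units"
  by (simp add: imag_units_def)

lemma imag_units_nonempty: "Quat 0 1 0 0 \<in> imag_units"
  by (simp add: imag_units_iff)

lemma norm_imag_unit:
  assumes "I \<in> imag_units" shows "norm I = 1"
  using norm_quat_cis[OF assms, of "pi / 2"] by (simp add: quat_cis_def)

lemma qRe_quat_cis: "I \<in> imag_units \<Longrightarrow> qRe (quat_cis I t) = cos t"
  by (simp add: quat_cis_def imag_units_iff)

lemma quat_cis_0 [simp]: "quat_cis I 0 = 1"
  by (simp add: quat_cis_def)

lemma quat_cis_mult:
  assumes I: "I \<in> imag_units"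
  shows "quat_cis I s * quat_cis I t = quat_cis I (s + t)"
proof -
  have "quat_cis I s * quat_cis I t = of_real (cos s * cos t) + (cos s * sin t + sin s * cos t) *\<^sub>R I + (sin s * sin t) *\<^sub>R (I * I)"
    by (simp add: quat_cis_def algebra_simps of_real_def)
  also have "\<dots> = quat_cis I (s + t)"
    by (simp add: imag_units_mult_self[OF I] quat_cis_def cos_add sin_add of_real_def algebra_simps)
  finally show ?thesis .
qed

lemma quat_cis_power: "I \<in> imag_units \<Longrightarrow> quat_cis I t ^ n = quat_cis I (real n * t)"
  by (induction n) (simp_all add: quat_cis_mult algebra_simps)

lemma quat_cis_power_int:
  assumes I: "I \<in> imag_units"
  shows "quat_cis I t powi n = quat_cis I (of_int n * t)"
proof (cases "n \<ge> 0")
  case True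
  then show ?thesis by (simp add: power_int_def quat_cis_power[OF I])
next
  case False
  have "inverse (quat_cis I t) = quat_cis I (- t)"
    by (intro inverse_unique) (simp add: quat_cis_mult[OF I])
  then show ?thesis using False by (simp add: power_int_def quat_cis_power[OF I])
qed

lemma qcnj_quat_cis: "I \<in> imag_units \<Longrightarrow> qcnj (quat_cis I t) = quat_cis I (- t)"
  by (simp add: quat_eq_iff quat_cis_def imag_units_iff)

section \<open>Stems and Fourier coefficients on the circles\<close>

text \<open>The slice function \<open>p + I q\<close> induced on the slice of \<open>I\<close> by the stem \<open>p + \<iota> q\<close>.\<close>

definition stem_eval :: "quat \<Rightarrow> quat \<times> quat \<Rightarrow> quat" where
  "stem_eval I u = fst u + I * snd u"

lemma bounded_linear_stem_eval: "bounded_linear (stem_eval I)"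
  unfolding stem_eval_def[abs_def]
  by (intro bounded_linear_add bounded_linear_fst bounded_linear_compose[OF bounded_linear_mult_right bounded_linear_snd])

lemma stem_eval_rot:
  assumes I: "I \<in> imag_units"
  shows "stem_eval I (rot \<theta> u) = quat_cis I \<theta> * stem_eval I u"
proof -
  have "I * (I * q) = - q" for q using imag_units_mult_self[OF I] by (simp flip: mult.assoc)
  then show ?thesis
    by (simp add: stem_eval_def rot_def quat_cis_def of_real_def algebra_simps)
qed

text \<open>The product of the complexified quaternions.  It induces the slice product, whereas \<^const>\<open>stem_eval\<close> is in general not
  multiplicative.\<close>

definition stem_mult :: "quat \<times> quat \<Rightarrow> quat \<times> quat \<Rightarrow> quat \<times> quat" where
  "stem_mult u v = (fst u * fst v - snd u * snd v, fst u * snd v + snd u * fst v)"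

lemma norm_stem_mult_le: "norm (stem_mult u v) \<le> 4 * norm u * norm v"
proof -
  have comp: "norm (fst w) \<le> norm w" "norm (snd w) \<le> norm w" for w :: "quat \<times> quat"
    by (metis norm_fst_le prod.collapse, metis norm_snd_le prod.collapse)
  have b: "norm (x * y) \<le> norm u * norm v" if "norm x \<le> norm u" "norm y \<le> norm v" for x y :: quat
    unfolding norm_mult by (intro mult_mono that norm_ge_zero)
  have "norm (stem_mult u v) \<le> norm (fst u * fst v - snd u * snd v) + norm (fst u * snd v + snd u * fst v)"
    unfolding stem_mult_def by (rule norm_Pair_le)
  also have "\<dots> \<le> (norm (fst u * fst v) + norm (snd u * snd v)) + (norm (fst u * snd v) + norm (snd u * fst v))"
    by (intro add_mono norm_triangle_ineq4 norm_triangle_ineq)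
  also have "\<dots> \<le> (norm u * norm v + norm u * norm v) + (norm u * norm v + norm u * norm v)"
    by (intro add_mono b comp)
  finally show ?thesis by simp
qed

lemma bounded_bilinear_stem_mult: "bounded_bilinear stem_mult"
proof
  show "\<exists>K. \<forall>a b. norm (stem_mult a b) \<le> norm a * norm b * K"
    using norm_stem_mult_le by (intro exI[of _ 4]) (simp add: mult_ac)
qed (simp_all add: stem_mult_def prod_eq_iff algebra_simps)

lemma stem_mult_rot_left: "stem_mult (rot \<theta> u) v = rot \<theta> (stem_mult u v)"
  by (simp add: stem_mult_def rot_def prod_eq_iff algebra_simps)

lemma stem_mult_rot_right: "stem_mult u (rot \<theta> v) = rot \<theta> (stem_mult u v)"
  by (simp add: stem_mult_def rot_def prod_eq_iff algebra_simps)

lemma stem_mult_real: "stem_mult (a, 0) (b, 0) = (a * b, 0)"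
  by (simp add: stem_mult_def)

lemma stem_mult_measurable:
  assumes "f \<in> borel_measurable M" "g \<in> borel_measurable M"
  shows "(\<lambda>t. stem_mult (f t) (g t)) \<in> borel_measurable M"
proof -
  have "continuous_on UNIV (\<lambda>p. stem_mult (fst p) (snd p))"
    by (intro bounded_bilinear.continuous_on[OF bounded_bilinear_stem_mult] continuous_intros)
  from borel_measurable_continuous_Pair[OF assms this] show ?thesis by simp
qed

lemma integrable_stem_mult:
  assumes U: "sq_integrable U" and V: "sq_integrable V"
  shows "integrable circ (\<lambda>t. stem_mult (U t) (V t))"
proof (rule Bochner_Integration.integrable_bound)
  show "integrable circ (\<lambda>t. 4 * (norm (U t) * norm (V t)))"
    by (intro integrable_mult_right integrable_sq_mult sq_integrableD(3) U V
        measurable_compose[OF sq_integrableD(2) borel_measurable_norm])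
  show "(\<lambda>t. stem_mult (U t) (V t)) \<in> borel_measurable circ"
    by (intro stem_mult_measurable sq_integrableD(2) U V)
  show "AE t in circ. norm (stem_mult (U t) (V t)) \<le> norm (4 * (norm (U t) * norm (V t)))"
    using norm_stem_mult_le by (simp add: mult.assoc)
qed

text \<open>The coefficients of a one-sided series, indexed by the integer exponents and extended by \<open>0\<close>.\<close>

definition series_coeff :: "(nat \<Rightarrow> int) \<Rightarrow> (nat \<Rightarrow> 'a::zero) \<Rightarrow> int \<Rightarrow> 'a" where
  "series_coeff e a n = (if n \<in> range e then a (inv e n) else 0)"

lemma series_coeff_apply: "inj e \<Longrightarrow> series_coeff e a (e k) = a k"
  by (simp add: series_coeff_def)

text \<open>The Fourier coefficients of a stem, required to be real, that is, to have second component \<open>0\<close>.  This is the condition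
  for the induced slice function to have right Fourier coefficients that do not depend on the circle.\<close>

definition has_stem_coeffs :: "(real \<Rightarrow> quat \<times> quat) \<Rightarrow> (int \<Rightarrow> quat) \<Rightarrow> bool" where
  "has_stem_coeffs U c \<longleftrightarrow> integrable circ U \<and> (\<forall>n. (\<integral>t. rot (- of_int n * t) (U t) \<partial>circ) = ((2 * pi) *\<^sub>R c n, 0))"

lemma L2_series_has_stem_coeffs:
  assumes "L2_series e a U" "inj e"
  shows "has_stem_coeffs U (series_coeff e a)"
  unfolding has_stem_coeffs_def
proof (intro conjI allI)
  show "integrable circ U" by (intro sq_integrable_imp_integrable L2_seriesD[OF assms(1)])
  show "(\<integral>t. rot (- of_int n * t) (U t) \<partial>circ) = ((2 * pi) *\<^sub>R series_coeff e a n, 0)" for n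
  proof (cases "n \<in> range e")
    case True
    then show ?thesis
      using L2_series_moment_eq[OF assms] by (auto simp: series_coeff_apply assms)
  next
    case False
    then show ?thesis
      using L2_series_moment_eq_0[OF assms(1) False] by (simp add: series_coeff_def zero_prod_def)
  qed
qed

lemma series_coeff_sq_summable:
  fixes a :: "nat \<Rightarrow> 'a::real_normed_vector"
  assumes e: "inj e" and a: "summable (\<lambda>k. (norm (a k))\<^sup>2)"
  shows "(\<lambda>n. (norm (series_coeff e a n))\<^sup>2) summable_on UNIV"
proof -
  have "(\<lambda>k. (norm (a k))\<^sup>2) summable_on UNIV"
    using a by (intro norm_summable_imp_summable_on) simp
  then have "((\<lambda>n. (norm (series_coeff e a n))\<^sup>2) \<circ> e) summable_on UNIV"
    by (simp add: o_def series_coeff_apply[OF e])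
  then have "(\<lambda>n. (norm (series_coeff e a n))\<^sup>2) summable_on range e"
    by (simp add: summable_on_reindex[OF e])
  then show ?thesis
    by (subst summable_on_cong_neutral[where T="range e"]) (auto simp: series_coeff_def)
qed

text \<open>The Fourier coefficients of a product are the convolution of those of the factors.  It is enough to expand the left
  factor: the \<open>n\<close>-th coefficient of \<open>exp (\<iota> m t) a V\<close> is \<open>a \<beta>(n - m)\<close>, the scalar \<open>exp (\<iota> m t)\<close> being central.\<close>

lemma stem_mult_has_stem_coeffs:
  assumes U: "L2_series e a U" and e: "inj e" and a: "summable (\<lambda>k. (norm (a k))\<^sup>2)"
    and V: "sq_integrable V" "has_stem_coeffs V \<beta>" and \<beta>: "(\<lambda>n. (norm (\<beta> n))\<^sup>2) summable_on UNIV"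
  shows "has_stem_coeffs (\<lambda>t. stem_mult (U t) (V t)) (\<lambda>n. \<Sum>\<^sub>\<infinity>k. series_coeff e a k * \<beta> (n - k))"
  unfolding has_stem_coeffs_def
proof (intro conjI allI)
  interpret sm: bounded_bilinear stem_mult by (rule bounded_bilinear_stem_mult)
  show "integrable circ (\<lambda>t. stem_mult (U t) (V t))"
    by (intro integrable_stem_mult L2_seriesD[OF U] V)
  fix n
  let ?\<alpha> = "series_coeff e a"
  have m: "(\<lambda>t. c * t) \<in> borel_measurable (borel :: real measure)" for c
    using affine_measurable_real[of c 0] by simp
  have rV: "integrable circ (\<lambda>t. rot (c * t) (V t))" for c
    by (intro sq_integrable_imp_integrable sq_integrable_rot m V)
  have moment: "(\<integral>t. rot (- of_int n * t) (stem_mult (rot (of_int (e k) * t) (a k, 0)) (V t)) \<partial>circ) =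
      ((2 * pi) *\<^sub>R (a k * \<beta> (n - e k)), 0)" for k
  proof -
    have "rot (- of_int n * t) (stem_mult (rot (of_int (e k) * t) (a k, 0)) (V t)) =
        stem_mult (a k, 0) (rot (- of_int (n - e k) * t) (V t))" for t
      unfolding stem_mult_rot_left stem_mult_rot_right rot_rot by (simp add: algebra_simps)
    then have "(\<integral>t. rot (- of_int n * t) (stem_mult (rot (of_int (e k) * t) (a k, 0)) (V t)) \<partial>circ) =
        stem_mult (a k, 0) (\<integral>t. rot (- of_int (n - e k) * t) (V t) \<partial>circ)"
      using integral_bounded_linear[OF sm.bounded_linear_right rV] by simp
    also have "\<dots> = stem_mult (a k, 0) ((2 * pi) *\<^sub>R \<beta> (n - e k), 0)"
      using V(2) unfolding has_stem_coeffs_def by (simp only:)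
    also have "\<dots> = ((2 * pi) *\<^sub>R (a k * \<beta> (n - e k)), 0)" by (simp add: stem_mult_real)
    finally show ?thesis .
  qed
  have "(\<lambda>k. \<integral>t. rot (- of_int n * t) (stem_mult (rot (of_int (e k) * t) (a k, 0)) (V t)) \<partial>circ) sums
      (\<integral>t. rot (- of_int n * t) (stem_mult (U t) (V t)) \<partial>circ)"
  proof (rule L2_series_tendsto_integral[OF U, where F="\<lambda>t v. rot (- of_int n * t) (stem_mult v (V t))"])
    show "sq_integrable (\<lambda>t. 4 * norm (V t))"
      by (rule sq_integrable_bound[OF V(1), of _ 4])
        (auto intro!: borel_measurable_times measurable_compose[OF sq_integrableD(1)[OF V(1)] borel_measurable_norm])
    have *: "integrable circ (\<lambda>t. rot (- of_int n * t) (stem_mult (W t) (V t)))" if "sq_integrable W" for W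
    proof (rule Bochner_Integration.integrable_bound[OF integrable_stem_mult[OF that V(1)]])
      show "(\<lambda>t. rot (- of_int n * t) (stem_mult (W t) (V t))) \<in> borel_measurable circ"
        by (intro rot_measurable measurable_circ m stem_mult_measurable sq_integrableD(1) that V)
    qed simp
    show "integrable circ (\<lambda>t. rot (- of_int n * t) (stem_mult (U t) (V t)))"
      by (intro * L2_seriesD[OF U])
    show "integrable circ (\<lambda>t. rot (- of_int n * t) (stem_mult (rot (of_int (e k) * t) (a k, 0)) (V t)))" for k
      by (intro * sq_integrable_rot sq_integrable_const m)
    show "linear (\<lambda>v. rot (- of_int n * t) (stem_mult v (V t)))" for t
      by (intro linearI) (simp_all add: sm.add_left sm.scaleR_left rot_add rot_scaleR)
    show "norm (rot (- of_int n * t) (stem_mult v (V t))) \<le> 4 * norm (V t) * norm v" for t v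
      using norm_stem_mult_le[of v "V t"] by (simp add: mult_ac)
  qed
  then have L: "(\<lambda>k. ((2 * pi) *\<^sub>R (a k * \<beta> (n - e k)), 0)) sums (\<integral>t. rot (- of_int n * t) (stem_mult (U t) (V t)) \<partial>circ)"
    unfolding moment .
  have \<beta>': "(\<lambda>k. (norm (\<beta> (n - k)))\<^sup>2) summable_on UNIV"
  proof -
    have "bij_betw (\<lambda>k. n - k) UNIV UNIV"
      by (rule bij_betwI[where g="\<lambda>k. n - k"]) auto
    then show ?thesis using summable_on_reindex_bij_betw[of "\<lambda>k. n - k" UNIV UNIV "\<lambda>k. (norm (\<beta> k))\<^sup>2"] \<beta> by simp
  qed
  have "(\<lambda>k. norm (?\<alpha> k * \<beta> (n - k))) summable_on UNIV"
  proof (rule Infinite_Sum.abs_summable_on_comparison_test')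
    show "(\<lambda>k. (norm (?\<alpha> k))\<^sup>2 + (norm (\<beta> (n - k)))\<^sup>2) summable_on UNIV"
      by (intro summable_on_add series_coeff_sq_summable e a \<beta>')
    show "norm (?\<alpha> k * \<beta> (n - k)) \<le> (norm (?\<alpha> k))\<^sup>2 + (norm (\<beta> (n - k)))\<^sup>2" for k
    proof -
      have "2 * (norm (?\<alpha> k) * norm (\<beta> (n - k))) \<le> (norm (?\<alpha> k))\<^sup>2 + (norm (\<beta> (n - k)))\<^sup>2"
        using sum_squares_bound[of "norm (?\<alpha> k)" "norm (\<beta> (n - k))"] by (simp add: mult.assoc)
      moreover have "0 \<le> norm (?\<alpha> k) * norm (\<beta> (n - k))" by simp
      ultimately show ?thesis unfolding norm_mult by linarith
    qed
  qed
  then have "((\<lambda>k. ?\<alpha> k * \<beta> (n - k)) has_sum (\<Sum>\<^sub>\<infinity>k. ?\<alpha> k * \<beta> (n - k))) UNIV"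
    by (rule has_sum_infsum[OF abs_summable_summable])
  moreover have "((\<lambda>k. ?\<alpha> k * \<beta> (n - k)) has_sum S) UNIV \<longleftrightarrow> ((\<lambda>k. ?\<alpha> k * \<beta> (n - k)) has_sum S) (range e)" for S
    by (rule has_sum_cong_neutral) (simp_all add: series_coeff_def)
  ultimately have "((\<lambda>k. ?\<alpha> k * \<beta> (n - k)) has_sum (\<Sum>\<^sub>\<infinity>k. ?\<alpha> k * \<beta> (n - k))) (range e)"
    by (simp only:)
  then have "(\<lambda>k. a k * \<beta> (n - e k)) sums (\<Sum>\<^sub>\<infinity>k. ?\<alpha> k * \<beta> (n - k))"
    unfolding has_sum_reindex[OF e] o_def series_coeff_apply[OF e] by (rule has_sum_imp_sums)
  from bounded_linear.sums[OF _ this, of "\<lambda>x. ((2 * pi) *\<^sub>R x, 0)"]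
  have "(\<lambda>k. ((2 * pi) *\<^sub>R (a k * \<beta> (n - e k)), 0 :: quat)) sums ((2 * pi) *\<^sub>R (\<Sum>\<^sub>\<infinity>k. ?\<alpha> k * \<beta> (n - k)), 0)"
    by (simp add: bounded_linear_Pair bounded_linear_scaleR_right bounded_linear_zero)
  with L show "(\<integral>t. rot (- of_int n * t) (stem_mult (U t) (V t)) \<partial>circ) = ((2 * pi) *\<^sub>R (\<Sum>\<^sub>\<infinity>k. ?\<alpha> k * \<beta> (n - k)), 0)"
    by (rule sums_unique2)
qed

text \<open>On every circle, \<open>F\<close> agrees almost everywhere with the slice function induced by \<open>U\<close>.  The exceptional set of
  parameters may depend on the circle.\<close>

definition boundary_stem :: "(quat \<Rightarrow> quat) \<Rightarrow> (real \<Rightarrow> quat \<times> quat) \<Rightarrow> bool" where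
  "boundary_stem F U \<longleftrightarrow> F \<in> borel_measurable (restrict_space borel (sphere 0 1)) \<and>
     (\<forall>I\<in>imag_units. AE t in circ. F (quat_cis I t) = stem_eval I (U t))"

lemma measurable_on_circle:
  "F \<in> borel_measurable (restrict_space borel (sphere 0 1)) \<Longrightarrow>
   F \<in> borel_measurable (restrict_space borel (sphere 0 1 \<inter> slice I))"
  by (erule measurable_restrict_mono) auto

lemma measurable_quat_cis_circle:
  assumes "I \<in> imag_units" "F \<in> borel_measurable (restrict_space borel (sphere 0 1))"
  shows "(\<lambda>t. F (quat_cis I t)) \<in> borel_measurable circ"
  by (rule measurable_compose[OF quat_cis_measurable[OF assms(1)] measurable_on_circle[OF assms(2)]])

lemma boundary_stem_has_fourier_coeffs:
  assumes F: "boundary_stem F U" and U: "has_stem_coeffs U c"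
  shows "has_fourier_coeffs F c"
  unfolding has_fourier_coeffs_def
proof (intro ballI conjI allI)
  fix I assume I: "I \<in> imag_units"
  have Fm: "F \<in> borel_measurable (restrict_space borel (sphere 0 1))"
    and ae: "AE t in circ. F (quat_cis I t) = stem_eval I (U t)"
    using F I by (auto simp: boundary_stem_def)
  have Ui: "integrable circ U" using U by (simp add: has_stem_coeffs_def)
  have "integrable circ (\<lambda>t. stem_eval I (U t))"
    by (rule integrable_bounded_linear[OF bounded_linear_stem_eval Ui])
  then have "integrable circ (\<lambda>t. F (quat_cis I t))"
    using ae measurable_quat_cis_circle[OF I Fm] by (subst integrable_cong_AE[where g="\<lambda>t. stem_eval I (U t)"]) auto
  then show "integrable (circle_measure I) F"
    unfolding circle_measure_def
    by (subst integrable_distr_eq[OF quat_cis_measurable[OF I] measurable_on_circle[OF Fm]])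
  fix n :: int
  have powm: "(\<lambda>q. q powi (- n)) \<in> borel_measurable (restrict_space borel (sphere 0 1 \<inter> slice I))"
  proof -
    have "continuous_on (sphere (0::quat) 1 \<inter> slice I) (\<lambda>q. q powi (- n))"
      by (intro continuous_intros) auto
    then show ?thesis by (rule borel_measurable_continuous_on_restrict)
  qed
  have "(\<integral>q. q powi (- n) * F q \<partial>circle_measure I) = (\<integral>t. quat_cis I t powi (- n) * F (quat_cis I t) \<partial>circ)"
    unfolding circle_measure_def
    by (intro integral_distr quat_cis_measurable I borel_measurable_times powm measurable_on_circle Fm)
  also have "\<dots> = (\<integral>t. stem_eval I (rot (- of_int n * t) (U t)) \<partial>circ)"
  proof (rule integral_cong_AE)
    have "continuous_on UNIV (\<lambda>t. quat_cis I (of_int (- n) * t))"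
      unfolding quat_cis_def by (intro continuous_intros)
    then show "(\<lambda>t. quat_cis I t powi - n * F (quat_cis I t)) \<in> borel_measurable circ"
      unfolding quat_cis_power_int[OF I]
      by (intro borel_measurable_times measurable_quat_cis_circle I Fm measurable_circ borel_measurable_continuous_onI)
    have "(\<lambda>t. rot (- of_int n * t) (U t)) \<in> borel_measurable circ"
      using affine_measurable_real[of "- of_int n" 0]
      by (intro rot_measurable[OF measurable_circ borel_measurable_integrable[OF Ui]]) simp
    then show "(\<lambda>t. stem_eval I (rot (- of_int n * t) (U t))) \<in> borel_measurable circ"
      by (rule measurable_compose) (intro borel_measurable_continuous_onI linear_continuous_on bounded_linear_stem_eval)
    show "AE t in circ. quat_cis I t powi - n * F (quat_cis I t) = stem_eval I (rot (- of_int n * t) (U t))"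
      using ae by eventually_elim (simp add: quat_cis_power_int[OF I] stem_eval_rot[OF I])
  qed
  also have "\<dots> = stem_eval I (\<integral>t. rot (- of_int n * t) (U t) \<partial>circ)"
  proof (rule integral_bounded_linear[OF bounded_linear_stem_eval])
    show "integrable circ (\<lambda>t. rot (- of_int n * t) (U t))"
      using affine_measurable_real[of "- of_int n" 0]
      by (intro Bochner_Integration.integrable_bound[OF Ui]
          rot_measurable[OF measurable_circ borel_measurable_integrable[OF Ui]]) simp_all
  qed
  also have "\<dots> = (2 * pi) *\<^sub>R c n"
    using U by (simp add: has_stem_coeffs_def stem_eval_def)
  finally show "(1 / (2 * pi)) *\<^sub>R (\<integral>q. q powi (- n) * F q \<partial>circle_measure I) = c n" by simp
qed

lemma fourier_coeffs_eq:
  assumes "has_fourier_coeffs F c" shows "fourier_coeffs F = c"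
  unfolding fourier_coeffs_def
proof (rule the_equality[where P="has_fourier_coeffs F", OF assms])
  fix c' assume "has_fourier_coeffs F c'"
  with assms imag_units_nonempty show "c' = c"
    unfolding has_fourier_coeffs_def fun_eq_iff by metis
qed

text \<open>The coefficients with indices \<open>n\<close> and \<open>- n\<close> together give the cosine and sine moments, so they determine the function
  almost everywhere on each circle.\<close>

theorem has_fourier_coeffs_unique:
  assumes F: "has_fourier_coeffs F c" and G: "has_fourier_coeffs G c" and I: "I \<in> imag_units"
  shows "AE t in circ. F (quat_cis I t) = G (quat_cis I t)"
proof -
  define h where "h t = F (quat_cis I t) - G (quat_cis I t)" for t
  have i: "integrable circ (\<lambda>t. H (quat_cis I t))"
      "(\<integral>t. quat_cis I (- of_int n * t) * H (quat_cis I t) \<partial>circ) = (2 * pi) *\<^sub>R c n"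
    if H: "has_fourier_coeffs H c" for H n
  proof -
    have H': "integrable (circle_measure I) H" "(1 / (2 * pi)) *\<^sub>R (\<integral>q. q powi (- n) * H q \<partial>circle_measure I) = c n"
      using H I by (auto simp: has_fourier_coeffs_def)
    have Hm: "H \<in> borel_measurable (restrict_space borel (sphere 0 1 \<inter> slice I))"
      using borel_measurable_integrable[OF H'(1)] by (simp add: circle_measure_def)
    show "integrable circ (\<lambda>t. H (quat_cis I t))"
      using H'(1) unfolding circle_measure_def
      by (subst (asm) integrable_distr_eq[OF quat_cis_measurable[OF I] Hm])
    have powm: "(\<lambda>q. q powi (- n)) \<in> borel_measurable (restrict_space borel (sphere 0 1 \<inter> slice I))"
    proof -
      have "continuous_on (sphere (0::quat) 1 \<inter> slice I) (\<lambda>q. q powi (- n))"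
        by (intro continuous_intros) auto
      then show ?thesis by (rule borel_measurable_continuous_on_restrict)
    qed
    have "(\<integral>q. q powi (- n) * H q \<partial>circle_measure I) = (\<integral>t. quat_cis I t powi (- n) * H (quat_cis I t) \<partial>circ)"
      unfolding circle_measure_def
      by (intro integral_distr quat_cis_measurable I borel_measurable_times powm Hm)
    also have "\<dots> = (\<integral>t. quat_cis I (- of_int n * t) * H (quat_cis I t) \<partial>circ)"
      by (simp add: quat_cis_power_int[OF I])
    finally show "(\<integral>t. quat_cis I (- of_int n * t) * H (quat_cis I t) \<partial>circ) = (2 * pi) *\<^sub>R c n"
      using H'(2) by (simp flip: H'(2))
  qed
  have h: "integrable circ h"
    unfolding h_def[abs_def] by (intro Bochner_Integration.integrable_diff i(1) F G)
  have cis_m: "(\<lambda>t. quat_cis I (k * t)) \<in> borel_measurable circ" for k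
    unfolding quat_cis_def by (intro measurable_circ borel_measurable_continuous_onI continuous_intros)
  have ci: "integrable circ (\<lambda>t. quat_cis I (k * t) * g t)" if "integrable circ g" for k g
    using that by (intro Bochner_Integration.integrable_bound[OF that] borel_measurable_times cis_m)
      (auto simp: norm_mult norm_quat_cis[OF I])
  have zero: "(\<integral>t. quat_cis I (of_int n * t) * h t \<partial>circ) = 0" for n :: int
  proof -
    have "(\<integral>t. quat_cis I (- of_int (- n) * t) * h t \<partial>circ) =
        (\<integral>t. quat_cis I (- of_int (- n) * t) * F (quat_cis I t) \<partial>circ) - (\<integral>t. quat_cis I (- of_int (- n) * t) * G (quat_cis I t) \<partial>circ)"
      unfolding h_def right_diff_distrib by (intro Bochner_Integration.integral_diff ci i(1) F G)
    then show ?thesis unfolding i(2)[OF F] i(2)[OF G] by simp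
  qed
  have zero': "(\<integral>t. quat_cis I (real n * t) * h t \<partial>circ) = 0" "(\<integral>t. quat_cis I (- real n * t) * h t \<partial>circ) = 0" for n
    using zero[of "int n"] zero[of "- int n"] by simp_all
  have "AE t in circ. h t = 0"
  proof (rule trig_moments_zero_imp_AE_zero[OF h])
    fix n :: nat
    have "cos (real n * t) *\<^sub>R h t = (1/2) *\<^sub>R (quat_cis I (real n * t) * h t + quat_cis I (- real n * t) * h t)" for t
      by (simp add: quat_cis_def of_real_def algebra_simps flip: scaleR_2)
    then show "(\<integral>t. cos (real n * t) *\<^sub>R h t \<partial>circ) = 0"
      by (simp only: integral_scaleR_right Bochner_Integration.integral_add[OF ci[OF h] ci[OF h]] zero')
        simp
    have "I * ((1/2) *\<^sub>R (quat_cis I (- real n * t) * h t - quat_cis I (real n * t) * h t)) = sin (real n * t) *\<^sub>R h t" for t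
    proof -
      have "I * ((1/2) *\<^sub>R (quat_cis I (- real n * t) * h t - quat_cis I (real n * t) * h t)) = - (sin (real n * t) *\<^sub>R (I * I * h t))"
        by (simp add: quat_cis_def of_real_def algebra_simps flip: scaleR_2)
      then show ?thesis by (simp add: imag_units_mult_self[OF I])
    qed
    then have "(\<integral>t. sin (real n * t) *\<^sub>R h t \<partial>circ) =
        (\<integral>t. I * ((1/2) *\<^sub>R (quat_cis I (- real n * t) * h t - quat_cis I (real n * t) * h t)) \<partial>circ)" by simp
    also have "\<dots> = I * ((1/2) *\<^sub>R ((\<integral>t. quat_cis I (- real n * t) * h t \<partial>circ) - (\<integral>t. quat_cis I (real n * t) * h t \<partial>circ)))"
      by (subst integral_bounded_linear[OF bounded_linear_mult_right],
          intro integrable_scaleR_right Bochner_Integration.integrable_diff ci h)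
        (simp only: integral_scaleR_right Bochner_Integration.integral_diff[OF ci[OF h] ci[OF h]])
    also have "\<dots> = 0" unfolding zero' by simp
    finally show "(\<integral>t. sin (real n * t) *\<^sub>R h t \<partial>circ) = 0" .
  qed
  then show ?thesis by (simp add: h_def)
qed

section \<open>The slice product of boundary functions\<close>

lemma eventually_at_left_1: "\<forall>\<^sub>F r in at_left (1::real). 0 \<le> r \<and> r < 1"
  unfolding eventually_at_left_field by (intro exI[of _ 0]) auto

text \<open>Complex conjugation \<open>\<iota> \<mapsto> - \<iota>\<close> of stems.\<close>

definition stem_mirror :: "quat \<times> quat \<Rightarrow> quat \<times> quat" where
  "stem_mirror u = (fst u, - snd u)"

text \<open>Quaternionic conjugation of both components of a stem.\<close>

definition stem_cnj :: "quat \<times> quat \<Rightarrow> quat \<times> quat" where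
  "stem_cnj u = (qcnj (fst u), qcnj (snd u))"

lemma linear_stem_mirror: "linear stem_mirror"
  by (intro linearI) (simp_all add: stem_mirror_def)

lemma bounded_linear_stem_mirror: "bounded_linear stem_mirror"
  using linear_stem_mirror by (simp add: linear_conv_bounded_linear)

lemma linear_stem_cnj: "linear stem_cnj"
  by (intro linearI) (simp_all add: stem_cnj_def linear_add[OF linear_qcnj] linear_scale[OF linear_qcnj])

lemma norm_stem_mirror [simp]: "norm (stem_mirror u) = norm u"
  by (simp add: stem_mirror_def norm_prod_def)

lemma norm_stem_cnj [simp]: "norm (stem_cnj u) = norm u"
  by (simp add: stem_cnj_def norm_prod_def)

lemma stem_mirror_rot: "stem_mirror (rot \<theta> (a, 0)) = rot (- \<theta>) (a, 0)"
  by (simp add: stem_mirror_def rot_def)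

lemma stem_cnj_rot: "stem_cnj (rot \<theta> (a, 0)) = rot \<theta> (qcnj a, 0)"
  by (simp add: stem_cnj_def rot_def linear_add[OF linear_qcnj] linear_scale[OF linear_qcnj] linear_0[OF linear_qcnj])

lemma stem_mirror_mult: "stem_mirror (stem_mult u v) = stem_mult (stem_mirror u) (stem_mirror v)"
  by (simp add: stem_mirror_def stem_mult_def)

lemma stem_eval_uminus: "stem_eval (- I) u = stem_eval I (stem_mirror u)"
  by (simp add: stem_eval_def stem_mirror_def)

lemma quat_cis_uminus: "quat_cis (- I) t = quat_cis I (- t)"
  by (simp add: quat_cis_def)

lemma AE_circ_iff: "(AE t in circ. P t) \<longleftrightarrow> (AE t in lborel. t \<in> {0..<2 * pi} \<longrightarrow> P t)"
  by (subst AE_restrict_space_iff) auto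

lemma AE_circ_reflect:
  assumes "AE t in circ. P t" shows "AE t in circ. P (2 * pi - t)"
proof -
  let ?Q = "\<lambda>t. t \<in> {0..<2 * pi} \<longrightarrow> P t"
  have "AE t in distr lborel borel ((+) (2 * pi)). ?Q t"
    using assms unfolding lborel_distr_plus AE_circ_iff .
  then have "AE t in lborel. ?Q (2 * pi + t)"
    by (intro AE_distrD[where f="(+) (2 * pi)" and M=lborel and M'=borel and P="?Q"]) simp_all
  from AE_lborel_uminus[OF this] AE_lborel_singleton[of 0] show ?thesis
    unfolding AE_circ_iff by eventually_elim auto
qed

lemma rot_reflect: "rot (of_int k * (2 * pi - t)) (a, 0) = stem_mirror (rot (of_int k * t) (a, 0))"
proof -
  have "of_int k * (2 * pi - t) = 2 * pi * of_int k - of_int k * t" by (simp add: algebra_simps)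
  then show ?thesis
    by (simp add: rot_def stem_mirror_def cos_diff sin_diff cos_int_2pin sin_int_2pin)
qed

text \<open>The sum of a series with coefficients in the real space is a stem function: its first component
  is even and the second one odd.  The Poisson integrals have these symmetries exactly, and they pass to radial limits.\<close>

theorem L2_series_parity:
  assumes U: "L2_series e a U"
  shows "AE t in circ. U (2 * pi - t) = stem_mirror (U t)"
proof -
  note lim = poisson_integral_tendsto_AE[OF sq_integrable_imp_integrable[OF L2_seriesD[OF U]]]
  let ?PI = "\<lambda>r t. \<integral>s. poisson r (t - s) *\<^sub>R U s \<partial>circ"
  have PI: "?PI r (2 * pi - t) = stem_mirror (?PI r t)" if r: "0 \<le> r" "r < 1" for r t
  proof -
    have "(\<lambda>k. stem_mirror (r ^ nat \<bar>e k\<bar> *\<^sub>R rot (of_int (e k) * t) (a k, 0))) sums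
        stem_mirror ((1 / (2 * pi)) *\<^sub>R ?PI r t)"
      by (rule bounded_linear.sums[OF bounded_linear_stem_mirror L2_series_poisson[OF U r]])
    then have "(\<lambda>k. r ^ nat \<bar>e k\<bar> *\<^sub>R rot (of_int (e k) * (2 * pi - t)) (a k, 0)) sums
        ((1 / (2 * pi)) *\<^sub>R stem_mirror (?PI r t))"
      unfolding rot_reflect linear_scale[OF linear_stem_mirror] .
    from sums_unique2[OF this L2_series_poisson[OF U r]] show ?thesis by simp
  qed
  show ?thesis
    using lim AE_circ_reflect[OF lim]
  proof eventually_elim
    case (elim t)
    have "((\<lambda>r. stem_mirror (?PI r t)) \<longlongrightarrow> stem_mirror ((2 * pi) *\<^sub>R U t)) (at_left 1)"
      by (rule bounded_linear.tendsto[OF bounded_linear_stem_mirror elim(1)])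
    moreover have "\<forall>\<^sub>F r in at_left 1. stem_mirror (?PI r t) = ?PI r (2 * pi - t)"
      using eventually_at_left_1 by eventually_elim (simp add: PI)
    ultimately have "((\<lambda>r. ?PI r (2 * pi - t)) \<longlongrightarrow> stem_mirror ((2 * pi) *\<^sub>R U t)) (at_left 1)"
      by (rule Lim_transform_eventually)
    from tendsto_unique[OF _ elim(2) this] show ?case
      unfolding linear_scale[OF linear_stem_mirror] by simp
  qed
qed

text \<open>A stem with the right parity is induced by a Borel function on the whole sphere.  Each \<open>q = exp (t I)\<close> is also
  \<open>exp ((2 \<pi> - t) (- I))\<close>; of the two representations the one with angle in
  \<open>[0, \<pi>]\<close> is used, which is a Borel function of \<open>q\<close>, and parity gives consistency on the other half circle.\<close>

theorem boundary_stem_exists: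
  assumes W: "W \<in> borel_measurable borel" and parity: "AE t in circ. W (2 * pi - t) = stem_mirror (W t)"
  shows "\<exists>H. boundary_stem H W"
proof -
  \<comment> \<open>Clamping changes nothing on the sphere and makes the angle continuous on the whole space.\<close>
  define angle where "angle q = arccos (max (-1) (min 1 (qRe q)))" for q
  define J where "J q = inverse (norm (q - of_real (qRe q))) *\<^sub>R (q - of_real (qRe q))" for q :: quat
  define H where "H q = stem_eval (J q) (W (angle q))" for q
  have qRe_c: "continuous_on UNIV qRe" by (rule linear_continuous_on[OF bounded_linear_qRe])
  have "continuous_on UNIV angle"
    unfolding angle_def by (intro continuous_on_arccos continuous_intros qRe_c) auto
  then have "angle \<in> borel_measurable borel" by (rule borel_measurable_continuous_onI)
  then have Wm: "(\<lambda>q. W (angle q)) \<in> borel_measurable borel" by (rule measurable_compose[OF _ W])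
  have im: "(\<lambda>q. q - of_real (qRe q)) \<in> borel_measurable (borel :: quat measure)"
    by (intro borel_measurable_continuous_onI continuous_intros qRe_c)
  have Jm: "J \<in> borel_measurable borel"
    unfolding J_def[abs_def]
    by (intro borel_measurable_scaleR borel_measurable_inverse measurable_compose[OF im borel_measurable_norm] im)
  have "H \<in> borel_measurable borel"
    unfolding H_def[abs_def] stem_eval_def
    by (intro borel_measurable_add borel_measurable_times Jm measurable_compose[OF Wm]
        borel_measurable_continuous_onI continuous_on_fst continuous_on_snd continuous_on_id)
  then have Hm: "H \<in> borel_measurable (restrict_space borel (sphere 0 1))"
    by (rule measurable_restrict_space1)
  have "AE t in circ. H (quat_cis I t) = stem_eval I (W t)" if I: "I \<in> imag_units" for I
  proof -
    have im_eq: "quat_cis I t - of_real (qRe (quat_cis I t)) = sin t *\<^sub>R I" for t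
      using I by (simp add: qRe_quat_cis) (simp add: quat_cis_def)
    have J_eq: "J (quat_cis I t) = sgn (sin t) *\<^sub>R I" for t
      unfolding J_def im_eq using norm_imag_unit[OF I] by (simp add: sgn_real_def)
    have angle_eq: "angle (quat_cis I t) = arccos (cos t)" for t
    proof -
      have "max (-1) (min 1 (cos t)) = cos t"
        using cos_ge_minus_one[of t] cos_le_one[of t] by linarith
      then show ?thesis by (simp only: angle_def qRe_quat_cis[OF I])
    qed
    have "AE t in lborel. t \<in> {0..<2 * pi} \<longrightarrow> H (quat_cis I t) = stem_eval I (W t)"
      using parity[unfolded AE_circ_iff] AE_lborel_singleton[of 0] AE_lborel_singleton[of pi]
    proof eventually_elim
      case (elim t)
      show ?case
      proof
        assume t: "t \<in> {0..<2 * pi}"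
        then consider "0 < t" "t < pi" | "pi < t" "t < 2 * pi" using elim by fastforce
        then show "H (quat_cis I t) = stem_eval I (W t)"
        proof cases
          case 1
          then show ?thesis using sin_gt_zero[of t] by (simp add: H_def J_eq angle_eq arccos_cos)
        next
          case 2
          have "arccos (cos t) = arccos (cos (2 * pi - t))" by (simp add: cos_diff)
          also have "\<dots> = 2 * pi - t" using 2 by (intro arccos_cos) auto
          finally have "angle (quat_cis I t) = 2 * pi - t" by (simp add: angle_eq)
          moreover have "sin t < 0" using sin_gt_zero[of "2 * pi - t"] 2 by (simp add: sin_diff)
          moreover have "W (2 * pi - t) = stem_mirror (W t)" using elim t by blast
          ultimately show ?thesis
            by (simp add: H_def J_eq stem_eval_uminus) (simp add: stem_mirror_def stem_eval_def)
        qed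
      qed
    qed
    then show ?thesis unfolding AE_circ_iff .
  qed
  with Hm show ?thesis unfolding boundary_stem_def by blast
qed

text \<open>The slice product of two series is induced by the product of their stems.  The induced function shows that the choice in
  \<^const>\<open>slice_prod\<close> is not vacuous, and uniqueness of Fourier coefficients identifies the chosen function with it on every
  circle.\<close>

theorem slice_prod_stem:
  assumes F: "boundary_stem F U" "L2_series e a U" "inj e" "summable (\<lambda>k. (norm (a k))\<^sup>2)"
    and G: "boundary_stem G V" "L2_series e' b V" "inj e'" "summable (\<lambda>k. (norm (b k))\<^sup>2)"
  shows "boundary_stem (F \<star> G) (\<lambda>t. stem_mult (U t) (V t))"
proof -
  let ?W = "\<lambda>t. stem_mult (U t) (V t)"
  let ?c = "\<lambda>n. \<Sum>\<^sub>\<infinity>k. series_coeff e a k * series_coeff e' b (n - k)"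
  have Fc: "fourier_coeffs F = series_coeff e a"
    by (intro fourier_coeffs_eq boundary_stem_has_fourier_coeffs[OF F(1)] L2_series_has_stem_coeffs F)
  have Gc: "fourier_coeffs G = series_coeff e' b"
    by (intro fourier_coeffs_eq boundary_stem_has_fourier_coeffs[OF G(1)] L2_series_has_stem_coeffs G)
  have Wc: "has_stem_coeffs ?W ?c"
    by (intro stem_mult_has_stem_coeffs F L2_seriesD[OF G(2)] L2_series_has_stem_coeffs G series_coeff_sq_summable)
  have "AE t in circ. ?W (2 * pi - t) = stem_mirror (?W t)"
    using L2_series_parity[OF F(2)] L2_series_parity[OF G(2)]
    by eventually_elim (simp add: stem_mirror_mult)
  then obtain H where H: "boundary_stem H ?W"
    using boundary_stem_exists[OF stem_mult_measurable[OF sq_integrableD(1)[OF L2_seriesD[OF F(2)]] sq_integrableD(1)[OF L2_seriesD[OF G(2)]]]]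
    by blast
  have Hc: "has_fourier_coeffs H ?c" by (rule boundary_stem_has_fourier_coeffs[OF H Wc])
  have "F \<star> G \<in> borel_measurable (restrict_space borel (sphere 0 1)) \<and> has_fourier_coeffs (F \<star> G) ?c"
    unfolding slice_prod_def Fc Gc
    by (rule someI[of _ H]) (use H Hc in \<open>simp add: boundary_stem_def\<close>)
  then have P: "F \<star> G \<in> borel_measurable (restrict_space borel (sphere 0 1))" "has_fourier_coeffs (F \<star> G) ?c"
    by blast+
  have "AE t in circ. (F \<star> G) (quat_cis I t) = stem_eval I (?W t)" if I: "I \<in> imag_units" for I
  proof -
    have "AE t in circ. H (quat_cis I t) = stem_eval I (?W t)"
      using H I by (simp add: boundary_stem_def)
    with has_fourier_coeffs_unique[OF P(2) Hc I] show ?thesis by eventually_elim simp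
  qed
  with P(1) show ?thesis by (simp add: boundary_stem_def)
qed

section \<open>Boundary values of power series\<close>

text \<open>At points where the radial limit does not exist, \<^const>\<open>boundary_value\<close> takes one fixed unspecified value, so only the set
  of convergence has to be shown to be Borel.\<close>

theorem boundary_value_measurable:
  assumes g: "continuous_on (ball 0 1) g"
  shows "boundary_value g \<in> borel_measurable (restrict_space borel (sphere 0 1))"
proof -
  let ?M = "restrict_space borel (sphere (0::quat) 1)"
  define G where "G r q = (if 0 \<le> r \<and> r < 1 then g (r *\<^sub>R q) else 0)" for r :: real and q
  have Gm: "G r \<in> borel_measurable ?M" for r
  proof (cases "0 \<le> r \<and> r < 1")
    case True
    then have "continuous_on (sphere 0 1) (\<lambda>q. g (r *\<^sub>R q))"
      by (intro continuous_on_compose2[OF g] continuous_intros) auto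
    then have "(\<lambda>q. g (r *\<^sub>R q)) \<in> borel_measurable ?M"
      by (rule borel_measurable_continuous_on_restrict)
    moreover have "G r = (\<lambda>q. g (r *\<^sub>R q))" using True by (simp add: G_def[abs_def])
    ultimately show ?thesis by simp
  next
    case False
    then have "G r = (\<lambda>_. 0)" by (auto simp: G_def fun_eq_iff)
    then show ?thesis by simp
  qed
  define x where "x n = 1 - 1 / real (Suc (Suc n))" for n
  have x: "0 \<le> x n" "x n < 1" for n by (simp_all add: x_def field_simps)
  have x_lim: "x \<longlonglongrightarrow> 1"
    unfolding x_def[abs_def] by real_asymp
  define L where "L q = lim (\<lambda>n. G (x n) q)" for q
  have Lm: "L \<in> borel_measurable ?M"
    unfolding L_def[abs_def] by (intro borel_measurable_lim_metric Gm)
  \<comment> \<open>Convergence to the limit \<open>L q\<close> along the sequence \<open>x\<close>, tested on rational radii only; continuity covers the others.\<close>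
  define C where "C q \<longleftrightarrow> (\<forall>k::nat. \<exists>n::nat. \<forall>y::rat. 1 - 1 / real (Suc n) < of_rat y \<and> of_rat y < (1::real) \<longrightarrow>
      dist (G (of_rat y) q) (L q) \<le> 1 / real (Suc k))" for q
  have C_iff: "C q \<longleftrightarrow> ((\<lambda>r. g (r *\<^sub>R q)) \<longlongrightarrow> L q) (at_left 1)" if q: "q \<in> sphere 0 1" for q
  proof
    assume C: "C q"
    show "((\<lambda>r. g (r *\<^sub>R q)) \<longlongrightarrow> L q) (at_left 1)"
    proof (rule tendstoI)
      fix e :: real assume "e > 0"
      then obtain k where k: "1 / real (Suc k) < e" using nat_approx_posE by blast
      from C obtain n where n: "\<And>y::rat. 1 - 1 / real (Suc n) < of_rat y \<Longrightarrow> of_rat y < (1::real) \<Longrightarrow>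
          dist (G (of_rat y) q) (L q) \<le> 1 / real (Suc k)" unfolding C_def by blast
      define z where "z = 1 - 1 / real (Suc n)"
      have z: "0 \<le> z" "z < 1" by (simp_all add: z_def)
      have "dist (g (r *\<^sub>R q)) (L q) \<le> 1 / real (Suc k)" if r: "z < r" "r < 1" for r
      proof -
        have "continuous_on {z<..<1} (\<lambda>r. g (r *\<^sub>R q))"
          using q z by (intro continuous_on_compose2[OF g] continuous_intros) auto
        then have ic: "isCont (\<lambda>r. g (r *\<^sub>R q)) r"
          using r by (simp add: continuous_on_eq_continuous_at)
        show ?thesis
        proof (rule ccontr)
          assume "\<not> ?thesis"
          then have "1 / real (Suc k) < dist (g (r *\<^sub>R q)) (L q)" by simp
          moreover have "((\<lambda>r. dist (g (r *\<^sub>R q)) (L q)) \<longlongrightarrow> dist (g (r *\<^sub>R q)) (L q)) (at r)"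
            using ic unfolding isCont_def by (intro tendsto_intros)
          ultimately have "\<forall>\<^sub>F s in at r. 1 / real (Suc k) < dist (g (s *\<^sub>R q)) (L q)"
            by (rule order_tendstoD(1)[rotated])
          then obtain d where d: "d > 0" "\<And>s. s \<noteq> r \<Longrightarrow> dist s r < d \<Longrightarrow> 1 / real (Suc k) < dist (g (s *\<^sub>R q)) (L q)"
            unfolding eventually_at by auto
          obtain y where y: "r < of_rat y" "of_rat y < min 1 (r + d)"
            using of_rat_dense[of r "min 1 (r + d)"] r d(1) by auto
          have "1 / real (Suc k) < dist (g (of_rat y *\<^sub>R q)) (L q)"
            using y by (intro d(2)) (auto simp: dist_real_def)
          moreover have "dist (G (of_rat y) q) (L q) \<le> 1 / real (Suc k)"
            using y r by (intro n) (auto simp: z_def)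
          moreover have "G (of_rat y) q = g (of_rat y *\<^sub>R q)"
          proof -
            have "0 \<le> (of_rat y :: real)" using y r z by linarith
            then show ?thesis using y by (simp add: G_def)
          qed
          ultimately show False by simp
        qed
      qed
      then have "\<forall>r>z. r < 1 \<longrightarrow> dist (g (r *\<^sub>R q)) (L q) < e" using k by fastforce
      then show "\<forall>\<^sub>F r in at_left 1. dist (g (r *\<^sub>R q)) (L q) < e"
        unfolding eventually_at_left_field using z(2) by blast
    qed
  next
    assume lim: "((\<lambda>r. g (r *\<^sub>R q)) \<longlongrightarrow> L q) (at_left 1)"
    show "C q" unfolding C_def
    proof
      fix k :: nat
      have "\<forall>\<^sub>F r in at_left 1. dist (g (r *\<^sub>R q)) (L q) < 1 / real (Suc k)"
        using lim by (rule tendstoD) simp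
      with eventually_at_left_1 have "\<forall>\<^sub>F r in at_left 1. dist (G r q) (L q) < 1 / real (Suc k)"
        by eventually_elim (simp add: G_def)
      then obtain z where z: "z < 1" "\<And>r. z < r \<Longrightarrow> r < 1 \<Longrightarrow> dist (G r q) (L q) < 1 / real (Suc k)"
        unfolding eventually_at_left_field by blast
      then obtain n where n: "1 / real (Suc n) < 1 - z" using nat_approx_posE[of "1 - z"] by auto
      have "dist (G (of_rat y) q) (L q) \<le> 1 / real (Suc k)"
        if "1 - 1 / real (Suc n) < of_rat y" "of_rat y < (1::real)" for y
        using that n by (intro less_imp_le z(2)) linarith+
      then show "\<exists>n::nat. \<forall>y::rat. 1 - 1 / real (Suc n) < of_rat y \<and> of_rat y < (1::real) \<longrightarrow>
          dist (G (of_rat y) q) (L q) \<le> 1 / real (Suc k)" by blast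
    qed
  qed
  \<comment> \<open>The value of \<^const>\<open>Lim\<close> when there is no limit.\<close>
  define c where "c = (THE l::quat. False)"
  have "boundary_value g q = (if C q then L q else c)" if q: "q \<in> space ?M" for q
  proof -
    from q have q': "q \<in> sphere 0 1" by (simp add: space_restrict_space)
    show ?thesis
    proof (cases "C q")
      case True
      then show ?thesis using C_iff[OF q'] by (simp add: boundary_value_def tendsto_Lim)
    next
      case False
      have "\<not> ((\<lambda>r. g (r *\<^sub>R q)) \<longlongrightarrow> l) (at_left 1)" for l
      proof
        assume l: "((\<lambda>r. g (r *\<^sub>R q)) \<longlongrightarrow> l) (at_left 1)"
        have "filterlim x (at_left 1) sequentially"
          using x x_lim by (simp add: filterlim_at less_imp_neq)
        then have "(\<lambda>n. g (x n *\<^sub>R q)) \<longlonglongrightarrow> l" by (rule filterlim_compose[OF l])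
        then have "(\<lambda>n. G (x n) q) \<longlonglongrightarrow> l" using x by (simp add: G_def)
        then have "L q = l" unfolding L_def by (rule limI)
        with l C_iff[OF q'] False show False by simp
      qed
      then have "(\<lambda>l. ((\<lambda>r. g (r *\<^sub>R q)) \<longlongrightarrow> l) (at_left 1)) = (\<lambda>l. False)" by blast
      then have "boundary_value g q = c" by (simp only: boundary_value_def t2_space_class.Lim_def c_def)
      then show ?thesis using False by simp
    qed
  qed
  moreover have "(\<lambda>q. if C q then L q else c) \<in> borel_measurable ?M"
  proof (rule measurable_If)
    show "{q \<in> space ?M. C q} \<in> sets ?M"
      unfolding C_def
    proof (intro sets.sets_Collect_countable_All sets.sets_Collect_countable_Ex)
      fix k n and y :: rat
      have "(\<lambda>q. dist (G (of_rat y) q) (L q)) \<in> borel_measurable ?M"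
        by (rule borel_measurable_dist[OF Gm Lm])
      then have "{q \<in> space ?M. dist (G (of_rat y) q) (L q) \<le> 1 / real (Suc k)} \<in> sets ?M"
        by (rule borel_measurable_le[OF _ borel_measurable_const])
      then show "{q \<in> space ?M. 1 - 1 / real (Suc n) < of_rat y \<and> of_rat y < (1::real) \<longrightarrow>
          dist (G (of_rat y) q) (L q) \<le> 1 / real (Suc k)} \<in> sets ?M"
      proof (cases "1 - 1 / real (Suc n) < of_rat y \<and> of_rat y < (1::real)")
        case False
        then have "{q \<in> space ?M. 1 - 1 / real (Suc n) < of_rat y \<and> of_rat y < (1::real) \<longrightarrow>
          dist (G (of_rat y) q) (L q) \<le> 1 / real (Suc k)} = space ?M" by blast
        then show ?thesis by (simp only: sets.top)
      qed (simp only: simp_thms)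
    qed
  qed (simp_all add: Lm)
  ultimately show ?thesis by (subst measurable_cong) 
qed


lemma continuous_on_power_series:
  assumes f: "has_power_series f a" and a: "\<And>n. norm (a n) \<le> B"
  shows "continuous_on (ball 0 1) f"
proof (rule continuous_at_imp_continuous_on, rule ballI)
  fix q0 :: quat assume "q0 \<in> ball 0 1"
  then obtain \<rho> where \<rho>: "norm q0 < \<rho>" "\<rho> < 1" using dense by auto
  then have \<rho>0: "0 \<le> \<rho>" using norm_ge_zero[of q0] by linarith
  have "continuous_on (ball 0 \<rho>) (\<lambda>q. \<Sum>n. q ^ n * a n)"
  proof (rule uniform_limit_theorem)
    show "uniform_limit (ball 0 \<rho>) (\<lambda>N q. \<Sum>n<N. q ^ n * a n) (\<lambda>q. \<Sum>n. q ^ n * a n) sequentially"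
    proof (rule Weierstrass_m_test)
      show "norm (q ^ n * a n) \<le> \<rho> ^ n * B" if "q \<in> ball 0 \<rho>" for n q
        using that a[of n] \<rho>0 unfolding norm_mult norm_power by (intro mult_mono power_mono) auto
      show "summable (\<lambda>n. \<rho> ^ n * B)"
        using \<rho> \<rho>0 by (intro summable_mult2 summable_geometric) simp
    qed
    show "\<forall>\<^sub>F N in sequentially. continuous_on (ball 0 \<rho>) (\<lambda>q. \<Sum>n<N. q ^ n * a n)"
      by (intro always_eventually allI continuous_intros)
  qed simp
  moreover have "(\<Sum>n. q ^ n * a n) = f q" if "q \<in> ball 0 \<rho>" for q
    using f that \<rho> unfolding has_power_series_def by (intro sums_unique[symmetric]) auto
  ultimately have "continuous_on (ball 0 \<rho>) f" by (rule continuous_on_eq)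
  then show "isCont f q0" using \<rho> by (auto simp: continuous_on_eq_continuous_at)
qed

text \<open>Uniqueness of real power series, which yields that of quaternionic ones by restriction to the real diameter and passing to
  components.\<close>

lemma real_power_series_zero:
  fixes c :: "nat \<Rightarrow> real"
  assumes "\<And>x. \<bar>x\<bar> < 1 \<Longrightarrow> (\<lambda>n. c n * x ^ n) sums 0"
  shows "c n = 0"
proof (induction n rule: less_induct)
  case (less n)
  have "((\<lambda>x::real. 0) \<longlongrightarrow> c (0 + n)) (at 0)"
  proof (rule powser_limit_0_strong[of 1 "\<lambda>k. c (k + n)" "\<lambda>x. 0"])
    fix x :: real assume x: "x \<noteq> 0" "norm x < 1"
    have "(\<lambda>k. c (k + n) * x ^ (k + n)) sums 0"
      by (subst sums_zero_iff_shift[of n "\<lambda>n. c n * x ^ n"]) (use less assms x in auto)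
    from sums_mult2[OF this, of "inverse (x ^ n)"] show "(\<lambda>k. c (k + n) * x ^ k) sums 0"
      using x by (simp add: power_add mult.assoc)
  qed simp
  then show ?case by (simp add: tendsto_const_iff)
qed

lemma has_power_series_unique:
  assumes f: "has_power_series f a" and g: "has_power_series f b"
  shows "a = b"
proof
  fix n
  show "a n = b n"
  proof (rule euclidean_eqI)
    fix i :: quat
    have "inner (a n - b n) i = 0"
    proof (rule real_power_series_zero[where c="\<lambda>n. inner (a n - b n) i"])
      fix x :: real assume x: "\<bar>x\<bar> < 1"
      then have "(of_real x :: quat) \<in> ball 0 1" by simp
      then have "(\<lambda>n. of_real x ^ n * a n - of_real x ^ n * b n) sums (f (of_real x) - f (of_real x))"
        using f g unfolding has_power_series_def by (intro sums_diff) auto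
      then have "(\<lambda>n. x ^ n *\<^sub>R (a n - b n)) sums 0"
        by (simp add: scaleR_conv_of_real right_diff_distrib)
      from bounded_linear.sums[OF bounded_linear_inner_left this, of i]
      show "(\<lambda>n. inner (a n - b n) i * x ^ n) sums 0" by (simp add: mult.commute)
    qed
    then show "inner (a n) i = inner (b n) i" by (simp add: inner_diff_left)
  qed
qed

lemma power_series_coeffs_eq:
  assumes "has_power_series f a" shows "power_series_coeffs f = a"
  unfolding power_series_coeffs_def using assms has_power_series_unique by (intro the_equality)

lemma regular_conj_has_power_series:
  assumes f: "has_power_series f a" and a: "\<And>n. norm (a n) \<le> B"
  shows "has_power_series (regular_conj f) (\<lambda>n. qcnj (a n))"
  unfolding has_power_series_def
proof
  fix q :: quat assume q: "q \<in> ball 0 1"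
  have "summable (\<lambda>n. norm q ^ n * B)"
    using q by (intro summable_mult2 summable_geometric) simp
  then have "summable (\<lambda>n. q ^ n * qcnj (a n))"
    by (rule summable_comparison_test') (simp add: norm_mult norm_power a mult_left_mono)
  then show "(\<lambda>n. q ^ n * qcnj (a n)) sums regular_conj f q"
    unfolding regular_conj_def power_series_coeffs_eq[OF f] by (rule summable_sums)
qed

lemma power_series_poisson:
  assumes f: "has_power_series f a" and U: "L2_series int a U" and I: "I \<in> imag_units"
    and r: "0 \<le> r" "r < 1"
  shows "f (r *\<^sub>R quat_cis I t) = stem_eval I ((1 / (2 * pi)) *\<^sub>R (\<integral>s. poisson r (t - s) *\<^sub>R U s \<partial>circ))"
proof -
  have "(\<lambda>n. stem_eval I (r ^ nat \<bar>int n\<bar> *\<^sub>R rot (of_int (int n) * t) (a n, 0))) sums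
      stem_eval I ((1 / (2 * pi)) *\<^sub>R (\<integral>s. poisson r (t - s) *\<^sub>R U s \<partial>circ))"
    by (rule bounded_linear.sums[OF bounded_linear_stem_eval L2_series_poisson[OF U r]])
  moreover have "stem_eval I (r ^ nat \<bar>int n\<bar> *\<^sub>R rot (of_int (int n) * t) (a n, 0)) = (r *\<^sub>R quat_cis I t) ^ n * a n" for n
    by (simp add: linear_scale[OF bounded_linear.linear[OF bounded_linear_stem_eval]] stem_eval_rot[OF I]
        quat_cis_power[OF I] scaleR_power) (simp add: stem_eval_def)
  moreover have "(\<lambda>n. (r *\<^sub>R quat_cis I t) ^ n * a n) sums f (r *\<^sub>R quat_cis I t)"
  proof -
    have "r *\<^sub>R quat_cis I t \<in> ball 0 1" using r norm_quat_cis[OF I, of t] by simp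
    then show ?thesis using f unfolding has_power_series_def by blast
  qed
  ultimately show ?thesis using sums_unique2 by simp
qed

text \<open>For almost every \<open>t\<close> the radial limits exist at \<open>exp (t I)\<close> for all \<open>I\<close> at once, because the stem does not depend on \<open>I\<close>.\<close>

theorem power_series_boundary_value:
  assumes f: "has_power_series f a" and U: "L2_series int a U"
  shows "AE t in circ. \<forall>I\<in>imag_units. boundary_value f (quat_cis I t) = stem_eval I (U t)"
  using poisson_integral_tendsto_AE[OF sq_integrable_imp_integrable[OF L2_seriesD[OF U]]]
proof eventually_elim
  case (elim t)
  show ?case
  proof
    fix I assume I: "I \<in> imag_units"
    have "((\<lambda>r. stem_eval I ((1 / (2 * pi)) *\<^sub>R (\<integral>s. poisson r (t - s) *\<^sub>R U s \<partial>circ))) \<longlongrightarrow>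
        stem_eval I ((1 / (2 * pi)) *\<^sub>R (2 * pi) *\<^sub>R U t)) (at_left 1)"
      by (intro bounded_linear.tendsto[OF bounded_linear_stem_eval] tendsto_scaleR tendsto_const elim)
    moreover have "\<forall>\<^sub>F r in at_left 1. stem_eval I ((1 / (2 * pi)) *\<^sub>R (\<integral>s. poisson r (t - s) *\<^sub>R U s \<partial>circ)) = f (r *\<^sub>R quat_cis I t)"
      using eventually_at_left_1 by eventually_elim (simp add: power_series_poisson[OF f U I])
    ultimately have "((\<lambda>r. f (r *\<^sub>R quat_cis I t)) \<longlongrightarrow> stem_eval I ((1 / (2 * pi)) *\<^sub>R (2 * pi) *\<^sub>R U t)) (at_left 1)"
      by (rule Lim_transform_eventually)
    then show "boundary_value f (quat_cis I t) = stem_eval I (U t)"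
      unfolding boundary_value_def by (subst tendsto_Lim) simp_all
  qed
qed

lemma power_series_boundary_stem:
  assumes f: "has_power_series f a" and U: "L2_series int a U" and a: "\<And>n. norm (a n) \<le> B"
  shows "boundary_stem (boundary_value f) U"
  unfolding boundary_stem_def
proof (intro conjI ballI)
  show "boundary_value f \<in> borel_measurable (restrict_space borel (sphere 0 1))"
    by (rule boundary_value_measurable[OF continuous_on_power_series[OF f a]])
  show "AE t in circ. boundary_value f (quat_cis I t) = stem_eval I (U t)" if "I \<in> imag_units" for I
    using power_series_boundary_value[OF f U] by eventually_elim (use that in blast)
qed

lemma boundary_value_tilde: "boundary_value (tilde f) q = boundary_value f (qcnj q)"
  by (simp add: boundary_value_def tilde_def linear_scale[OF linear_qcnj])

lemma tilde_boundary_stem: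
  assumes "boundary_stem (boundary_value f) U"
  shows "boundary_stem (boundary_value (tilde f)) (\<lambda>t. stem_mirror (U t))"
  unfolding boundary_stem_def boundary_value_tilde[abs_def]
proof (intro conjI ballI)
  have "qcnj \<in> restrict_space borel (sphere 0 1) \<rightarrow>\<^sub>M restrict_space borel (sphere 0 1)"
    by (intro measurable_restrict_space3 borel_measurable_continuous_onI
        linear_continuous_on bounded_linear_qcnj) auto
  then show "(\<lambda>q. boundary_value f (qcnj q)) \<in> borel_measurable (restrict_space borel (sphere 0 1))"
    using assms unfolding boundary_stem_def by (blast intro: measurable_compose)
  fix I assume I: "I \<in> imag_units"
  then have "AE t in circ. boundary_value f (quat_cis (- I) t) = stem_eval (- I) (U t)"
    using assms imag_units_uminus unfolding boundary_stem_def by blast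
  then show "AE t in circ. boundary_value f (qcnj (quat_cis I t)) = stem_eval I (stem_mirror (U t))"
    by (simp add: qcnj_quat_cis[OF I] quat_cis_uminus stem_eval_uminus)
qed

section \<open>Inner functions and unimodular stems\<close>

lemma norm_stem_eval_sq:
  assumes I: "I \<in> imag_units"
  shows "(norm (stem_eval I u))\<^sup>2 = (norm (fst u))\<^sup>2 + (norm (snd u))\<^sup>2 +
    2 * inner I (fst u * qcnj (snd u))"
proof -
  have "inner (fst u) (I * snd u) = inner I (fst u * qcnj (snd u))"
    using I by (simp add: imag_units_iff inner_quat_def algebra_simps)
  moreover have "norm (I * snd u) = norm (snd u)"
    by (simp add: norm_mult norm_imag_unit[OF I])
  moreover have "(norm (x + y))\<^sup>2 = (norm x)\<^sup>2 + (norm y)\<^sup>2 + 2 * inner x y" for x y :: quat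
    by (simp add: power2_norm_eq_inner inner_add_left inner_add_right inner_commute)
  ultimately show ?thesis unfolding stem_eval_def by simp
qed

text \<open>The condition for \<open>u = a + \<iota> b\<close> that \<open>|a + I b| = 1\<close> for all imaginary units \<open>I\<close>: one has \<open>|a|\<^sup>2 + |b|\<^sup>2 = 1\<close>,
  and the product of \<open>a\<close> with the conjugate of \<open>b\<close> is real.\<close>

definition unimodular_stem :: "quat \<times> quat \<Rightarrow> bool" where
  "unimodular_stem u \<longleftrightarrow> (norm (fst u))\<^sup>2 + (norm (snd u))\<^sup>2 = 1 \<and> fst u * qcnj (snd u) = snd u * qcnj (fst u)"

lemma unimodular_stem_iff_product:
  "unimodular_stem u \<longleftrightarrow> stem_mult (stem_mirror u) (stem_cnj u) = (1, 0)"
  by (simp add: unimodular_stem_def stem_mult_def stem_mirror_def stem_cnj_def mult_qcnj flip: of_real_add of_real_power)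

lemma unimodular_stem_imp_product:
  assumes "unimodular_stem u"
  shows "stem_mult (stem_cnj u) (stem_mirror u) = (1, 0)"
proof -
  obtain a b where u: "u = (a, b)" by fastforce
  from assms have n: "(norm a)\<^sup>2 + (norm b)\<^sup>2 = 1" and c: "a * qcnj b = b * qcnj a"
    by (simp_all add: unimodular_stem_def u)
  have "qcnj b * a = qcnj a * b"
  proof (cases "a = 0")
    case False
    have "qcnj a * (a * qcnj b) * a = qcnj a * (b * qcnj a) * a" by (simp only: c)
    then have "(qcnj a * a) * (qcnj b * a) = (qcnj a * b) * (qcnj a * a)" by (simp only: mult.assoc)
    then have "((norm a)\<^sup>2) *\<^sub>R (qcnj b * a) = ((norm a)\<^sup>2) *\<^sub>R (qcnj a * b)"
      unfolding mult_qcnj of_real_def by simp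
    then show ?thesis using False by simp
  qed (simp add: linear_0[OF linear_qcnj])
  moreover have "(of_real ((norm a)\<^sup>2) + of_real ((norm b)\<^sup>2) :: quat) = 1"
    unfolding of_real_add[symmetric] n by simp
  ultimately show ?thesis
    by (simp add: u stem_mult_def stem_mirror_def stem_cnj_def mult_qcnj)
qed

lemma unimodular_stem_norm:
  assumes "unimodular_stem u" "I \<in> imag_units"
  shows "norm (stem_eval I u) = 1"
proof -
  let ?c = "fst u * qcnj (snd u)"
  have "qcnj ?c = ?c" using assms(1) by (simp add: unimodular_stem_def qcnj_mult) (simp add: quat_eq_iff)
  then have "inner I ?c = 0" using assms(2) by (simp add: quat_eq_iff imag_units_iff inner_quat_def del: quat_mult_simps)
  then have "(norm (stem_eval I u))\<^sup>2 = 1"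
    using norm_stem_eval_sq[OF assms(2), of u] assms(1) by (simp add: unimodular_stem_def)
  then show ?thesis by (simp add: power2_eq_1_iff) (smt (verit) norm_ge_zero)
qed

text \<open>On a single circle the equation \<open>p + I q = 1\<close> does not give \<open>p = 1\<close> and \<open>q = 0\<close>, since \<open>p - 1\<close> and \<open>I q\<close> may cancel.
  The equation at the conjugate point rules this out.\<close>

lemma stem_eval_eq_1:
  assumes I: "I \<in> imag_units" and "stem_eval I w = 1" "stem_eval I (stem_mirror w) = 1"
  shows "w = (1, 0)"
proof -
  have 1: "fst w + I * snd w = 1" "fst w - I * snd w = 1"
    using assms by (simp_all add: stem_eval_def stem_mirror_def)
  have "2 *\<^sub>R fst w = (fst w + I * snd w) + (fst w - I * snd w)" by (simp add: scaleR_2)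
  also have "\<dots> = 2 *\<^sub>R 1" unfolding 1 by (simp add: scaleR_2)
  finally have f: "fst w = 1" by (simp only: scaleR_cancel_left) simp
  with 1(1) have "I * snd w = 0" by simp
  moreover have "I \<noteq> 0" using norm_imag_unit[OF I] by auto
  ultimately show ?thesis using f by (simp add: prod_eq_iff)
qed

lemma continuous_imag_unit_of_angles: "continuous_on UNIV imag_unit_of_angles"
proof -
  have "imag_unit_of_angles = (\<lambda>x. (sin (fst x) * cos (snd x)) *\<^sub>R Quat 0 1 0 0 +
     (sin (fst x) * sin (snd x)) *\<^sub>R Quat 0 0 1 0 + cos (fst x) *\<^sub>R Quat 0 0 0 1)"
    by (auto simp: imag_unit_of_angles_def fun_eq_iff quat_eq_iff)
  moreover have "continuous_on UNIV \<dots>" by (intro continuous_intros)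
  ultimately show ?thesis by metis
qed

text \<open>A continuous function that vanishes almost everywhere on the 2-sphere vanishes off the meridian and the poles excluded by
  the open parameter rectangle; this is enough for the evaluations below.\<close>

lemma AE_imag_units_area_angles:
  fixes h :: "quat \<Rightarrow> real"
  assumes h: "continuous_on UNIV h" and ae: "AE I in imag_units_area. h I = 0"
    and \<theta>: "0 < \<theta>" "\<theta> < pi" and \<phi>: "0 < \<phi>" "\<phi> < 2 * pi"
  shows "h (imag_unit_of_angles (\<theta>, \<phi>)) = 0"
proof -
  let ?S = "{0..pi} \<times> {0..<2 * pi} :: (real \<times> real) set"
  let ?R = "{0<..<pi} \<times> {0<..<2 * pi} :: (real \<times> real) set"
  define N where "N = {x \<in> ?R. h (imag_unit_of_angles x) \<noteq> 0}"
  have S: "?S \<in> sets lborel" unfolding sets_lborel borel_prod[symmetric] by (intro pair_measureI) auto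
  have m: "(\<lambda>(\<theta>, \<phi>). ennreal (sin \<theta>)) \<in> borel_measurable (restrict_space lborel ?S)"
  proof (rule measurable_restrict_space1)
    have "(\<lambda>x::real \<times> real. sin (fst x)) \<in> borel_measurable borel"
      by (intro borel_measurable_continuous_onI continuous_intros)
    then show "(\<lambda>(\<theta>, \<phi> :: real). ennreal (sin \<theta>)) \<in> borel_measurable lborel"
      by (simp add: case_prod_beta)
  qed
  have meas: "imag_unit_of_angles \<in> density (restrict_space lborel ?S) (\<lambda>(\<theta>, \<phi>). ennreal (sin \<theta>)) \<rightarrow>\<^sub>M restrict_space borel imag_units"
    using imag_unit_of_angles_measurable[of ?S] by (simp add: measurable_density_eq1)
  have "AE x in density (restrict_space lborel ?S) (\<lambda>(\<theta>, \<phi>). ennreal (sin \<theta>)). h (imag_unit_of_angles x) = 0"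
    using AE_distrD[OF meas ae[unfolded imag_units_area_def]] .
  then have "AE x in lborel. x \<in> ?S \<longrightarrow> 0 < (case x of (\<theta>, \<phi>) \<Rightarrow> ennreal (sin \<theta>)) \<longrightarrow> h (imag_unit_of_angles x) = 0"
    unfolding AE_density[OF m] using S by (subst (asm) AE_restrict_space_iff) auto
  then have "AE x in lborel. x \<notin> N"
    by eventually_elim (auto simp: N_def sin_gt_zero)
  moreover have oN: "open N"
  proof -
    have "open (?R \<inter> (\<lambda>x. h (imag_unit_of_angles x)) -` (- {0}))"
      by (intro open_Int open_Times open_vimage continuous_on_compose2[OF h continuous_imag_unit_of_angles])
        (auto simp: open_Compl)
    moreover have "N = ?R \<inter> (\<lambda>x. h (imag_unit_of_angles x)) -` (- {0})" by (auto simp: N_def)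
    ultimately show ?thesis by simp
  qed
  moreover have "N \<in> sets lborel" using oN by simp
  ultimately have "N \<in> null_sets lborel" by (simp add: AE_iff_null_sets)
  then have "negligible N" by (simp add: negligible_iff_null_sets null_sets_completionI)
  with oN have "N = {}" using open_not_negligible by blast
  then show ?thesis using \<theta> \<phi> by (auto simp: N_def)
qed

text \<open>By the formula for \<open>|a + I b|\<^sup>2\<close> the hypothesis is an affine equation in \<open>I\<close> that holds almost everywhere on the
  2-sphere.  Evaluation at four affinely independent points shows that all its coefficients vanish.\<close>

lemma AE_norm_stem_eval_imp_unimodular:
  assumes ae: "AE I in imag_units_area. norm (stem_eval I u) = 1"
  shows "unimodular_stem u"
proof -
  let ?c = "fst u * qcnj (snd u)"
  define s where "s = (norm (fst u))\<^sup>2 + (norm (snd u))\<^sup>2 - 1"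
  define h where "h I = norm (stem_eval I u) - 1" for I
  have hc: "continuous_on UNIV h"
    unfolding h_def stem_eval_def by (intro continuous_intros)
  have "AE I in imag_units_area. h I = 0" using ae by eventually_elim (simp add: h_def)
  note ang = AE_imag_units_area_angles[OF hc this]
  have eq: "s + 2 * (sin \<theta> * cos \<phi> * qIm1 ?c + sin \<theta> * sin \<phi> * qIm2 ?c + cos \<theta> * qIm3 ?c) = 0"
    if "0 < \<theta>" "\<theta> < pi" "0 < \<phi>" "\<phi> < 2 * pi" for \<theta> \<phi>
  proof -
    let ?I = "imag_unit_of_angles (\<theta>, \<phi>)"
    have "(norm (stem_eval ?I u))\<^sup>2 = 1" using ang[OF that] by (simp add: h_def)
    then show ?thesis
      unfolding norm_stem_eval_sq[OF imag_unit_of_angles_in]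
      by (simp add: s_def imag_unit_of_angles_def inner_quat_def algebra_simps)
  qed
  have pi3: "pi / 2 < 2 * pi" "3 * pi / 2 < 2 * pi" "0 < pi" by simp_all
  have s2: "sin (3 * pi / 2) = -1" "cos (3 * pi / 2) = 0"
    using sin_add[of pi "pi / 2"] cos_add[of pi "pi / 2"] by (simp_all add: field_simps)
  \<comment> \<open>The points are \<open>j\<close>, \<open>-j\<close>, \<open>-i\<close>, and one outside the plane of \<open>i\<close> and \<open>j\<close>.\<close>
  have e1: "s + 2 * qIm2 ?c = 0" using eq[of "pi / 2" "pi / 2"] by simp
  have e2: "s - 2 * qIm2 ?c = 0" using eq[of "pi / 2" "3 * pi / 2"] pi3 s2 by simp
  have e3: "s - 2 * qIm1 ?c = 0" using eq[of "pi / 2" pi] by simp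
  have s0: "s = 0" "qIm2 ?c = 0" "qIm1 ?c = 0" using e1 e2 e3 by linarith+
  have e4: "s + 2 * (sin (pi / 3) * qIm2 ?c + cos (pi / 3) * qIm3 ?c) = 0"
    using eq[of "pi / 3" "pi / 2"] by simp
  then have s3: "qIm3 ?c = 0" unfolding s0 by (simp add: cos_60)
  have "qcnj ?c = ?c" using s0 s3 by (simp add: quat_eq_iff del: quat_mult_simps)
  then have "?c = snd u * qcnj (fst u)" by (simp add: qcnj_mult) (simp add: quat_eq_iff)
  with s0(1) show ?thesis by (simp add: unimodular_stem_def s_def)
qed

lemma AE_scale_measure:
  assumes "c \<noteq> 0"
  shows "(AE x in scale_measure c M. P x) \<longleftrightarrow> (AE x in M. P x)"
  using assms by (simp add: eventually_ae_filter null_sets_def space_scale_measure)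

lemma finite_measure_imag_units_area: "finite_measure imag_units_area"
  using emeasure_imag_units_area by (intro finite_measureI) auto

lemma space_imag_units_area: "space imag_units_area = imag_units"
  by (simp add: imag_units_area_def space_restrict_space)

text \<open>Fubini's theorem for null sets, in both orders of the variables.  The first order is needed to vary \<open>I\<close> for a fixed angle,
  the second one to select a single circle.\<close>

lemma AE_boundary_measure_iff:
  assumes P: "{q \<in> sphere 0 1. P q} \<in> sets (restrict_space borel (sphere 0 1))"
  shows "(AE q in boundary_measure. P q) \<longleftrightarrow> (AE t in circ. AE I in imag_units_area. P (quat_cis I t))"
    and "(AE q in boundary_measure. P q) \<longleftrightarrow> (AE I in imag_units_area. AE t in circ. P (quat_cis I t))"
proof -
  interpret C: finite_measure circ by (rule finite_measure_circ)
  interpret A: finite_measure imag_units_area by (rule finite_measure_imag_units_area)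
  interpret pair_sigma_finite circ imag_units_area ..
  let ?M = "circ \<Otimes>\<^sub>M imag_units_area"
  let ?f = "\<lambda>(t, I). quat_cis I t"
  have P': "{q \<in> space (restrict_space borel (sphere 0 1)). P q} \<in> sets (restrict_space borel (sphere 0 1))"
    using P by (simp add: space_restrict_space)
  have "?f -` {q \<in> space (restrict_space borel (sphere 0 1)). P q} \<inter> space ?M \<in> sets ?M"
    by (rule measurable_sets[OF quat_cis_pair_measurable P'])
  moreover have "?f -` {q \<in> space (restrict_space borel (sphere 0 1)). P q} \<inter> space ?M = {x \<in> space ?M. P (?f x)}"
    using measurable_space[OF quat_cis_pair_measurable] by auto
  ultimately have m: "{x \<in> space ?M. P (?f x)} \<in> sets ?M" by simp
  have "ennreal (1 / (2 * pi * (4 * pi))) \<noteq> 0" by simp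
  then have "(AE q in boundary_measure. P q) \<longleftrightarrow> (AE q in distr ?M (restrict_space borel (sphere 0 1)) ?f. P q)"
    unfolding boundary_measure_def by (rule AE_scale_measure)
  also have "\<dots> \<longleftrightarrow> (AE x in ?M. P (?f x))"
    by (rule AE_distr_iff[OF quat_cis_pair_measurable P'])
  also have "\<dots> \<longleftrightarrow> (AE t in circ. AE I in imag_units_area. P (quat_cis I t))"
    using AE_pair[of "\<lambda>x. P (?f x)"] AE_pair_measure[OF m] by auto
  finally show 1: "(AE q in boundary_measure. P q) \<longleftrightarrow> (AE t in circ. AE I in imag_units_area. P (quat_cis I t))" .
  show "(AE q in boundary_measure. P q) \<longleftrightarrow> (AE I in imag_units_area. AE t in circ. P (quat_cis I t))"
    unfolding 1 using m by (intro AE_commute) (simp add: case_prod_beta)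
qed

lemma AE_imag_units_area_obtain:
  assumes "AE I in imag_units_area. P I"
  obtains I where "I \<in> imag_units" "P I"
proof (rule ccontr)
  assume "\<not> thesis"
  with that have "\<And>I. I \<in> imag_units \<Longrightarrow> \<not> P I" by blast
  with assms have "AE I in imag_units_area. False"
    by (subst AE_cong[where Q=P]) (simp_all add: space_imag_units_area)
  then have "emeasure imag_units_area (space imag_units_area) = 0"
    by (subst (asm) AE_iff_measurable[OF _ refl]) simp_all
  then show False by (simp add: emeasure_imag_units_area)
qed

lemma AE_circle_measure_iff:
  assumes I: "I \<in> imag_units" and P: "{q \<in> sphere 0 1. P q} \<in> sets (restrict_space borel (sphere 0 1))"
  shows "(AE q in circle_measure I. P q) \<longleftrightarrow> (AE t in circ. P (quat_cis I t))"
  unfolding circle_measure_def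
proof (rule AE_distr_iff[OF quat_cis_measurable[OF I]])
  have "(\<lambda>q. q) \<in> restrict_space borel (sphere 0 1 \<inter> slice I) \<rightarrow>\<^sub>M restrict_space borel (sphere (0::quat) 1)"
    by (intro measurable_restrict_space3) auto
  from measurable_sets[OF this P]
  show "{q \<in> space (restrict_space borel (sphere 0 1 \<inter> slice I)). P q} \<in> sets (restrict_space borel (sphere 0 1 \<inter> slice I))"
    by (rule back_subst[where P="\<lambda>X. X \<in> _"]) (auto simp: space_restrict_space)
qed

lemma quat_polar:
  obtains I t where "I \<in> imag_units" "q = norm q *\<^sub>R quat_cis I t"
proof -
  define v where "v = q - of_real (qRe q)"
  define I where "I = (if v = 0 then Quat 0 1 0 0 else inverse (norm v) *\<^sub>R v)"
  have v: "qRe v = 0" by (simp add: v_def)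
  have n2: "(norm q)\<^sup>2 = (qRe q)\<^sup>2 + (norm v)\<^sup>2"
    unfolding norm_quat_sq by (simp add: v_def)
  have I: "I \<in> imag_units"
  proof (cases "v = 0")
    case False
    then have "(norm v)\<^sup>2 \<noteq> 0" by simp
    moreover have "(norm v)\<^sup>2 = (qIm1 v)\<^sup>2 + (qIm2 v)\<^sup>2 + (qIm3 v)\<^sup>2" by (simp add: norm_quat_sq v)
    ultimately show ?thesis using False
      by (simp add: I_def imag_units_iff v power_mult_distrib power_inverse flip: distrib_left)
  qed (simp add: I_def imag_units_nonempty)
  have vI: "v = norm v *\<^sub>R I" by (simp add: I_def)
  show ?thesis
  proof (cases "q = 0")
    case False
    have "(qRe q / norm q)\<^sup>2 + (norm v / norm q)\<^sup>2 = 1"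
      unfolding power_divide add_divide_distrib[symmetric] n2[symmetric] using False by simp
    then obtain t where t: "qRe q / norm q = cos t" "norm v / norm q = sin t"
      using sincos_total_pi[of "norm v / norm q" "qRe q / norm q"] by auto
    have "norm q *\<^sub>R quat_cis I t = of_real (norm q * cos t) + (norm q * sin t) *\<^sub>R I"
      by (simp add: quat_cis_def of_real_def algebra_simps)
    also have "norm q * cos t = qRe q" using False by (simp add: t(1)[symmetric])
    also have "norm q * sin t = norm v" using False by (simp add: t(2)[symmetric])
    also have "of_real (qRe q) + norm v *\<^sub>R I = q" using vI by (simp add: v_def)
    finally show ?thesis using that[OF I, of t] by simp
  qed (use that[OF I, of 0] in simp)
qed

text \<open>The maximum principle for boundary values of modulus \<open>1\<close>: the values in the ball are Poisson means of the boundary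
  values on a circle.\<close>

lemma power_series_norm_le_1:
  assumes f: "has_power_series f a" and U: "L2_series int a U"
    and uni: "AE t in circ. unimodular_stem (U t)" and q: "q \<in> ball 0 1"
  shows "norm (f q) \<le> 1"
proof -
  obtain I t where I: "I \<in> imag_units" and qeq: "q = norm q *\<^sub>R quat_cis I t" by (rule quat_polar)
  let ?r = "norm q"
  have r: "0 \<le> ?r" "?r < 1" using q by simp_all
  have Ui: "integrable circ U" by (rule sq_integrable_imp_integrable[OF L2_seriesD[OF U]])
  have i: "integrable circ (\<lambda>s. poisson ?r (t - s) *\<^sub>R U s)" by (rule integrable_poisson[OF r Ui])
  let ?g = "\<lambda>s. stem_eval I (poisson ?r (t - s) *\<^sub>R U s)"
  have gi: "integrable circ ?g" by (rule integrable_bounded_linear[OF bounded_linear_stem_eval i])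
  have sc: "stem_eval I (c *\<^sub>R u) = c *\<^sub>R stem_eval I u" for c u
    by (rule linear_scale[OF bounded_linear.linear[OF bounded_linear_stem_eval]])
  have "f q = f (?r *\<^sub>R quat_cis I t)" using qeq by (rule arg_cong)
  also have "\<dots> = (1 / (2 * pi)) *\<^sub>R stem_eval I (\<integral>s. poisson ?r (t - s) *\<^sub>R U s \<partial>circ)"
    unfolding power_series_poisson[OF f U I r] by (rule sc)
  also have "\<dots> = (1 / (2 * pi)) *\<^sub>R (\<integral>s. ?g s \<partial>circ)"
    by (simp only: integral_bounded_linear[OF bounded_linear_stem_eval i])
  finally have "f q = (1 / (2 * pi)) *\<^sub>R (\<integral>s. ?g s \<partial>circ)" .
  then have eq: "norm (f q) = norm (\<integral>s. ?g s \<partial>circ) / (2 * pi)" by simp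
  have "norm (\<integral>s. ?g s \<partial>circ) \<le> (\<integral>s. norm (?g s) \<partial>circ)" by (rule integral_norm_bound)
  also have "(\<integral>s. norm (?g s) \<partial>circ) = (\<integral>s. poisson ?r (t - s) \<partial>circ)"
  proof (rule integral_cong_AE)
    show "(\<lambda>s. norm (?g s)) \<in> borel_measurable circ"
      using borel_measurable_integrable[OF integrable_norm[OF gi]] .
    show "(\<lambda>s. poisson ?r (t - s)) \<in> borel_measurable circ"
      by (intro measurable_circ measurable_compose[OF _ poisson_measurable]) simp
    show "AE s in circ. norm (?g s) = poisson ?r (t - s)"
      using uni by eventually_elim (use r in \<open>simp add: sc unimodular_stem_norm I poisson_nonneg\<close>)
  qed
  also have "\<dots> = 2 * pi" by (rule integral_poisson[OF r])
  finally show ?thesis unfolding eq by simp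
qed

theorem proposition3p1:
  fixes f :: "quat \<Rightarrow> quat"
  assumes "f \<in> hardy2"
  shows "(inner_function f \<longleftrightarrow>
            (AE q in boundary_measure.
               (boundary_value (tilde f) \<star> boundary_value (regular_conj f)) q = 1 \<and>
               (boundary_value (regular_conj f) \<star> boundary_value (tilde f)) q = 1)) \<and>
         (inner_function f \<longleftrightarrow>
            (\<exists>I\<in>imag_units. AE q in circle_measure I.
               (boundary_value (tilde f) \<star> boundary_value (regular_conj f)) q = 1 \<and>
               (boundary_value (regular_conj f) \<star> boundary_value (tilde f)) q = 1))"
proof -
  \<comment> \<open>The function has stem \<open>U = A + \<iota> B\<close>; its two companions have the stems \<open>A - \<iota> B\<close> and \<open>qcnj A + \<iota> qcnj B\<close>.\<close>
  obtain a where reg: "slice_regular f" and f: "has_power_series f a" and a: "summable (\<lambda>n. (norm (a n))\<^sup>2)"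
    using assms by (auto simp: hardy2_def)
  have inj: "inj int" "inj (\<lambda>n. - int n)" by (auto simp: inj_on_def)
  obtain U where U: "L2_series int a U" using L2_series_exists[OF inj(1) a] by blast
  have "(\<lambda>n. (norm (a n))\<^sup>2) \<longlonglongrightarrow> 0" by (rule summable_LIMSEQ_zero[OF a])
  then have "Bseq (\<lambda>n. (norm (a n))\<^sup>2)" by (intro convergent_imp_Bseq convergentI)
  then obtain B where B: "\<And>n. norm ((norm (a n))\<^sup>2) \<le> B" unfolding Bseq_def by blast
  have aB: "norm (a n) \<le> sqrt B" for n using B[of n] by (simp add: real_le_rsqrt)
  let ?F = "boundary_value (tilde f)" and ?G = "boundary_value (regular_conj f)"
  have bvf: "boundary_stem (boundary_value f) U" by (rule power_series_boundary_stem[OF f U aB])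
  have F: "boundary_stem ?F (\<lambda>t. stem_mirror (U t))" by (rule tilde_boundary_stem[OF bvf])
  have FL: "L2_series (\<lambda>n. - int n) a (\<lambda>t. stem_mirror (U t))"
    by (rule L2_series_image[OF U linear_stem_mirror]) (simp_all add: stem_mirror_rot)
  have GL: "L2_series int (\<lambda>n. qcnj (a n)) (\<lambda>t. stem_cnj (U t))"
    by (rule L2_series_image[OF U linear_stem_cnj]) (simp_all add: stem_cnj_rot)
  have ga: "summable (\<lambda>n. (norm (qcnj (a n)))\<^sup>2)" using a by simp
  have "has_power_series (regular_conj f) (\<lambda>n. qcnj (a n))"
    by (rule regular_conj_has_power_series[OF f aB])
  moreover have "norm (qcnj (a n)) \<le> sqrt B" for n by (simp add: aB)
  ultimately have G: "boundary_stem ?G (\<lambda>t. stem_cnj (U t))"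
    by (rule power_series_boundary_stem[OF _ GL])
  let ?W1 = "\<lambda>t. stem_mult (stem_mirror (U t)) (stem_cnj (U t))"
  let ?W2 = "\<lambda>t. stem_mult (stem_cnj (U t)) (stem_mirror (U t))"
  have FG: "boundary_stem (?F \<star> ?G) ?W1" by (rule slice_prod_stem[OF F FL inj(2) a G GL inj(1) ga])
  have GF: "boundary_stem (?G \<star> ?F) ?W2" by (rule slice_prod_stem[OF G GL inj(1) ga F FL inj(2) a])
  let ?P = "\<lambda>q. (?F \<star> ?G) q = 1 \<and> (?G \<star> ?F) q = 1"
  have Pm: "{q \<in> sphere 0 1. ?P q} \<in> sets (restrict_space borel (sphere 0 1))"
  proof -
    have "(?F \<star> ?G) -` {1} \<inter> space (restrict_space borel (sphere 0 1)) \<in> sets (restrict_space borel (sphere 0 1))"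
      "(?G \<star> ?F) -` {1} \<inter> space (restrict_space borel (sphere 0 1)) \<in> sets (restrict_space borel (sphere 0 1))"
      using FG GF unfolding boundary_stem_def by (blast intro: measurable_sets borel_closed closed_singleton)+
    from sets.Int[OF this] show ?thesis
      by (rule back_subst[where P="\<lambda>X. X \<in> _"]) (auto simp: space_restrict_space)
  qed
  have Nm: "{q \<in> sphere 0 1. norm (boundary_value f q) = 1} \<in> sets (restrict_space borel (sphere 0 1))"
  proof -
    have "(\<lambda>q. norm (boundary_value f q)) \<in> borel_measurable (restrict_space borel (sphere 0 1))"
      using bvf unfolding boundary_stem_def by (blast intro: measurable_compose[OF _ borel_measurable_norm])
    from measurable_sets[OF this, of "{1}"] show ?thesis
      by (rule back_subst[where P="\<lambda>X. X \<in> _"]) (auto simp: space_restrict_space)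
  qed
  \<comment> \<open>All three conditions of the theorem are compared with this one.\<close>
  let ?uni = "AE t in circ. unimodular_stem (U t)"
  have inner_uni: "?uni" if "inner_function f"
  proof -
    have "AE q in boundary_measure. norm (boundary_value f q) = 1"
      using that by (simp add: inner_function_def)
    then have "AE t in circ. AE I in imag_units_area. norm (boundary_value f (quat_cis I t)) = 1"
      unfolding AE_boundary_measure_iff(1)[OF Nm] .
    with power_series_boundary_value[OF f U] show ?thesis
    proof eventually_elim
      case (elim t)
      have "AE I in imag_units_area. norm (stem_eval I (U t)) = 1"
        using elim(2)
      proof (rule AE_mp, intro AE_I2 impI)
        fix I assume "I \<in> space imag_units_area" "norm (boundary_value f (quat_cis I t)) = 1"
        then show "norm (stem_eval I (U t)) = 1" using elim(1) by (simp add: space_imag_units_area)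
      qed
      then show ?case by (rule AE_norm_stem_eval_imp_unimodular)
    qed
  qed
  have uni_inner: "inner_function f" if uni: ?uni
  proof -
    have le: "norm (f q) \<le> 1" if "q \<in> ball 0 1" for q
      by (rule power_series_norm_le_1[OF f U uni that])
    then have "bounded (f ` ball 0 1)" unfolding bounded_iff by blast
    moreover have "AE t in circ. AE I in imag_units_area. norm (boundary_value f (quat_cis I t)) = 1"
      using power_series_boundary_value[OF f U] uni
      by eventually_elim (intro AE_I2, simp add: space_imag_units_area unimodular_stem_norm)
    ultimately show ?thesis
      using le reg unfolding inner_function_def hardy_inf_def AE_boundary_measure_iff(1)[OF Nm] by blast
  qed
  have uni_circle: "AE t in circ. ?P (quat_cis I t)" if ?uni "I \<in> imag_units" for I
  proof -
    have "AE t in circ. (?F \<star> ?G) (quat_cis I t) = stem_eval I (?W1 t)"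
      "AE t in circ. (?G \<star> ?F) (quat_cis I t) = stem_eval I (?W2 t)"
      using FG GF that(2) by (simp_all add: boundary_stem_def)
    with that(1) show ?thesis
    proof eventually_elim
      case (elim t)
      then show ?case
        using unimodular_stem_imp_product[of "U t"]
        by (simp add: unimodular_stem_iff_product) (simp add: stem_eval_def)
    qed
  qed
  have circle_uni: "?uni" if I: "I \<in> imag_units" and ae: "AE t in circ. ?P (quat_cis I t)" for I
  proof -
    have "AE t in circ. (?F \<star> ?G) (quat_cis I t) = stem_eval I (?W1 t)"
      using FG I by (simp add: boundary_stem_def)
    with ae have W: "AE t in circ. stem_eval I (?W1 t) = 1" by eventually_elim simp
    show ?thesis
      using W AE_circ_reflect[OF W] L2_series_parity[OF FL] L2_series_parity[OF GL]
    proof eventually_elim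
      case (elim t)
      have "?W1 (2 * pi - t) = stem_mirror (?W1 t)"
        unfolding elim(3,4) stem_mirror_mult ..
      then have "?W1 t = (1, 0)" using stem_eval_eq_1[OF I elim(1)] elim(2) by simp
      then show ?case by (simp add: unimodular_stem_iff_product)
    qed
  qed
  have 1: "inner_function f \<longleftrightarrow> (\<exists>I\<in>imag_units. AE q in circle_measure I. ?P q)"
  proof
    assume "inner_function f"
    then have "AE t in circ. ?P (quat_cis (Quat 0 1 0 0) t)"
      by (intro uni_circle inner_uni imag_units_nonempty)
    then show "\<exists>I\<in>imag_units. AE q in circle_measure I. ?P q"
      using imag_units_nonempty AE_circle_measure_iff[OF imag_units_nonempty Pm] by blast
  next
    assume "\<exists>I\<in>imag_units. AE q in circle_measure I. ?P q"
    then obtain I where "I \<in> imag_units" "AE q in circle_measure I. ?P q" by blast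
    then show "inner_function f"
      using circle_uni uni_inner AE_circle_measure_iff[OF _ Pm] by blast
  qed
  have 2: "inner_function f \<longleftrightarrow> (AE q in boundary_measure. ?P q)"
  proof
    assume "inner_function f"
    then show "AE q in boundary_measure. ?P q"
      unfolding AE_boundary_measure_iff(2)[OF Pm]
      by (intro AE_I2 uni_circle inner_uni) (simp_all add: space_imag_units_area)
  next
    assume "AE q in boundary_measure. ?P q"
    then have "AE I in imag_units_area. AE t in circ. ?P (quat_cis I t)"
      unfolding AE_boundary_measure_iff(2)[OF Pm] .
    then obtain I where "I \<in> imag_units" "AE t in circ. ?P (quat_cis I t)"
      by (rule AE_imag_units_area_obtain)
    then show "inner_function f" using circle_uni uni_inner by blast
  qed
  from 1 2 show ?thesis by blast
qed

end
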